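(* Let $N\ge 1$, $s\in(0,1)$, and let $f:(0,\infty)\times\mathbb{R}^N\times\mathbb{R}\to\mathbb{R}$ be a Carathéodory function with $f(t,x,r)r\ge 0$ for all $(t,x,r)$. Let $u$ be a nonnegative classical solution of $$\partial_t u+(-\Delta)^s u+f(t,x,u)=0\quad\text{in } Q_\infty=(0,\infty)\times\mathbb{R}^N,$$ and let $$\mathcal R_u=\Big\{z\in\mathbb{R}^N:\ \exists\,\rho>0\ \text{s.t.}\ \int_0^1\!\!\int_{B_\rho(z)} f(t,x,u(t,x))\,dx\,dt<+\infty\Big\}.$$ Then there exists a nonnegative Radon measure $\nu_u$ on $\mathcal R_u$ such that $$\lim_{t\to 0}\int_{\mathcal R_u}u(t,x)\zeta(x)\,dx=\int_{\mathcal R_u}\zeta\,d\nu_u\qquad\text{for all }\zeta\in C^2_0(\mathcal R_u).$$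
   Context: The fractional Laplacian is $(-\Delta)^s\phi(x)=\lim_{\varepsilon\to0^+}a_{N,s}\int_{|z-x|>\varepsilon}\frac{\phi(x)-\phi(z)}{|z-x|^{N+2s}}dz$, with $a_{N,s}=\frac{\Gamma(\frac N2+s)}{\pi^{N/2}\Gamma(2-s)}s(1-s)$. $\mathcal L^s(\mathbb{R}^N)$ is the space of $\phi\in L^1_{loc}(\mathbb{R}^N)$ with $\|\phi\|_{\mathcal L^s}=\int_{\mathbb{R}^N}\frac{|\phi(x)|}{1+|x|^{N+2s}}dx<+\infty$. Solutions are understood in the classical (pointwise) sense, and it is always assumed that $u(t,\cdot)\in\mathcal L^s(\mathbb{R}^N)$ for every $t>0$. $B_\rho(z)$ is the open ball of center $z$ and radius $\rho$. $C^2_0(\mathcal R_u)$ is the space of $C^2$ functions with compact support in the open set $\mathcal R_u$. *)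

theory Defs
  imports "HOL-Analysis.Analysis"
begin

text \<open>\<open>\<real>\<^sup>N\<close> is an arbitrary \<^typ>\<open>'a::euclidean_space\<close>, with \<open>N = DIM('a)\<close>
  (which is at least 1). A function on \<open>(0,\<infinity>) \<times> \<real>\<^sup>N\<close> is a curried function on the whole
  type whose values at times \<open>t \<le> 0\<close> are never used.\<close>

definition Q_infty :: "(real \<times> 'a::euclidean_space) set" where
  "Q_infty = {0<..} \<times> UNIV"

definition frac_lap_const :: "nat \<Rightarrow> real \<Rightarrow> real" where
  "frac_lap_const N s =
     Gamma (real N / 2 + s) / (pi powr (real N / 2) * Gamma (2 - s)) * s * (1 - s)"

definition frac_lap_trunc ::
    "real \<Rightarrow> ('a::euclidean_space \<Rightarrow> real) \<Rightarrow> 'a \<Rightarrow> real \<Rightarrow> real" where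
  "frac_lap_trunc s \<phi> x \<epsilon> = frac_lap_const DIM('a) s *
     (LINT z:{z. norm (z - x) > \<epsilon>}|lebesgue.
        (\<phi> x - \<phi> z) / norm (z - x) powr (real DIM('a) + 2 * s))"

definition frac_lap_exists :: "real \<Rightarrow> ('a::euclidean_space \<Rightarrow> real) \<Rightarrow> 'a \<Rightarrow> bool" where
  "frac_lap_exists s \<phi> x \<longleftrightarrow> (\<exists>l. (frac_lap_trunc s \<phi> x \<longlongrightarrow> l) (at_right 0))"

text \<open>The value of \<open>frac_lap\<close> is meaningful only where \<open>frac_lap_exists\<close> holds.\<close>

definition frac_lap :: "real \<Rightarrow> ('a::euclidean_space \<Rightarrow> real) \<Rightarrow> 'a \<Rightarrow> real" where
  "frac_lap s \<phi> x = Lim (at_right 0) (frac_lap_trunc s \<phi> x)"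

definition L1_loc :: "('a::euclidean_space \<Rightarrow> real) set" where
  "L1_loc = {\<phi>. \<forall>K. compact K \<longrightarrow> set_integrable lebesgue K \<phi>}"

definition Ls_space :: "real \<Rightarrow> ('a::euclidean_space \<Rightarrow> real) set" where
  "Ls_space s = {\<phi> \<in> L1_loc.
     (\<integral>\<^sup>+x. ennreal (\<bar>\<phi> x\<bar> / (1 + norm x powr (real DIM('a) + 2 * s))) \<partial>lebesgue) < \<infinity>}"

definition caratheodory :: "(real \<Rightarrow> 'a::euclidean_space \<Rightarrow> real \<Rightarrow> real) \<Rightarrow> bool" where
  "caratheodory f \<longleftrightarrow>
     (\<forall>r. (\<lambda>(t, x). f t x r) \<in> borel_measurable (lebesgue_on Q_infty)) \<and>
     (AE (t, x) in lebesgue_on Q_infty. continuous_on UNIV (f t x))"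

text \<open>A classical solution is a continuous function for which the two operators in the
  equation exist at every point of \<open>(0,\<infinity>) \<times> \<real>\<^sup>N\<close> and are continuous there, and the
  equation holds at every point. The standing requirement that each time slice lies in
  \<open>Ls_space s\<close> is part of the notion; it makes the truncated integrals absolutely
  convergent.\<close>

definition classical_solution ::
    "real \<Rightarrow> (real \<Rightarrow> 'a::euclidean_space \<Rightarrow> real \<Rightarrow> real) \<Rightarrow> (real \<Rightarrow> 'a \<Rightarrow> real) \<Rightarrow> bool" where
  "classical_solution s f u \<longleftrightarrow>
     (\<forall>t>0. u t \<in> Ls_space s) \<and>
     continuous_on Q_infty (\<lambda>(t, x). u t x) \<and>
     (\<forall>t>0. \<forall>x. (\<lambda>\<tau>. u \<tau> x) differentiable (at t)) \<and>
     continuous_on Q_infty (\<lambda>(t, x). deriv (\<lambda>\<tau>. u \<tau> x) t) \<and>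
     (\<forall>t>0. \<forall>x. frac_lap_exists s (u t) x) \<and>
     continuous_on Q_infty (\<lambda>(t, x). frac_lap s (u t) x) \<and>
     (\<forall>t>0. \<forall>x. deriv (\<lambda>\<tau>. u \<tau> x) t + frac_lap s (u t) x + f t x (u t x) = 0)"

text \<open>For nonnegative \<open>u\<close> and \<open>f t x r * r \<ge> 0\<close> the integrand below is nonnegative almost
  everywhere, so that \<^const>\<open>ennreal\<close> loses nothing.\<close>

definition regular_set ::
    "(real \<Rightarrow> 'a::euclidean_space \<Rightarrow> real \<Rightarrow> real) \<Rightarrow> (real \<Rightarrow> 'a \<Rightarrow> real) \<Rightarrow> 'a set" where
  "regular_set f u = {z. \<exists>\<rho>>0.
     (\<integral>\<^sup>+t\<in>{0<..<1}. (\<integral>\<^sup>+x\<in>ball z \<rho>. ennreal (f t x (u t x)) \<partial>lebesgue) \<partial>lebesgue) < \<infinity>}"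

definition radon_measure_on :: "'a::euclidean_space set \<Rightarrow> 'a measure \<Rightarrow> bool" where
  "radon_measure_on \<Omega> \<nu> \<longleftrightarrow>
     sets \<nu> = sets (restrict_space borel \<Omega>) \<and>
     (\<forall>K. compact K \<and> K \<subseteq> \<Omega> \<longrightarrow> emeasure \<nu> K < \<infinity>) \<and>
     (\<forall>A\<in>sets \<nu>. emeasure \<nu> A = (SUP K\<in>{K. compact K \<and> K \<subseteq> A}. emeasure \<nu> K))"

definition C2_fun :: "('a::euclidean_space \<Rightarrow> real) \<Rightarrow> bool" where
  "C2_fun \<zeta> \<longleftrightarrow>
     (\<exists>(D1 :: 'a \<Rightarrow> 'a \<Rightarrow>\<^sub>L real) (D2 :: 'a \<Rightarrow> 'a \<Rightarrow>\<^sub>L ('a \<Rightarrow>\<^sub>L real)).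
        (\<forall>x. (\<zeta> has_derivative blinfun_apply (D1 x)) (at x)) \<and>
        (\<forall>x. (D1 has_derivative blinfun_apply (D2 x)) (at x)) \<and>
        continuous_on UNIV D2)"

text \<open>Functions with compact support in an open set, extended by 0 to the whole space.\<close>

definition C2_0 :: "'a::euclidean_space set \<Rightarrow> ('a \<Rightarrow> real) set" where
  "C2_0 \<Omega> = {\<zeta>. C2_fun \<zeta> \<and> compact (closure {x. \<zeta> x \<noteq> 0}) \<and> closure {x. \<zeta> x \<noteq> 0} \<subseteq> \<Omega>}"

end

theory Submission
  imports Defs
begin

text \<open>Let \<open>\<zeta> \<ge> 0\<close> be continuous with compact support in the regular set, and semiconvex. Then
  \<open>(-\<Delta>)\<^sup>s \<zeta> \<le> C \<zeta>\<close>: at zeros of \<open>\<zeta>\<close> the left-hand side is negative. Hence \<open>X(t) = \<integral>u(t)\<zeta>\<close> satisfies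
  \<open>X' \<ge> -C X - F\<close> with \<open>F = \<integral>f(t,x,u)\<zeta>\<close> integrable near \<open>0\<close>, so that \<open>X\<close> has a limit at \<open>0\<close>.
  Sup-convolutions approximate every continuous function with compact support by such \<open>\<zeta>\<close>, so the limit
  exists for all of them and defines a positive functional, which the Riesz theorem represents
  by a Radon measure.\<close>

section \<open>Positive functionals on compactly supported functions\<close>

text \<open>The inequality for \<open>\<zeta>\<close> has to be transferred to the solution, and
  there lies the obstacle: a classical solution need not be C^2 in space, so the truncated operators
  of \<open>u(t)\<close> carry no bound that would let the principal value pass under the integral
  against \<open>\<zeta>\<close>. Only an inequality is wanted, so one-sided bounds suffice.
  Truncation makes the kernel integrable and the operator symmetric. Replacing \<open>u(t)\<close>
  by its inf-convolution supplies a uniform lower bound at the price of a small displacement of the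
  point, which the continuity of \<open>(-\<Delta>)\<^sup>s u(t)\<close> absorbs. The same
  construction applied to \<open>B - g\<close>, with \<open>B\<close> an upper bound of
  \<open>g\<close>, yields the semiconvex test functions.

  Uniform approximation of a test function controls the integrals only if the mass of
  \<open>u(t)\<close> near the support stays bounded as t tends to 0. This bound comes from the
  result for semiconvex functions itself, applied to a semiconvex majorant of a cut-off
  function.\<close>

definition Cc :: "'a::euclidean_space set \<Rightarrow> ('a \<Rightarrow> real) set" where
  "Cc \<Omega> = {f. continuous_on UNIV f \<and> (\<exists>K. compact K \<and> K \<subseteq> \<Omega> \<and> (\<forall>x. x \<notin> K \<longrightarrow> f x = 0))}"

lemma CcI:
  assumes "continuous_on UNIV f" "compact K" "K \<subseteq> \<Omega>" "\<And>x. x \<notin> K \<Longrightarrow> f x = 0"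
  shows "f \<in> Cc \<Omega>"
  using assms unfolding Cc_def by blast

lemma CcE:
  assumes "f \<in> Cc \<Omega>"
  obtains K where "continuous_on UNIV f" "compact K" "K \<subseteq> \<Omega>" "\<And>x. x \<notin> K \<Longrightarrow> f x = 0"
  using assms unfolding Cc_def by blast

lemma Cc_continuous: "f \<in> Cc \<Omega> \<Longrightarrow> continuous_on UNIV f"
  by (auto simp: Cc_def)

lemma Cc_measurable: "f \<in> Cc \<Omega> \<Longrightarrow> f \<in> borel_measurable borel"
  by (auto intro: borel_measurable_continuous_onI Cc_continuous)

text \<open>One statement serves all pointwise operations. The condition \<open>H 0 0 = 0\<close>
  keeps the result zero off the union of the two compact sets. Unary operations such as the positive
  part are the case where the second argument is ignored.\<close>

lemma Cc_combine:
  assumes f: "f \<in> Cc \<Omega>" and g: "g \<in> Cc \<Omega>"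
    and H: "continuous_on UNIV (\<lambda>p. H (fst p) (snd p))" "H 0 0 = (0::real)"
  shows "(\<lambda>x. H (f x) (g x)) \<in> Cc \<Omega>"
proof -
  from f obtain K where K: "continuous_on UNIV f" "compact K" "K \<subseteq> \<Omega>" "\<And>x. x \<notin> K \<Longrightarrow> f x = 0"
    by (rule CcE) blast
  from g obtain L where L: "continuous_on UNIV g" "compact L" "L \<subseteq> \<Omega>" "\<And>x. x \<notin> L \<Longrightarrow> g x = 0"
    by (rule CcE) blast
  have "continuous_on UNIV (\<lambda>x. H (fst (f x, g x)) (snd (f x, g x)))"
    by (rule continuous_on_compose2[OF H(1)]) (auto intro!: continuous_intros K L)
  then show ?thesis
    using K L H(2) by (intro CcI[of _ "K \<union> L"]) auto
qed

lemma Cc_mult: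
  assumes f: "f \<in> Cc \<Omega>" and g: "continuous_on UNIV g"
  shows "(\<lambda>x. f x * g x) \<in> Cc \<Omega>"
proof -
  from f obtain K where K: "continuous_on UNIV f" "compact K" "K \<subseteq> \<Omega>" "\<And>x. x \<notin> K \<Longrightarrow> f x = 0"
    by (rule CcE) blast
  then show ?thesis
    by (intro CcI[of _ K]) (auto intro!: continuous_intros g)
qed

lemma Cc_cmult: "f \<in> Cc \<Omega> \<Longrightarrow> (\<lambda>x. c * f x) \<in> Cc \<Omega>"
  using Cc_mult[of f \<Omega> "\<lambda>_. c"] by (simp add: mult.commute)

lemma Cc_add: "f \<in> Cc \<Omega> \<Longrightarrow> g \<in> Cc \<Omega> \<Longrightarrow> (\<lambda>x. f x + g x) \<in> Cc \<Omega>"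
  by (rule Cc_combine[where H="(+)"]) (auto intro!: continuous_intros)

lemma Cc_diff: "f \<in> Cc \<Omega> \<Longrightarrow> g \<in> Cc \<Omega> \<Longrightarrow> (\<lambda>x. f x - g x) \<in> Cc \<Omega>"
  by (rule Cc_combine[where H="(-)"]) (auto intro!: continuous_intros)

lemma Cc_zero: "(\<lambda>_. 0) \<in> Cc \<Omega>"
  by (rule CcI[of _ "{}"]) auto

lemma Cc_sum: "(\<And>i. i \<in> I \<Longrightarrow> f i \<in> Cc \<Omega>) \<Longrightarrow> (\<lambda>x. \<Sum>i\<in>I. f i x) \<in> Cc \<Omega>"
  by (induction I rule: infinite_finite_induct) (auto intro!: Cc_add Cc_zero)

lemma Cc_mono: "f \<in> Cc U \<Longrightarrow> U \<subseteq> \<Omega> \<Longrightarrow> f \<in> Cc \<Omega>"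
  unfolding Cc_def by blast

lemma Cc_bounded:
  assumes "f \<in> Cc \<Omega>"
  obtains B where "B > 0" "\<And>x. \<bar>f x\<bar> \<le> B"
proof -
  from assms obtain K where K: "continuous_on UNIV f" "compact K" "K \<subseteq> \<Omega>" "\<And>x. x \<notin> K \<Longrightarrow> f x = 0"
    by (rule CcE) blast
  have "compact (f ` K)"
    using K by (intro compact_continuous_image) (auto intro: continuous_on_subset)
  then obtain B where "B > 0" "\<And>y. y \<in> f ` K \<Longrightarrow> norm y \<le> B"
    by (meson bounded_pos compact_imp_bounded)
  then show ?thesis
    using K(4) by (intro that[of B]) (metis abs_zero image_eqI less_eq_real_def real_norm_def)+
qed

lemma Cc_bump:
  assumes "compact K" "open \<Omega>" "K \<subseteq> \<Omega>"
  obtains \<sigma> where "\<sigma> \<in> Cc \<Omega>" "\<And>x. 0 \<le> \<sigma> x" "\<And>x. \<sigma> x \<le> 1" "\<And>x. x \<in> K \<Longrightarrow> \<sigma> x = 1"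
proof (cases "K = {}")
  \<comment> \<open>The empty set is separate because \<open>infdist\<close> to it is 0 by
    convention, which would make the tent function below constantly 1.\<close>
  case True
  then show ?thesis using that[of "\<lambda>_. 0"] Cc_zero by auto
next
  case False
  obtain e where e: "e > 0" "(\<Union>x\<in>K. cball x e) \<subseteq> \<Omega>"
    using compact_subset_open_imp_cball_epsilon_subset[OF assms] .
  define \<sigma> where "\<sigma> x = max 0 (1 - infdist x K / e)" for x
  have sub: "{x. infdist x K \<le> e} \<subseteq> \<Omega>"
  proof safe
    fix x assume x: "infdist x K \<le> e"
    obtain y where "y \<in> K" "infdist x K = dist x y"
      using infdist_attains_inf[of K x] False assms(1) by (auto simp: compact_imp_closed)
    then have "x \<in> cball y e" using x by (simp add: dist_commute)
    then show "x \<in> \<Omega>" using e(2) \<open>y \<in> K\<close> by blast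
  qed
  have "\<sigma> \<in> Cc \<Omega>"
    using e sub compact_infdist_le[OF False assms(1) e(1)]
    by (intro CcI[of _ "{x. infdist x K \<le> e}"])
       (auto simp: \<sigma>_def field_simps intro!: continuous_intros)
  then show ?thesis
    using e infdist_nonneg[of _ K] by (intro that[of \<sigma>]) (auto simp: \<sigma>_def)
qed

section \<open>Positive linear functionals and countable domination\<close>

locale positive_functional =
  fixes \<Omega> :: "'a::euclidean_space set" and \<Lambda> :: "('a \<Rightarrow> real) \<Rightarrow> real"
  assumes open_dom: "open \<Omega>"
    and add: "\<And>f g. f \<in> Cc \<Omega> \<Longrightarrow> g \<in> Cc \<Omega> \<Longrightarrow> \<Lambda> (\<lambda>x. f x + g x) = \<Lambda> f + \<Lambda> g"
    and scale: "\<And>f c. f \<in> Cc \<Omega> \<Longrightarrow> \<Lambda> (\<lambda>x. c * f x) = c * \<Lambda> f"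
    and pos: "\<And>f. f \<in> Cc \<Omega> \<Longrightarrow> (\<And>x. 0 \<le> f x) \<Longrightarrow> 0 \<le> \<Lambda> f"
begin

lemma diff: "f \<in> Cc \<Omega> \<Longrightarrow> g \<in> Cc \<Omega> \<Longrightarrow> \<Lambda> (\<lambda>x. f x - g x) = \<Lambda> f - \<Lambda> g"
  using add[of f "\<lambda>x. -1 * g x"] scale[of g "-1"] Cc_cmult[of g \<Omega> "-1"] by simp

lemma mono: "f \<in> Cc \<Omega> \<Longrightarrow> g \<in> Cc \<Omega> \<Longrightarrow> (\<And>x. f x \<le> g x) \<Longrightarrow> \<Lambda> f \<le> \<Lambda> g"
  using pos[of "\<lambda>x. g x - f x"] diff[of g f] Cc_diff[of g \<Omega> f] by auto

lemma zero: "\<Lambda> (\<lambda>_. 0) = 0"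
  using scale[OF Cc_zero, of 0] by simp

lemma sum: "(\<And>i. i \<in> I \<Longrightarrow> f i \<in> Cc \<Omega>) \<Longrightarrow> \<Lambda> (\<lambda>x. \<Sum>i\<in>I. f i x) = (\<Sum>i\<in>I. \<Lambda> (f i))"
  by (induction I rule: infinite_finite_induct) (auto simp: zero add Cc_sum)

definition Ccp :: "('a \<Rightarrow> real) set" where
  "Ccp = {f \<in> Cc \<Omega>. \<forall>x. 0 \<le> f x}"

lemma Ccp_Cc: "f \<in> Ccp \<Longrightarrow> f \<in> Cc \<Omega>" and Ccp_nonneg: "f \<in> Ccp \<Longrightarrow> 0 \<le> f x"
  by (auto simp: Ccp_def)

lemma Ccp_\<Lambda>_nonneg: "f \<in> Ccp \<Longrightarrow> 0 \<le> \<Lambda> f"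
  by (auto simp: Ccp_def pos)

text \<open>Daniell's continuity property, by a Dini argument on the support of \<open>f\<close>.\<close>

lemma countably_dominated:
  assumes f: "f \<in> Cc \<Omega>" and g: "\<And>n::nat. g n \<in> Ccp"
    and le: "\<And>x. ennreal (f x) \<le> (\<Sum>n. ennreal (g n x))"
  shows "ennreal (\<Lambda> f) \<le> (\<Sum>n. ennreal (\<Lambda> (g n)))"
proof -
  from f obtain K where K: "continuous_on UNIV f" "compact K" "K \<subseteq> \<Omega>" "\<And>x. x \<notin> K \<Longrightarrow> f x = 0"
    by (rule CcE) blast
  \<comment> \<open>Constants are not in \<open>Cc\<close>; the cut-off \<open>\<sigma>\<close>
    stands in for 1 on the support of \<open>f\<close>, so that a pointwise error \<open>e\<close>
    costs \<open>e * \<Lambda> \<sigma>\<close>.\<close>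
  obtain \<sigma> where \<sigma>: "\<sigma> \<in> Cc \<Omega>" "\<And>x. 0 \<le> \<sigma> x" "\<And>x. \<sigma> x \<le> 1" "\<And>x. x \<in> K \<Longrightarrow> \<sigma> x = 1"
    using Cc_bump[OF K(2) open_dom K(3)] by blast
  have s0: "0 \<le> \<Lambda> \<sigma>" using \<sigma> pos by blast
  have key: "ennreal (\<Lambda> f) \<le> (\<Sum>n. ennreal (\<Lambda> (g n))) + ennreal (e * \<Lambda> \<sigma>)" if e: "e > 0" for e
  proof -
    define U where "U m = {x. f x - (\<Sum>n<m. g n x) < e}" for m :: nat
    have opU: "open (U m)" for m
      unfolding U_def using g K
      by (intro open_Collect_less continuous_intros) (auto simp: Ccp_def Cc_def)
    have incU: "U m \<subseteq> U m'" if "m \<le> m'" for m m'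
    proof -
      have "(\<Sum>n<m. g n x) \<le> (\<Sum>n<m'. g n x)" for x
        using g that by (intro sum_mono2) (auto simp: Ccp_def)
      then show ?thesis unfolding U_def by (force intro: order_le_less_trans[OF diff_left_mono])
    qed
    have cover: "K \<subseteq> (\<Union>m. U m)"
    proof
      fix x
      have "\<exists>m. f x - (\<Sum>n<m. g n x) < e"
      proof (rule ccontr)
        assume "\<not> ?thesis"
        then have *: "(\<Sum>n<m. g n x) \<le> f x - e" for m
          by (smt (verit, best))
        have "(\<Sum>n. ennreal (g n x)) \<le> ennreal (f x - e)"
          using * g by (intro suminf_le_const) (auto simp: Ccp_def sum_ennreal intro!: ennreal_leI)
        also have "\<dots> < ennreal (f x)"
          using e *[of 0] by (simp add: ennreal_less_iff)
        finally show False using le[of x] by simp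
      qed
      then show "x \<in> (\<Union>m. U m)" by (auto simp: U_def)
    qed
    obtain M where M: "finite M" "K \<subseteq> (\<Union>m\<in>M. U m)"
      using compactE_image[OF K(2), of UNIV U] opU cover by auto
    define m where "m = Max (insert 0 M)"
    have "U i \<subseteq> U m" if "i \<in> M" for i
      using that M(1) by (intro incU) (auto simp: m_def)
    then have KU: "K \<subseteq> U m" using M(2) by blast
    have "f x \<le> (\<Sum>n<m. g n x) + e * \<sigma> x" for x
    proof (cases "x \<in> K")
      case True
      then show ?thesis using KU \<sigma>(4) by (fastforce simp: U_def)
    next
      case False
      then show ?thesis using K(4) \<sigma>(2) e g by (auto simp: Ccp_def intro!: add_nonneg_nonneg sum_nonneg)
    qed
    then have "\<Lambda> f \<le> \<Lambda> (\<lambda>x. (\<Sum>n<m. g n x) + e * \<sigma> x)"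
      by (intro mono Cc_add Cc_sum Cc_cmult f \<sigma>(1) Ccp_Cc[OF g]) auto
    also have "\<dots> = (\<Sum>n<m. \<Lambda> (g n)) + e * \<Lambda> \<sigma>"
      using g \<sigma>(1) by (simp add: add sum scale Cc_sum Cc_cmult Ccp_Cc)
    finally have "ennreal (\<Lambda> f) \<le> ennreal ((\<Sum>n<m. \<Lambda> (g n)) + e * \<Lambda> \<sigma>)"
      by (rule ennreal_leI)
    also have "\<dots> = (\<Sum>n<m. ennreal (\<Lambda> (g n))) + ennreal (e * \<Lambda> \<sigma>)"
      using g s0 e by (subst ennreal_plus) (auto simp: sum_ennreal Ccp_\<Lambda>_nonneg intro!: sum_nonneg)
    also have "\<dots> \<le> (\<Sum>n. ennreal (\<Lambda> (g n))) + ennreal (e * \<Lambda> \<sigma>)"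
      by (intro add_right_mono sum_le_suminf) auto
    finally show ?thesis .
  qed
  show ?thesis
  proof (rule ennreal_le_epsilon)
    fix e :: real assume "0 < e"
    then have p: "e / (\<Lambda> \<sigma> + 1) > 0" using s0 by simp
    have "e / (\<Lambda> \<sigma> + 1) * \<Lambda> \<sigma> \<le> e"
      using s0 \<open>0 < e\<close> by (simp add: field_simps)
    then show "ennreal (\<Lambda> f) \<le> (\<Sum>n. ennreal (\<Lambda> (g n))) + ennreal e"
      using key[OF p] by (meson add_left_mono ennreal_leI order_trans)
  qed
qed

section \<open>The outer measure of a positive functional\<close>

definition covers :: "(nat \<Rightarrow> 'a \<Rightarrow> real) \<Rightarrow> 'a set \<Rightarrow> bool" where
  "covers g A \<longleftrightarrow> (\<forall>n. g n \<in> Ccp) \<and> (\<forall>x\<in>A. 1 \<le> (\<Sum>n. ennreal (g n x)))"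

text \<open>Sets are covered by countable families of functions rather than of open sets: covers can
  then be multiplied by cut-offs, and \<open>\<Lambda>\<close> gives their cost directly. A set that
  is not contained in \<open>\<Omega>\<close> has no cover, so its value is the infimum of the empty
  set, which is infinite.\<close>

definition mu :: "'a set \<Rightarrow> ennreal" where
  "mu A = (INF g\<in>{g. covers g A}. \<Sum>n. ennreal (\<Lambda> (g n)))"

lemma mu_le: "covers g A \<Longrightarrow> mu A \<le> (\<Sum>n. ennreal (\<Lambda> (g n)))"
  unfolding mu_def by (rule INF_lower) simp

lemma mu_greatest: "(\<And>g. covers g A \<Longrightarrow> c \<le> (\<Sum>n. ennreal (\<Lambda> (g n)))) \<Longrightarrow> c \<le> mu A"
  unfolding mu_def by (rule INF_greatest) simp

lemma mu_mono: "A \<subseteq> B \<Longrightarrow> mu A \<le> mu B"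
  by (rule mu_greatest, rule mu_le) (auto simp: covers_def)

lemma Ccp_zero: "(\<lambda>_. 0) \<in> Ccp"
  by (auto simp: Ccp_def Cc_zero)

lemma mu_single:
  assumes "g \<in> Ccp" "\<And>x. x \<in> A \<Longrightarrow> 1 \<le> g x"
  shows "mu A \<le> ennreal (\<Lambda> g)"
proof -
  define h where "h n = (if n = (0::nat) then g else (\<lambda>_. 0))" for n
  have s: "(\<Sum>n. ennreal (h n x)) = ennreal (g x)" for x
    by (subst suminf_finite[of "{0}"]) (auto simp: h_def)
  have "covers h A"
    using assms by (auto simp: covers_def s) (auto simp: h_def Ccp_zero)
  then have "mu A \<le> (\<Sum>n. ennreal (\<Lambda> (h n)))" by (rule mu_le)
  also have "\<dots> = ennreal (\<Lambda> g)"
    by (subst suminf_finite[of "{0}"]) (auto simp: h_def zero)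
  finally show ?thesis .
qed

lemma mu_empty: "mu {} = 0"
  using mu_single[OF Ccp_zero, of "{}"] by (simp add: zero)

text \<open>Re-enumeration along \<open>prod_decode\<close> turns a sequence of families into a
  single cover. It merges the covers of the members of a union, and it handles covers whose
  functions have been cut into countably many pieces.\<close>

lemma covers_2dimen:
  assumes g: "\<And>i j. g i j \<in> Ccp" and c: "\<And>x. x \<in> A \<Longrightarrow> 1 \<le> (\<Sum>i. \<Sum>j. ennreal (g i j x))"
  shows "mu A \<le> (\<Sum>i. \<Sum>j. ennreal (\<Lambda> (g i j)))"
proof -
  define h where "h n = (case prod_decode n of (i, j) \<Rightarrow> g i j)" for n
  have s: "(\<Sum>n. ennreal (h n x)) = (\<Sum>i. \<Sum>j. ennreal (g i j x))" for x
    using suminf_ennreal_2dimen[of "\<lambda>i. \<Sum>j. ennreal (g i j x)" "\<lambda>(i, j). ennreal (g i j x)"]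
    by (simp add: h_def case_prod_beta)
  have "covers h A"
    using g c by (auto simp: covers_def s) (auto simp: h_def split: prod.split)
  then have "mu A \<le> (\<Sum>n. ennreal (\<Lambda> (h n)))" by (rule mu_le)
  also have "\<dots> = (\<Sum>i. \<Sum>j. ennreal (\<Lambda> (g i j)))"
    using suminf_ennreal_2dimen[of "\<lambda>i. \<Sum>j. ennreal (\<Lambda> (g i j))" "\<lambda>(i, j). ennreal (\<Lambda> (g i j))"]
    by (simp add: h_def case_prod_beta)
  finally show ?thesis .
qed

lemma mu_UN_le: "mu (\<Union>i::nat. A i) \<le> (\<Sum>i. mu (A i))"
proof (rule ennreal_le_epsilon)
  fix e :: real assume e: "0 < e" "(\<Sum>i. mu (A i)) < top"
  have "\<exists>g. covers g (A n) \<and> (\<Sum>i. ennreal (\<Lambda> (g i))) < mu (A n) + e * (1/2)^Suc n" for n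
  proof -
    have "mu (A n) < mu (A n) + e * (1/2)^Suc n"
      using e by (auto simp: less_top dest!: ennreal_suminf_lessD)
    then show ?thesis
      using mu_greatest[of "A n" "mu (A n) + e * (1/2)^Suc n"] by (meson leD not_le_imp_less)
  qed
  then obtain g where g: "\<And>n. covers (g n) (A n)"
      "\<And>n. (\<Sum>i. ennreal (\<Lambda> (g n i))) < mu (A n) + e * (1/2)^Suc n"
    by metis
  have "mu (\<Union>i. A i) \<le> (\<Sum>n. \<Sum>i. ennreal (\<Lambda> (g n i)))"
  proof (rule covers_2dimen)
    fix x assume "x \<in> (\<Union>i. A i)"
    then obtain n where "x \<in> A n" by auto
    then have "1 \<le> (\<Sum>i. ennreal (g n i x))" using g(1) by (auto simp: covers_def)
    also have "\<dots> \<le> (\<Sum>n. \<Sum>i. ennreal (g n i x))"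
      using sum_le_suminf[of "\<lambda>n. \<Sum>i. ennreal (g n i x)" "{n}"] by simp
    finally show "1 \<le> (\<Sum>n. \<Sum>i. ennreal (g n i x))" .
  qed (use g(1) in \<open>auto simp: covers_def\<close>)
  also have "\<dots> \<le> (\<Sum>n. mu (A n) + e * (1/2) ^ Suc n)"
    using g(2) by (intro suminf_le) (auto intro: less_imp_le)
  also have "\<dots> = (\<Sum>n. mu (A n)) + (\<Sum>n. ennreal e * ennreal ((1/2) ^ Suc n))"
    using \<open>0 < e\<close> by (subst suminf_add[symmetric])
                     (auto simp del: ennreal_suminf_cmult simp add: ennreal_mult[symmetric])
  also have "\<dots> = (\<Sum>n. mu (A n)) + e"
    unfolding ennreal_suminf_cmult
    by (subst suminf_ennreal_eq[OF zero_le_power power_half_series]) auto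
  finally show "mu (\<Union>i. A i) \<le> (\<Sum>n. mu (A n)) + e" .
qed

lemma outer_measure_space_mu: "outer_measure_space (Pow UNIV) mu"
  by (auto simp: outer_measure_space_def positive_def mu_empty increasing_def mu_mono
      countably_subadditive_def mu_UN_le)

text \<open>An open set \<open>E\<close> is the increasing limit of the continuous cut-offs \<open>\<phi> k\<close>; a cover of
  \<open>A\<close> is split by the increments of \<open>\<phi>\<close> into a cover of \<open>A \<inter> E\<close>, and by \<open>1 - \<phi> K\<close> into a
  cover of \<open>A - E\<close>.\<close>

lemma mu_open_split:
  assumes E: "open E"
  shows "mu (A \<inter> E) + mu (A - E) \<le> mu A"
proof (rule mu_greatest)
  fix g assume g: "covers g A"
  then have gp: "\<And>n. g n \<in> Ccp" by (simp add: covers_def)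
  define T where "T = (\<Sum>n. ennreal (\<Lambda> (g n)))"
  \<comment> \<open>For \<open>E = UNIV\<close> the distance to the empty complement would be 0 and
    the formula would vanish identically. \<open>\<phi> 0 = 0\<close> is the starting value of the
    telescoping sum of increments.\<close>
  define \<phi> where "\<phi> k x = (if E = UNIV then (if k = 0 then 0 else 1) else min 1 (real k * infdist x (- E)))" for k x
  have cont: "continuous_on UNIV (\<phi> k)" for k
    by (cases "E = UNIV") (auto simp: \<phi>_def intro!: continuous_intros)
  have \<phi>01: "0 \<le> \<phi> k x" "\<phi> k x \<le> 1" for k x
    by (auto simp: \<phi>_def infdist_nonneg)
  have \<phi>0: "\<phi> 0 x = 0" for x by (simp add: \<phi>_def)
  have \<phi>mono: "\<phi> k x \<le> \<phi> (Suc k) x" for k x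
    using infdist_nonneg[of x "-E"] by (auto simp: \<phi>_def distrib_right)
  have \<phi>out: "\<phi> k x = 0" if "x \<notin> E" for k x
    using that by (auto simp: \<phi>_def)
  have \<phi>in: "\<exists>k. \<phi> k x = 1" if "x \<in> E" for x
  proof (cases "E = UNIV")
    case True
    then show ?thesis by (intro exI[of _ 1]) (simp add: \<phi>_def)
  next
    case False
    then have "infdist x (-E) > 0"
      using that E infdist_pos_not_in_closed[of "-E" x] by auto
    moreover from this obtain k :: nat where "1 / infdist x (-E) < k"
      using reals_Archimedean2 by blast
    ultimately show ?thesis
      using False by (intro exI[of _ k]) (auto simp: \<phi>_def field_simps)
  qed
  define \<psi> where "\<psi> k x = \<phi> (Suc k) x - \<phi> k x" for k x
  have \<psi>0: "0 \<le> \<psi> k x" for k x using \<phi>mono by (simp add: \<psi>_def)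
  have \<psi>sum: "(\<Sum>k<K. \<psi> k x) = \<phi> K x" for K x
    unfolding \<psi>_def using sum_lessThan_telescope[of "\<lambda>k. \<phi> k x" K] by (simp add: \<phi>0)
  have \<psi>cont: "continuous_on UNIV (\<psi> k)" for k
    unfolding \<psi>_def by (intro continuous_intros cont)
  have G1: "(\<lambda>x. g n x * \<psi> k x) \<in> Ccp" for n k
    using gp[of n] \<psi>0 \<psi>cont by (auto simp: Ccp_def intro!: Cc_mult)
  have G2: "(\<lambda>x. g n x * (1 - \<phi> k x)) \<in> Ccp" for n k
    using gp[of n] \<phi>01 cont by (auto simp: Ccp_def intro!: Cc_mult continuous_intros)
  define c where "c k = (\<Sum>n. ennreal (\<Lambda> (\<lambda>x. g n x * \<psi> k x)))" for k
  have AE: "mu (A \<inter> E) \<le> (\<Sum>k. c k)"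
    unfolding c_def
  proof (rule covers_2dimen[OF G1])
    fix x assume x: "x \<in> A \<inter> E"
    then obtain K where K: "\<phi> K x = 1" using \<phi>in by auto
    have "1 \<le> (\<Sum>n. ennreal (g n x))" using g x by (auto simp: covers_def)
    also have "\<dots> = (\<Sum>n. ennreal (g n x) * (\<Sum>k<K. ennreal (\<psi> k x)))"
      using \<psi>0 K by (simp add: sum_ennreal \<psi>sum)
    also have "\<dots> = (\<Sum>n. \<Sum>k<K. ennreal (g n x * \<psi> k x))"
      by (intro arg_cong[where f=suminf] ext, subst sum_distrib_left)
         (auto intro!: sum.cong simp: ennreal_mult \<psi>0 Ccp_nonneg[OF gp])
    also have "\<dots> = (\<Sum>k<K. \<Sum>n. ennreal (g n x * \<psi> k x))"
      by (rule suminf_sum) auto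
    also have "\<dots> \<le> (\<Sum>k. \<Sum>n. ennreal (g n x * \<psi> k x))"
      by (rule sum_le_suminf) auto
    finally show "1 \<le> (\<Sum>k. \<Sum>n. ennreal (g n x * \<psi> k x))" .
  qed
  \<comment> \<open>For finite \<open>K\<close> the weights \<open>\<psi> 0\<close>, ...,
    \<open>\<psi> (K - 1)\<close> and \<open>1 - \<phi> K\<close> add up to 1, so finite additivity
    of \<open>\<Lambda>\<close> splits the cost of each \<open>g n\<close> exactly. Since
    \<open>1 - \<phi> K\<close> is 1 off \<open>E\<close>, the last products cover
    \<open>A - E\<close>. The supremum over \<open>K\<close> is taken only afterwards, outside
    \<open>\<Lambda>\<close>.\<close>
  have step: "(\<Sum>k<K. c k) + mu (A - E) \<le> T" for K
  proof -
    have "mu (A - E) \<le> (\<Sum>n. ennreal (\<Lambda> (\<lambda>x. g n x * (1 - \<phi> K x))))"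
      using g G2 \<phi>out by (intro mu_le) (auto simp: covers_def)
    then have "(\<Sum>k<K. c k) + mu (A - E) \<le>
        (\<Sum>n. \<Sum>k<K. ennreal (\<Lambda> (\<lambda>x. g n x * \<psi> k x))) + (\<Sum>n. ennreal (\<Lambda> (\<lambda>x. g n x * (1 - \<phi> K x))))"
      unfolding c_def by (subst suminf_sum) (auto intro: add_left_mono)
    also have "\<dots> = (\<Sum>n. (\<Sum>k<K. ennreal (\<Lambda> (\<lambda>x. g n x * \<psi> k x))) + ennreal (\<Lambda> (\<lambda>x. g n x * (1 - \<phi> K x))))"
      by (rule suminf_add) auto
    also have "\<dots> = T"
      unfolding T_def
    proof (intro arg_cong[where f=suminf] ext)
      fix n
      have "(\<Sum>k<K. ennreal (\<Lambda> (\<lambda>x. g n x * \<psi> k x))) + ennreal (\<Lambda> (\<lambda>x. g n x * (1 - \<phi> K x)))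
        = ennreal ((\<Sum>k<K. \<Lambda> (\<lambda>x. g n x * \<psi> k x)) + \<Lambda> (\<lambda>x. g n x * (1 - \<phi> K x)))"
        using Ccp_\<Lambda>_nonneg[OF G1] Ccp_\<Lambda>_nonneg[OF G2] by (subst ennreal_plus) (auto intro!: sum_nonneg)
      also have "(\<Sum>k<K. \<Lambda> (\<lambda>x. g n x * \<psi> k x)) + \<Lambda> (\<lambda>x. g n x * (1 - \<phi> K x))
        = \<Lambda> (\<lambda>x. (\<Sum>k<K. g n x * \<psi> k x) + g n x * (1 - \<phi> K x))"
        using G1 G2 by (subst add) (auto simp: sum Ccp_Cc intro!: Cc_sum)
      also have "(\<lambda>x. (\<Sum>k<K. g n x * \<psi> k x) + g n x * (1 - \<phi> K x)) = g n"
        unfolding sum_distrib_left[symmetric] \<psi>sum by (simp add: algebra_simps)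
      finally show "(\<Sum>k<K. ennreal (\<Lambda> (\<lambda>x. g n x * \<psi> k x))) + ennreal (\<Lambda> (\<lambda>x. g n x * (1 - \<phi> K x)))
        = ennreal (\<Lambda> (g n))" .
    qed
    finally show ?thesis .
  qed
  have "mu (A \<inter> E) + mu (A - E) \<le> (\<Sum>k. c k) + mu (A - E)"
    by (intro add_right_mono AE)
  also have "\<dots> = (SUP K. (\<Sum>k<K. c k) + mu (A - E))"
    by (simp add: suminf_eq_SUP ennreal_SUP_add_left)
  also have "\<dots> \<le> T"
    by (intro SUP_least step)
  finally show "mu (A \<inter> E) + mu (A - E) \<le> (\<Sum>n. ennreal (\<Lambda> (g n)))" unfolding T_def .
qed

section \<open>The Borel measure obtained from the outer measure\<close>

definition riesz :: "'a measure" where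
  "riesz = measure_of UNIV (sets borel) mu"

lemma sets_riesz [simp, measurable_cong]: "sets riesz = sets borel"
  unfolding riesz_def by (simp add: sets.sigma_sets_eq[of borel, simplified])

lemma space_riesz [simp]: "space riesz = UNIV"
  unfolding riesz_def by (simp add: space_measure_of_conv)

text \<open>By Caratheodory's lemma \<open>mu\<close> is a measure on its
  \<open>lambda_system\<close>. \<open>mu_open_split\<close> puts the open sets into that system,
  hence all Borel sets.\<close>

lemma emeasure_riesz:
  assumes "A \<in> sets borel"
  shows "emeasure riesz A = mu A"
proof -
  interpret P: sigma_algebra UNIV "Pow UNIV" by (rule sigma_algebra_Pow)
  let ?L = "lambda_system UNIV (Pow UNIV) mu"
  have ms: "measure_space UNIV ?L mu"
    by (rule P.caratheodory_lemma[OF outer_measure_space_mu])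
  then have sa: "sigma_algebra UNIV ?L" by (simp add: measure_space_def)
  have "{S. open S} \<subseteq> ?L"
  proof safe
    fix E :: "'a set" assume "open E"
    have "mu (x \<inter> E) + mu (x - E) = mu x" for x
    proof (rule antisym)
      show "mu (x \<inter> E) + mu (x - E) \<le> mu x" by (rule mu_open_split) fact
      \<comment> \<open>The two pieces are padded with empty sets so that countable subadditivity
        applies.\<close>
      have "mu x = mu (\<Union>i::nat. if i = 0 then x \<inter> E else if i = 1 then x - E else {})"
        by (rule arg_cong[where f=mu]) (auto split: if_splits)
      also have "\<dots> \<le> (\<Sum>i::nat. mu (if i = 0 then x \<inter> E else if i = 1 then x - E else {}))"
        by (rule mu_UN_le)
      also have "\<dots> = mu (x \<inter> E) + mu (x - E)"
        by (subst suminf_finite[of "{0, 1}"]) (auto simp: mu_empty)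
      finally show "mu x \<le> mu (x \<inter> E) + mu (x - E)" .
    qed
    then show "E \<in> ?L" unfolding P.lambda_system_eq by auto
  qed
  then have sub: "sets borel \<subseteq> ?L"
    unfolding sets_borel by (rule sigma_algebra.sigma_sets_subset[OF sa])
  have "sigma_algebra UNIV (sets (borel :: 'a measure))"
    using sets.sigma_algebra_axioms[of "borel :: 'a measure"] by simp
  then have "measure_space UNIV (sets borel) mu"
    by (rule measure_down[OF ms _ sub])
  then show ?thesis
    using assms by (intro emeasure_measure_of[OF riesz_def]) (auto simp: measure_space_def)
qed

lemma mu_compact_finite:
  assumes "compact K" "K \<subseteq> \<Omega>"
  shows "mu K < \<infinity>"
proof -
  obtain \<sigma> where "\<sigma> \<in> Cc \<Omega>" "\<And>x. 0 \<le> \<sigma> x" "\<And>x. x \<in> K \<Longrightarrow> \<sigma> x = 1"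
    using Cc_bump[OF assms(1) open_dom assms(2)] by metis
  then have "mu K \<le> ennreal (\<Lambda> \<sigma>)" by (intro mu_single) (auto simp: Ccp_def)
  then show ?thesis by (simp add: order_le_less_trans)
qed

text \<open>\<open>f / c\<close> is at most 1 on \<open>A\<close> and 0 elsewhere, so every cover of
  \<open>A\<close> dominates it pointwise, and \<open>countably_dominated\<close> carries this over
  to \<open>\<Lambda>\<close>. It is the counterpart of \<open>mu_single\<close>, which bounds
  \<open>mu\<close> from above.\<close>

lemma mu_ge:
  assumes f: "f \<in> Ccp" and le: "\<And>x. f x \<le> c" and A: "\<And>x. x \<notin> A \<Longrightarrow> f x = 0" and c: "c > 0"
  shows "ennreal (\<Lambda> f) \<le> ennreal c * mu A"
proof -
  have "ennreal (\<Lambda> (\<lambda>x. (1 / c) * f x)) \<le> mu A"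
  proof (rule mu_greatest)
    fix g assume g: "covers g A"
    show "ennreal (\<Lambda> (\<lambda>x. (1 / c) * f x)) \<le> (\<Sum>n. ennreal (\<Lambda> (g n)))"
    proof (rule countably_dominated)
      fix x
      show "ennreal (1 / c * f x) \<le> (\<Sum>n. ennreal (g n x))"
      proof (cases "x \<in> A")
        case True
        have "ennreal (1 / c * f x) \<le> 1" using le[of x] c by simp
        also have "1 \<le> (\<Sum>n. ennreal (g n x))" using True g by (simp add: covers_def)
        finally show ?thesis .
      qed (simp add: A)
    qed (use g Cc_cmult[OF Ccp_Cc[OF f], of "1 / c"] in \<open>auto simp: covers_def\<close>)
  qed
  then have "ennreal c * ennreal (1 / c * \<Lambda> f) \<le> ennreal c * mu A"
    unfolding scale[OF Ccp_Cc[OF f]] by (intro mult_left_mono) auto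
  then show ?thesis
    using c Ccp_\<Lambda>_nonneg[OF f] by (simp add: ennreal_mult[symmetric])
qed

section \<open>Horizontal layers and the integral of the Riesz measure\<close>

lemma layer_sum:
  fixes y \<eta> :: real
  assumes "0 \<le> y" "0 < \<eta>"
  shows "(\<Sum>j<m. min \<eta> (max 0 (y - real j * \<eta>))) = min (real m * \<eta>) y"
  using assms
  by (induction m) (auto simp: min_def max_def algebra_simps)

text \<open>Compared with \<open>layer_sum\<close>, every slice that \<open>y\<close> enters is
  rounded up to its full height \<open>\<eta>\<close>. Only the topmost slice entered can be
  incomplete, so the excess is at most one \<open>\<eta>\<close>, and it is absent for
  \<open>y = 0\<close>. The latter keeps the error integrable when \<open>y\<close> is a function of
  compact support.\<close>

lemma layer_count:
  fixes y \<eta> :: real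
  assumes "0 \<le> y" "0 < \<eta>"
  shows "(\<Sum>j<m. \<eta> * indicator {z. z > real j * \<eta>} y) \<le> y + \<eta> * indicator {0<..} y"
    and "y \<le> real m * \<eta> \<Longrightarrow> y \<le> (\<Sum>j<m. \<eta> * indicator {z. z > real j * \<eta>} y)"
proof -
  define c where "c m = (\<Sum>j<m. \<eta> * indicator {z. z > real j * \<eta>} y)" for m
  have c0: "c 0 = 0" and cS: "c (Suc m) = c m + (if y > real m * \<eta> then \<eta> else 0)" for m
    by (simp_all add: c_def)
  \<comment> \<open>The third conjunct carries the induction: while \<open>y\<close> is above the
    current level, every earlier level has been counted.\<close>
  have *: "c m \<le> y + (if y > 0 then \<eta> else 0) \<and> (y \<le> real m * \<eta> \<longrightarrow> y \<le> c m) \<and>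
     (y > real m * \<eta> \<longrightarrow> c m = real m * \<eta>)" for m
  proof (induction m)
    case (Suc m)
    have "0 \<le> real m * \<eta>" using assms by simp
    moreover have "real (Suc m) * \<eta> = real m * \<eta> + \<eta>" by (simp add: algebra_simps)
    ultimately show ?case
      using Suc assms(2) unfolding cS by (smt (verit))
  qed (use assms in \<open>auto simp: c0\<close>)
  show "(\<Sum>j<m. \<eta> * indicator {z. z > real j * \<eta>} y) \<le> y + \<eta> * indicator {0<..} y"
    and "y \<le> real m * \<eta> \<Longrightarrow> y \<le> (\<Sum>j<m. \<eta> * indicator {z. z > real j * \<eta>} y)"
    using *[of m] unfolding c_def by (auto simp del: sum_mult_indicator split: if_splits)
qed

text \<open>Both \<open>\<Lambda> f\<close> and \<open>\<integral>f\<close> are compared with the layer sum \<open>\<Sum>j<m. \<eta> mu {f > j \<eta>}\<close>.\<close>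

lemma nn_integral_riesz:
  assumes f: "f \<in> Ccp"
  shows "(\<integral>\<^sup>+x. ennreal (f x) \<partial>riesz) = ennreal (\<Lambda> f)"
proof -
  from f have fC: "f \<in> Cc \<Omega>" and f0: "\<And>x. 0 \<le> f x" by (auto simp: Ccp_def)
  have fm [measurable]: "f \<in> borel_measurable borel" by (rule Cc_measurable[OF fC])
  obtain B where B: "B > 0" "\<And>x. f x \<le> B" using Cc_bounded[OF fC] by (metis abs_le_D1)
  from fC obtain K where K: "compact K" "K \<subseteq> \<Omega>" "\<And>x. x \<notin> K \<Longrightarrow> f x = 0" by (rule CcE) blast
  define S where "S j \<eta> = {x. f x > real j * \<eta>}" for j :: nat and \<eta> :: real
  have Sm [measurable]: "S j \<eta> \<in> sets borel" for j \<eta> unfolding S_def by measurable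
  define F where "F j \<eta> x = min \<eta> (max 0 (f x - real j * \<eta>))" for j :: nat and \<eta> x
  have FC: "F j \<eta> \<in> Ccp" if "\<eta> > 0" for j \<eta>
  proof -
    have "F j \<eta> \<in> Cc \<Omega>"
      unfolding F_def using that
      by (intro Cc_combine[OF fC fC, where H="\<lambda>y _. min \<eta> (max 0 (y - real j * \<eta>))"])
         (auto intro!: continuous_intros)
    then show ?thesis using that by (auto simp: Ccp_def F_def)
  qed
  \<comment> \<open>All superlevel sets lie in \<open>K\<close>, so \<open>R\<close> bounds the
    error caused by one layer, uniformly in \<open>\<eta>\<close>.\<close>
  define R where "R = mu K"
  have Rfin: "R < \<infinity>" unfolding R_def by (rule mu_compact_finite[OF K(1,2)])
  have SK: "mu (S 0 \<eta>) \<le> R" for \<eta>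
    unfolding R_def by (rule mu_mono) (use K(3) in \<open>force simp: S_def\<close>)
  have main: "ennreal (\<Lambda> f) \<le> (\<integral>\<^sup>+x. ennreal (f x) \<partial>riesz) + ennreal \<eta> * R \<and>
      (\<integral>\<^sup>+x. ennreal (f x) \<partial>riesz) \<le> ennreal (\<Lambda> f) + ennreal \<eta> * R" if \<eta>: "\<eta> > 0" for \<eta>
  proof -
    obtain m :: nat where m0: "B / \<eta> < real m" using reals_Archimedean2 by blast
    then have mB: "B \<le> real m * \<eta>" using \<eta> by (simp add: field_simps)
    have m: "m > 0" using m0 B \<eta> by (metis divide_pos_pos gr0I less_asym' of_nat_0)
    define L where "L = (\<Sum>j<m. ennreal \<eta> * mu (S j \<eta>))"
    have int: "(\<integral>\<^sup>+x. ennreal (\<Sum>j<m. \<eta> * indicator {z. z > real j * \<eta>} (f x)) \<partial>riesz) = L"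
    proof -
      have "(\<integral>\<^sup>+x. ennreal (\<Sum>j<m. \<eta> * indicator {z. z > real j * \<eta>} (f x)) \<partial>riesz)
         = (\<integral>\<^sup>+x. (\<Sum>j<m. ennreal \<eta> * indicator (S j \<eta>) x) \<partial>riesz)"
      proof (intro nn_integral_cong)
        fix x
        have *: "ennreal \<eta> * indicator (S j \<eta>) x = ennreal (\<eta> * indicator {z. z > real j * \<eta>} (f x))" for j
          by (auto simp: S_def indicator_def)
        show "ennreal (\<Sum>j<m. \<eta> * indicator {z. z > real j * \<eta>} (f x)) = (\<Sum>j<m. ennreal \<eta> * indicator (S j \<eta>) x)"
          unfolding * using \<eta> by (intro sum_ennreal[symmetric]) auto
      qed
      also have "\<dots> = (\<Sum>j<m. ennreal \<eta> * emeasure riesz (S j \<eta>))"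
        by (subst nn_integral_sum) (auto simp: nn_integral_cmult_indicator)
      finally show ?thesis by (simp add: L_def emeasure_riesz)
    qed
    have \<Lambda>sum: "ennreal (\<Lambda> f) = (\<Sum>j<m. ennreal (\<Lambda> (F j \<eta>)))"
    proof -
      have "(\<lambda>x. \<Sum>j<m. F j \<eta> x) = f"
        unfolding F_def layer_sum[OF f0 \<eta>] using order_trans[OF B(2) mB] by (simp add: min_absorb2)
      then have "\<Lambda> f = (\<Sum>j<m. \<Lambda> (F j \<eta>))"
        using sum[of "{..<m}" "\<lambda>j. F j \<eta>"] FC[OF \<eta>] by (simp add: Ccp_Cc)
      then show ?thesis using FC[OF \<eta>] by (simp add: sum_ennreal Ccp_\<Lambda>_nonneg)
    qed
    have a: "ennreal (\<Lambda> f) \<le> L"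
      unfolding \<Lambda>sum L_def
      using \<eta> by (intro sum_mono mu_ge FC) (auto simp: F_def S_def)
    have b: "L \<le> ennreal (\<Lambda> f) + ennreal \<eta> * R"
    proof -
      \<comment> \<open>The layer \<open>F j \<eta>\<close> has its full height
        \<open>\<eta>\<close> only on the next superlevel set. Hence the lower comparison is shifted
        by one index, and the unmatched term at level 0 is what costs
        \<open>\<eta> * R\<close>.\<close>
      have bj: "ennreal \<eta> * mu (S (Suc j) \<eta>) \<le> ennreal (\<Lambda> (F j \<eta>))" for j
      proof -
        have "mu (S (Suc j) \<eta>) \<le> ennreal (\<Lambda> (\<lambda>x. (1 / \<eta>) * F j \<eta> x))"
        proof (rule mu_single)
          show "(\<lambda>x. (1 / \<eta>) * F j \<eta> x) \<in> Ccp"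
            using Cc_cmult[OF Ccp_Cc[OF FC[OF \<eta>, of j]], of "1 / \<eta>"]
              Ccp_nonneg[OF FC[OF \<eta>]] \<eta> by (simp add: Ccp_def)
          fix x assume "x \<in> S (Suc j) \<eta>"
          then have "F j \<eta> x = \<eta>" using \<eta> by (auto simp: S_def F_def algebra_simps)
          then show "1 \<le> (1 / \<eta>) * F j \<eta> x" using \<eta> by simp
        qed
        then have "ennreal \<eta> * mu (S (Suc j) \<eta>) \<le> ennreal \<eta> * ennreal ((1 / \<eta>) * \<Lambda> (F j \<eta>))"
          unfolding scale[OF Ccp_Cc[OF FC[OF \<eta>]]] by (intro mult_left_mono) auto
        also have "\<dots> = ennreal (\<Lambda> (F j \<eta>))"
          using \<eta> Ccp_\<Lambda>_nonneg[OF FC[OF \<eta>]] by (subst ennreal_mult[symmetric]) auto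
        finally show ?thesis .
      qed
      obtain m' where m': "m = Suc m'" using m gr0_implies_Suc by blast
      have "L = ennreal \<eta> * mu (S 0 \<eta>) + (\<Sum>j<m'. ennreal \<eta> * mu (S (Suc j) \<eta>))"
        unfolding L_def m' by (rule sum.lessThan_Suc_shift)
      also have "\<dots> \<le> ennreal \<eta> * R + (\<Sum>j<m'. ennreal (\<Lambda> (F j \<eta>)))"
        by (intro add_mono mult_left_mono SK sum_mono bj) auto
      also have "\<dots> \<le> ennreal \<eta> * R + ennreal (\<Lambda> f)"
        unfolding \<Lambda>sum m' by (intro add_left_mono sum_mono2) auto
      finally show ?thesis by (simp add: add.commute)
    qed
    have c: "(\<integral>\<^sup>+x. ennreal (f x) \<partial>riesz) \<le> L"
      unfolding int[symmetric] using f0 \<eta> B(2) mB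
      by (intro nn_integral_mono ennreal_leI layer_count(2)) (auto intro: order_trans)
    have d: "L \<le> (\<integral>\<^sup>+x. ennreal (f x) \<partial>riesz) + ennreal \<eta> * R"
    proof -
      have "L \<le> (\<integral>\<^sup>+x. ennreal (f x) + ennreal \<eta> * indicator (S 0 \<eta>) x \<partial>riesz)"
        unfolding int[symmetric]
      proof (intro nn_integral_mono)
        fix x
        have "ennreal (\<Sum>j<m. \<eta> * indicator {z. z > real j * \<eta>} (f x))
            \<le> ennreal (f x + \<eta> * indicator {0<..} (f x))"
          by (rule ennreal_leI[OF layer_count(1)[OF f0 \<eta>]])
        also have "\<dots> = ennreal (f x) + ennreal \<eta> * indicator (S 0 \<eta>) x"
          using f0[of x] \<eta> by (subst ennreal_plus) (auto simp: S_def indicator_def)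
        finally show "ennreal (\<Sum>j<m. \<eta> * indicator {z. z > real j * \<eta>} (f x))
            \<le> ennreal (f x) + ennreal \<eta> * indicator (S 0 \<eta>) x" .
      qed
      also have "\<dots> = (\<integral>\<^sup>+x. ennreal (f x) \<partial>riesz) + ennreal \<eta> * mu (S 0 \<eta>)"
        by (subst nn_integral_add) (auto simp: nn_integral_cmult_indicator emeasure_riesz)
      also have "\<dots> \<le> (\<integral>\<^sup>+x. ennreal (f x) \<partial>riesz) + ennreal \<eta> * R"
        by (intro add_left_mono mult_left_mono SK) auto
      finally show ?thesis .
    qed
    show ?thesis
      using order_trans[OF a d] order_trans[OF c b] by simp
  qed
  obtain r where r: "R = ennreal r" "r \<ge> 0" using Rfin by (cases R) auto
  have eps: "x \<le> y" if H: "\<And>\<eta>. \<eta> > 0 \<Longrightarrow> x \<le> y + ennreal \<eta> * R" for x y :: ennreal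
  proof (rule ennreal_le_epsilon)
    fix e :: real assume "0 < e"
    then have p: "e / (r + 1) > 0" using r by simp
    have "e / (r + 1) * r \<le> e" using r \<open>0 < e\<close> by (simp add: field_simps)
    then have "ennreal (e / (r + 1)) * R \<le> ennreal e"
      using r p by (simp add: ennreal_mult[symmetric] ennreal_leI del: times_divide_eq_left)
    then show "x \<le> y + ennreal e" using H[OF p] by (meson add_left_mono order_trans)
  qed
  show ?thesis
    by (rule antisym; rule eps) (use main in auto)
qed

lemma integral_riesz:
  assumes f: "f \<in> Cc \<Omega>"
  shows "integrable riesz f" "(\<integral>x. f x \<partial>riesz) = \<Lambda> f"
proof -
  have pos_case: "integrable riesz g \<and> (\<integral>x. g x \<partial>riesz) = \<Lambda> g" if g: "g \<in> Ccp" for g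
  proof -
    have gm: "g \<in> borel_measurable riesz"
      using Cc_measurable[OF Ccp_Cc[OF g]] by measurable
    have "has_bochner_integral riesz g (\<Lambda> g)"
      using gm nn_integral_riesz[OF g] Ccp_\<Lambda>_nonneg[OF g] Ccp_nonneg[OF g]
      by (intro has_bochner_integral_nn_integral) auto
    then show ?thesis by (auto simp: has_bochner_integral_iff)
  qed
  define P where "P x = max 0 (f x)" for x
  define M where "M x = max 0 (- f x)" for x
  have P: "P \<in> Ccp" unfolding P_def Ccp_def
    by (auto intro!: Cc_combine[OF f f, where H="\<lambda>y _. max 0 y"] continuous_intros)
  have M: "M \<in> Ccp" unfolding M_def Ccp_def
    by (auto intro!: Cc_combine[OF f f, where H="\<lambda>y _. max 0 (- y)"] continuous_intros)
  have eq: "f = (\<lambda>x. P x - M x)" by (auto simp: P_def M_def max_def)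
  show "integrable riesz f" "(\<integral>x. f x \<partial>riesz) = \<Lambda> f"
    using pos_case[OF P] pos_case[OF M] diff[OF Ccp_Cc[OF P] Ccp_Cc[OF M]] by (simp_all add: eq)
qed

text \<open>Finite Borel measures are inner regular. This is applied to the restrictions of
  \<open>riesz\<close> to the members of a compact exhaustion of \<open>\<Omega>\<close>, each
  finite by \<open>mu_compact_finite\<close>; continuity from below along the exhaustion does the
  rest.\<close>

lemma riesz_inner_regular:
  assumes A: "A \<in> sets borel" "A \<subseteq> \<Omega>"
  shows "emeasure riesz A = (SUP K\<in>{K. compact K \<and> K \<subseteq> A}. emeasure riesz K)"
proof (rule antisym)
  obtain C :: "nat \<Rightarrow> 'a set" where C: "\<And>n. compact (C n)" "\<And>n. C n \<subseteq> \<Omega>"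
      "\<And>n. C n \<subseteq> interior (C (Suc n))" "(\<Union>n. C n) = \<Omega>"
    using open_Union_compact_subsets[OF open_dom] by metis
  have inc: "incseq (\<lambda>n. A \<inter> C n)"
    by (rule incseq_SucI) (use C(3) interior_subset in blast)
  have [measurable]: "C n \<in> sets borel" for n using C(1) by (simp add: borel_compact)
  have "emeasure riesz A = emeasure riesz (\<Union>n. A \<inter> C n)"
    using A(2) C(4) by (intro arg_cong[where f="emeasure riesz"]) auto
  also have "\<dots> = (SUP n. emeasure riesz (A \<inter> C n))"
    using A by (intro SUP_emeasure_incseq[symmetric] inc) auto
  also have "\<dots> \<le> (SUP K\<in>{K. compact K \<and> K \<subseteq> A}. emeasure riesz K)"
  proof (rule SUP_least)
    fix n
    define M where "M = density riesz (indicator (C n))"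
    have eM: "emeasure M X = emeasure riesz (X \<inter> C n)" if "X \<in> sets borel" for X
    proof -
      have "emeasure M X = (\<integral>\<^sup>+x. indicator (X \<inter> C n) x \<partial>riesz)"
        unfolding M_def indicator_inter_arith using that
        by (subst emeasure_density) (auto simp: mult.commute)
      also have "\<dots> = emeasure riesz (X \<inter> C n)"
        using that by (intro nn_integral_indicator) auto
      finally show ?thesis .
    qed
    have "emeasure M A = (SUP K\<in>{K. K \<subseteq> A \<and> compact K}. emeasure M K)"
    proof (rule inner_regular)
      show "emeasure M (space M) \<noteq> \<infinity>"
        using mu_compact_finite[OF C(1,2)[of n]] eM[of UNIV] by (auto simp: M_def emeasure_riesz)
    qed (use A in \<open>auto simp: M_def\<close>)
    also have "\<dots> \<le> (SUP K\<in>{K. compact K \<and> K \<subseteq> A}. emeasure riesz K)"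
    proof (rule SUP_least)
      fix K assume K: "K \<in> {K. K \<subseteq> A \<and> compact K}"
      then have "emeasure M K = emeasure riesz (K \<inter> C n)" by (intro eM) (auto simp: borel_compact)
      also have "\<dots> \<le> (SUP K\<in>{K. compact K \<and> K \<subseteq> A}. emeasure riesz K)"
        using K C(1) by (intro SUP_upper) auto
      finally show "emeasure M K \<le> (SUP K\<in>{K. compact K \<and> K \<subseteq> A}. emeasure riesz K)" .
    qed
    finally show "emeasure riesz (A \<inter> C n) \<le> (SUP K\<in>{K. compact K \<and> K \<subseteq> A}. emeasure riesz K)"
      using eM[OF A(1)] by simp
  qed
  finally show "emeasure riesz A \<le> (SUP K\<in>{K. compact K \<and> K \<subseteq> A}. emeasure riesz K)" .
  show "(SUP K\<in>{K. compact K \<and> K \<subseteq> A}. emeasure riesz K) \<le> emeasure riesz A"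
    using A by (intro SUP_least emeasure_mono) auto
qed

end

text \<open>Nonempty sets outside \<open>\<Omega>\<close> have infinite \<open>riesz\<close>
  measure, so the measure is restricted to \<open>\<Omega>\<close>. Integrals of functions in
  \<open>Cc\<close> do not change, since these vanish outside \<open>\<Omega>\<close>.\<close>

theorem riesz_representation:
  assumes "positive_functional \<Omega> \<Lambda>"
  obtains \<nu> where "radon_measure_on \<Omega> \<nu>" "\<And>f. f \<in> Cc \<Omega> \<Longrightarrow> (LINT x|\<nu>. f x) = \<Lambda> f"
proof -
  interpret positive_functional \<Omega> \<Lambda> by fact
  have [measurable]: "\<Omega> \<in> sets borel" using open_dom by simp
  let ?\<nu> = "restrict_space riesz \<Omega>"
  have em: "emeasure ?\<nu> A = emeasure riesz A" if "A \<subseteq> \<Omega>" for A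
    using that by (intro emeasure_restrict_space) auto
  have "radon_measure_on \<Omega> ?\<nu>"
    unfolding radon_measure_on_def
  proof (intro conjI allI impI ballI)
    show "sets ?\<nu> = sets (restrict_space borel \<Omega>)" by (intro sets_restrict_space_cong) simp
    fix K assume K: "compact K \<and> K \<subseteq> \<Omega>"
    then show "emeasure ?\<nu> K < \<infinity>"
      using mu_compact_finite[of K] by (simp add: em emeasure_riesz borel_compact)
  next
    fix A assume "A \<in> sets ?\<nu>"
    then have A: "A \<in> sets borel" "A \<subseteq> \<Omega>" by (auto simp: sets_restrict_space_iff)
    then have "emeasure ?\<nu> A = (SUP K\<in>{K. compact K \<and> K \<subseteq> A}. emeasure riesz K)"
      by (simp add: em riesz_inner_regular)
    also have "\<dots> = (SUP K\<in>{K. compact K \<and> K \<subseteq> A}. emeasure ?\<nu> K)"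
      using A by (intro SUP_cong) (auto simp: em)
    finally show "emeasure ?\<nu> A = (SUP K\<in>{K. compact K \<and> K \<subseteq> A}. emeasure ?\<nu> K)" .
  qed
  moreover have "(LINT x|?\<nu>. f x) = \<Lambda> f" if f: "f \<in> Cc \<Omega>" for f
  proof -
    from f obtain K where K: "K \<subseteq> \<Omega>" "\<And>x. x \<notin> K \<Longrightarrow> f x = 0" by (rule CcE) blast
    have "(LINT x|?\<nu>. f x) = (LINT x:\<Omega>|riesz. f x)"
      by (subst integral_restrict_space) (auto simp: set_lebesgue_integral_def)
    also have "\<dots> = (LINT x|riesz. f x)"
      unfolding set_lebesgue_integral_def using K
      by (intro Bochner_Integration.integral_cong) (auto simp: indicator_def)
    finally show ?thesis using integral_riesz(2)[OF f] by simp
  qed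
  ultimately show ?thesis by (rule that)
qed

section \<open>Inf-convolution\<close>

text \<open>The Moreau envelope of \<open>v\<close> with parameter \<open>d\<close>.\<close>

definition infc :: "real \<Rightarrow> ('a::euclidean_space \<Rightarrow> real) \<Rightarrow> 'a \<Rightarrow> real" where
  "infc d v x = (INF y. v y + (norm (y - x))\<^sup>2 / (2 * d))"

locale inf_convolution =
  fixes d :: real and v :: "'a::euclidean_space \<Rightarrow> real"
  assumes d: "d > 0" and cont: "continuous_on UNIV v" and nonneg: "\<And>x. 0 \<le> v x"
begin

lemma le: "infc d v x \<le> v y + (norm (y - x))\<^sup>2 / (2 * d)"
  unfolding infc_def using nonneg d
  by (intro cINF_lower bdd_belowI2[of _ 0]) (auto intro!: add_nonneg_nonneg)

lemma le_self: "infc d v x \<le> v x"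
  using le[of x x] by simp

lemma ge0: "0 \<le> infc d v x"
  unfolding infc_def using nonneg d by (intro cINF_greatest) (auto intro!: add_nonneg_nonneg)

lemma attained: "\<exists>y. infc d v x = v y + (norm (y - x))\<^sup>2 / (2 * d)"
proof -
  define h where "h y = v y + (norm (y - x))\<^sup>2 / (2 * d)" for y
  \<comment> \<open>Beyond distance \<open>R\<close> the quadratic term alone exceeds
    \<open>v x\<close>, the value at the competitor \<open>y = x\<close>. The minimum over the
    compact ball is therefore global.\<close>
  define R where "R = sqrt (2 * d * v x)"
  have R: "R \<ge> 0" "R\<^sup>2 = 2 * d * v x" using d nonneg by (auto simp: R_def)
  have "\<exists>y\<in>cball x R. \<forall>z\<in>cball x R. h y \<le> h z"
    unfolding h_def using R d
    by (intro continuous_attains_inf)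
       (auto intro!: continuous_intros continuous_on_subset[OF cont])
  then obtain y where y: "\<And>z. z \<in> cball x R \<Longrightarrow> h y \<le> h z" by blast
  have "h y \<le> h z" for z
  proof (cases "z \<in> cball x R")
    case False
    then have "R < norm (z - x)" by (simp add: dist_norm norm_minus_commute)
    then have "R\<^sup>2 < (norm (z - x))\<^sup>2" using R by (intro power_strict_mono) auto
    then have "v x \<le> (norm (z - x))\<^sup>2 / (2 * d)" using d R by (simp add: field_simps)
    then have "h x \<le> h z" using nonneg[of z] by (simp add: h_def)
    then show ?thesis using y[of x] R by auto
  qed (rule y)
  then have "infc d v x = h y"
    unfolding infc_def h_def by (intro cInf_eq_minimum) auto
  then show ?thesis by (auto simp: h_def)
qed

text \<open>If \<open>y\<close> is a minimiser for \<open>x\<close>, then \<open>y + h\<close> is a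
  competitor for \<open>x + h\<close> with the same quadratic term, which cancels in the difference.
  The point \<open>y\<close> does not depend on \<open>h\<close>, so the inequality can be
  integrated against a kernel in \<open>h\<close>. Its distance to \<open>x\<close> is controlled
  because the quadratic term is at most \<open>v x\<close>.\<close>

lemma translate:
  "\<exists>y. (norm (y - x))\<^sup>2 \<le> 2 * d * v x \<and> infc d v x = v y + (norm (y - x))\<^sup>2 / (2 * d) \<and>
       (\<forall>h. infc d v (x + h) - infc d v x \<le> v (y + h) - v y)"
proof -
  obtain y where y: "infc d v x = v y + (norm (y - x))\<^sup>2 / (2 * d)" using attained by blast
  have "(norm (y - x))\<^sup>2 / (2 * d) \<le> v x" using le_self[of x] y nonneg[of y] by simp
  then have "(norm (y - x))\<^sup>2 \<le> 2 * d * v x" using d by (simp add: field_simps)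
  moreover have "infc d v (x + h) - infc d v x \<le> v (y + h) - v y" for h
    using le[of "x + h" "y + h"] y by simp
  ultimately show ?thesis using y by blast
qed

text \<open>Here the minimiser \<open>y\<close> stays fixed while \<open>x\<close> moves to
  \<open>x + h\<close> and \<open>x - h\<close>: only the quadratic term changes, and the
  parallelogram law evaluates its second difference. No regularity of \<open>v\<close> enters the
  constant.\<close>

lemma semiconcave: "infc d v (x + h) + infc d v (x - h) - 2 * infc d v x \<le> (norm h)\<^sup>2 / d"
proof -
  obtain y where y: "infc d v x = v y + (norm (y - x))\<^sup>2 / (2 * d)" using attained by blast
  define k where "k = y - x"
  have 1: "infc d v (x + h) \<le> v y + (norm (k - h))\<^sup>2 / (2 * d)"
    using le[of "x + h" y] by (simp add: k_def algebra_simps)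
  have 2: "infc d v (x - h) \<le> v y + (norm (k + h))\<^sup>2 / (2 * d)"
    using le[of "x - h" y] by (simp add: k_def algebra_simps)
  have "(norm (k - h))\<^sup>2 + (norm (k + h))\<^sup>2 = 2 * (norm k)\<^sup>2 + 2 * (norm h)\<^sup>2"
    by (simp add: power2_norm_eq_inner algebra_simps inner_commute)
  then have "(norm (k - h))\<^sup>2 / (2 * d) + (norm (k + h))\<^sup>2 / (2 * d) = (norm k)\<^sup>2 / d + (norm h)\<^sup>2 / d"
    using d by (simp add: field_simps)
  moreover have "2 * infc d v x = 2 * v y + (norm k)\<^sup>2 / d" using d by (simp add: y k_def field_simps)
  ultimately show ?thesis using 1 2 by linarith
qed

text \<open>An infimum of continuous functions is upper semicontinuous. This covers slices of a
  solution, which may be unbounded and so lie outside the scope of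
  \<open>continuous_infc\<close>.\<close>

lemma measurable_infc: "infc d v \<in> borel_measurable borel"
proof -
  have "{x. infc d v x < a} = (\<Union>y. {x. v y + (norm (y - x))\<^sup>2 / (2 * d) < a})" for a
  proof safe
    fix x assume "infc d v x < a"
    then show "x \<in> (\<Union>y. {x. v y + (norm (y - x))\<^sup>2 / (2 * d) < a})" using attained[of x] by auto
  next
    fix x y assume "v y + (norm (y - x))\<^sup>2 / (2 * d) < a"
    then show "infc d v x < a" using le[of x y] by simp
  qed
  moreover have "open (\<Union>y. {x. v y + (norm (y - x))\<^sup>2 / (2 * d) < a})" for a
    using d by (intro open_UN ballI open_Collect_less continuous_intros) auto
  ultimately show ?thesis
    by (subst borel_measurable_iff_less) auto
qed

text \<open>The bound \<open>B\<close> places all minimisers within the same distance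
  \<open>L\<close> of their points. Reusing the minimiser of \<open>x\<close> at a nearby point then
  changes the quadratic term by a small amount, and exchanging the two points gives the other
  direction.\<close>

lemma continuous_infc:
  assumes B: "\<And>x. v x \<le> B"
  shows "continuous_on UNIV (infc d v)"
proof -
  define L where "L = sqrt (2 * d * B)"
  have B0: "0 \<le> B" using nonneg B order_trans by blast
  have L0: "L \<ge> 0" "L\<^sup>2 = 2 * d * B" using d B0 by (auto simp: L_def)
  have half: "infc d v x' - infc d v x \<le> dist x' x * (2 * L + dist x' x) / (2 * d)" for x x'
  proof -
    obtain y where y: "(norm (y - x))\<^sup>2 \<le> 2 * d * v x" "infc d v x = v y + (norm (y - x))\<^sup>2 / (2 * d)"
      using translate[of x] by blast
    have "(norm (y - x))\<^sup>2 \<le> L\<^sup>2" unfolding L0(2) using y(1) B[of x] d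
      by (smt (verit) mult_left_mono)
    then have yL: "norm (y - x) \<le> L" using L0(1) by (rule power2_le_imp_le)
    have tri: "norm (y - x') \<le> norm (y - x) + dist x' x"
      by (metis dist_norm dist_triangle2 dist_commute)
    have "(norm (y - x'))\<^sup>2 \<le> (norm (y - x) + dist x' x)\<^sup>2"
      using tri by (intro power_mono) auto
    also have "\<dots> = (norm (y - x))\<^sup>2 + dist x' x * (2 * norm (y - x) + dist x' x)"
      by (simp add: power2_eq_square algebra_simps)
    also have "\<dots> \<le> (norm (y - x))\<^sup>2 + dist x' x * (2 * L + dist x' x)"
      using yL by (intro add_left_mono mult_left_mono) auto
    finally have "(norm (y - x'))\<^sup>2 / (2 * d) \<le> ((norm (y - x))\<^sup>2 + dist x' x * (2 * L + dist x' x)) / (2 * d)"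
      using d by (intro divide_right_mono) auto
    then show ?thesis using le[of x' y] y(2) by (simp add: add_divide_distrib)
  qed
  have lim: "((\<lambda>x'. dist x' x * (2 * L + dist x' x) / (2 * d)) \<longlongrightarrow> 0) (at x)" for x :: 'a
    using d by (auto intro!: tendsto_eq_intros)
  have "(infc d v \<longlongrightarrow> infc d v x) (at x)" for x
  proof (rule Lim_null_comparison[THEN LIM_zero_cancel])
    show "\<forall>\<^sub>F x' in at x. norm (infc d v x' - infc d v x) \<le> dist x' x * (2 * L + dist x' x) / (2 * d)"
    proof (intro always_eventually allI)
      fix x'
      show "norm (infc d v x' - infc d v x) \<le> dist x' x * (2 * L + dist x' x) / (2 * d)"
        using half[of x' x] half[of x x'] by (simp add: abs_le_iff dist_commute)
    qed
  qed (rule lim)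
  then show ?thesis by (simp add: continuous_on_def)
qed

end

section \<open>The singular kernel\<close>

lemma lborel_reflect: "distr lborel borel uminus = (lborel :: 'a::euclidean_space measure)"
  using lborel_affine[of "-1" "0 :: 'a"] by (simp add: density_1 uminus_add_conv_diff[symmetric] o_def)

lemma integral_lborel_reflect:
  fixes f :: "'a::euclidean_space \<Rightarrow> real"
  assumes [measurable]: "f \<in> borel_measurable borel"
  shows "(\<integral>x. f (- x) \<partial>lborel) = (\<integral>x. f x \<partial>lborel)"
    and "integrable lborel (\<lambda>x. f (- x)) \<longleftrightarrow> integrable lborel f"
  using integral_distr[of uminus lborel borel f] integrable_distr_eq[of uminus lborel borel f]
  by (simp_all add: lborel_reflect)

lemma integral_lborel_translate:
  fixes f :: "'a::euclidean_space \<Rightarrow> real"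
  assumes [measurable]: "f \<in> borel_measurable borel"
  shows "(\<integral>x. f (c + x) \<partial>lborel) = (\<integral>x. f x \<partial>lborel)"
    and "integrable lborel (\<lambda>x. f (c + x)) \<longleftrightarrow> integrable lborel f"
    and "(\<integral>\<^sup>+x. ennreal (f (c + x)) \<partial>lborel) = (\<integral>\<^sup>+x. ennreal (f x) \<partial>lborel)"
  using integral_distr[of "(+) c" lborel borel f] integrable_distr_eq[of "(+) c" lborel borel f]
    nn_integral_distr[of "(+) c" lborel borel "\<lambda>x. ennreal (f x)"]
  by (simp_all add: lborel_distr_plus)

text \<open>The set \<open>S\<close> selects the admissible values of |h|: complements of balls,
  annuli and punctured balls all occur.\<close>

definition ker :: "real \<Rightarrow> real set \<Rightarrow> 'a::euclidean_space \<Rightarrow> real" where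
  "ker p S h = indicator S (norm h) * norm h powr (- p)"

lemma ker_nonneg: "0 \<le> ker p S h"
  by (simp add: ker_def)

lemma ker_minus: "ker p S (- h) = ker p S h"
  by (simp add: ker_def)

lemma ker_measurable [measurable]: "S \<in> sets borel \<Longrightarrow> ker p S \<in> borel_measurable borel"
  unfolding ker_def[abs_def]
  by (intro borel_measurable_times measurable_compose[OF borel_measurable_norm, of "indicator S"]
      borel_measurable_indicator powr_real_measurable borel_measurable_const borel_measurable_norm)

lemma ker_split: "a \<le> b \<Longrightarrow> ker p {a<..} h = ker p {a<..b} h + ker p {b<..} h"
  by (auto simp: ker_def indicator_def)

text \<open>A replacement for polar coordinates. Each dyadic shell is enlarged to the ball of its
  outer radius, and the products of bound and volume form a geometric series.\<close>

lemma nn_integral_dyadic: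
  fixes \<phi> :: "'a::euclidean_space \<Rightarrow> real"
  assumes \<phi>: "\<And>h. \<phi> h > 0 \<Longrightarrow> \<exists>j. norm h \<le> r j \<and> \<phi> h \<le> b j"
    and r: "\<And>j. 0 \<le> r j" and b: "\<And>j. 0 \<le> b j"
    and q: "\<And>j. b j * r j ^ DIM('a) = c * q ^ j" "0 \<le> c" "0 \<le> q" "q < 1"
  shows "(\<integral>\<^sup>+h. ennreal (\<phi> h) \<partial>lborel) \<le> ennreal (unit_ball_vol (real DIM('a)) * (c / (1 - q)))"
proof -
  let ?V = "unit_ball_vol (real DIM('a))"
  have "(\<integral>\<^sup>+h. ennreal (\<phi> h) \<partial>lborel) \<le> (\<integral>\<^sup>+h. (\<Sum>j. ennreal (b j) * indicator (cball 0 (r j)) h) \<partial>(lborel :: 'a measure))"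
  proof (rule nn_integral_mono)
    fix h
    show "ennreal (\<phi> h) \<le> (\<Sum>j. ennreal (b j) * indicator (cball 0 (r j)) h)"
    proof (cases "\<phi> h > 0")
      case True
      then obtain j where j: "norm h \<le> r j" "\<phi> h \<le> b j" using \<phi> by blast
      define t where "t j = ennreal (b j) * indicator (cball 0 (r j)) h" for j
      have "ennreal (\<phi> h) \<le> t j" using j by (simp add: t_def ennreal_leI)
      also have "t j \<le> (\<Sum>j. t j)"
        using sum_le_suminf[of t "{j}"] by simp
      also have "\<dots> = (\<Sum>j. ennreal (b j) * indicator (cball 0 (r j)) h)"
        by (simp add: t_def)
      finally show ?thesis .
    qed (simp add: ennreal_neg)
  qed
  also have "\<dots> = (\<Sum>j. ennreal (b j) * emeasure lborel (cball (0::'a) (r j)))"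
    by (subst nn_integral_suminf)
       (auto simp: nn_integral_cmult_indicator intro!: borel_measurable_times_ennreal borel_measurable_indicator)
  also have "\<dots> = (\<Sum>j. ennreal ((?V * c) * q ^ j))"
  proof (intro arg_cong[where f=suminf] ext)
    fix j
    have "ennreal (b j) * emeasure lborel (cball (0::'a) (r j)) = ennreal (b j * (?V * r j ^ DIM('a)))"
      using b r by (simp add: emeasure_cball ennreal_mult)
    also have "b j * (?V * r j ^ DIM('a)) = (?V * c) * q ^ j"
      using q(1)[of j] by (simp add: mult.left_commute mult.commute)
    finally show "ennreal (b j) * emeasure lborel (cball (0::'a) (r j)) = ennreal ((?V * c) * q ^ j)" .
  qed
  also have "\<dots> = ennreal ((?V * c) * (1 / (1 - q)))"
    using q by (intro suminf_ennreal_eq sums_mult geometric_sums) auto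
  finally show ?thesis by simp
qed

text \<open>On the shell between \<open>\<epsilon> * 2 ^ j\<close> and twice that radius the kernel
  is largest at the inner radius. Multiplied by the volume of the outer ball this gives a series of
  ratio \<open>2 powr (N - p)\<close>, which converges because p exceeds the dimension.\<close>

lemma ker_tail_integrable:
  assumes p: "real DIM('a::euclidean_space) < p" and e: "\<epsilon> > 0"
  shows "integrable lborel (ker p {\<epsilon><..} :: 'a \<Rightarrow> real)"
proof -
  define N where "N = DIM('a)"
  have "(\<integral>\<^sup>+h. ennreal (ker p {\<epsilon><..} (h::'a)) \<partial>lborel)
     \<le> ennreal (unit_ball_vol (real DIM('a)) * (\<epsilon> powr (- p) * (2 * \<epsilon>) ^ N / (1 - 2 powr (real N - p))))"
  proof (rule nn_integral_dyadic[where r = "\<lambda>j. 2 * \<epsilon> * 2 ^ j" and b = "\<lambda>j. (\<epsilon> * 2 ^ j) powr (- p)"])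
    fix h :: 'a assume "ker p {\<epsilon><..} h > 0"
    then have h: "norm h > \<epsilon>" by (cases "norm h > \<epsilon>") (auto simp: ker_def)
    define j where "j = (LEAST j. norm h \<le> 2 * \<epsilon> * 2 ^ j)"
    have "\<exists>j. norm h / (2 * \<epsilon>) < 2 ^ j" by (rule real_arch_pow) simp
    then have "\<exists>j. norm h \<le> 2 * \<epsilon> * 2 ^ j" using e by (auto simp: field_simps intro: less_imp_le)
    then have 1: "norm h \<le> 2 * \<epsilon> * 2 ^ j" unfolding j_def by (rule LeastI_ex)
    have 2: "\<epsilon> * 2 ^ j \<le> norm h"
    proof (cases j)
      case (Suc i)
      then have "\<not> norm h \<le> 2 * \<epsilon> * 2 ^ i" using not_less_Least[of i "\<lambda>j. norm h \<le> 2 * \<epsilon> * 2 ^ j"] by (simp add: j_def)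
      then show ?thesis using Suc by simp
    qed (use h in simp)
    have "ker p {\<epsilon><..} h \<le> (\<epsilon> * 2 ^ j) powr (- p)"
      using 2 e p h by (auto simp: ker_def intro!: powr_mono2')
    with 1 show "\<exists>j. norm h \<le> 2 * \<epsilon> * 2 ^ j \<and> ker p {\<epsilon><..} h \<le> (\<epsilon> * 2 ^ j) powr (- p)" by blast
  next
    fix j
    have "(\<epsilon> * 2 ^ j) powr (- p) = \<epsilon> powr (- p) * (2 powr (- p)) ^ j"
      by (simp add: powr_mult powr_realpow[symmetric] powr_powr mult.commute)
    moreover have "2 powr (real N - p) = 2 ^ N * 2 powr (- p)"
      by (simp add: powr_diff powr_realpow powr_minus divide_inverse)
    ultimately show "(\<epsilon> * 2 ^ j) powr (- p) * (2 * \<epsilon> * 2 ^ j) ^ DIM('a)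
       = \<epsilon> powr (- p) * (2 * \<epsilon>) ^ N * (2 powr (real N - p)) ^ j"
      by (simp add: N_def power_mult_distrib power_mult[symmetric] mult.commute mult.left_commute)
  qed (use e p in \<open>auto simp: N_def powr_less_one\<close>)
  then show ?thesis
    by (intro integrableI_nonneg) (auto simp: ker_nonneg intro: order_le_less_trans)
qed

text \<open>Shells shrinking by halves give the ratio \<open>2 powr (p - 2 - N)\<close>, and scaling
  yields the power of \<open>\<rho>\<close>; \<open>C\<close> is independent of
  \<open>\<rho>\<close>. The factor \<open>2 powr \<bar>p\<bar>\<close> compares the kernel on a
  shell with its value at the outer radius for either sign of \<open>p\<close>.\<close>

lemma ker_near_integrable:
  assumes p: "p < real DIM('a::euclidean_space) + 2"
  obtains C where "C \<ge> 0"
    "\<And>\<rho>. \<rho> > 0 \<Longrightarrow> integrable lborel (\<lambda>h::'a. (norm h)\<^sup>2 * ker p {0<..\<rho>} h)"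
    "\<And>\<rho>. \<rho> > 0 \<Longrightarrow> (\<integral>h. (norm (h::'a))\<^sup>2 * ker p {0<..\<rho>} h \<partial>lborel) \<le> C * \<rho> powr (real DIM('a) + 2 - p)"
proof -
  define N where "N = DIM('a)"
  define q where "q = 2 powr (p - 2 - real N)"
  have q: "0 \<le> q" "q < 1" using p by (auto simp: q_def N_def powr_less_one)
  define C where "C = unit_ball_vol (real DIM('a)) * (2 powr \<bar>p\<bar> / (1 - q))"
  have C0: "C \<ge> 0" using q by (auto simp: C_def)
  have main: "(\<integral>\<^sup>+h. ennreal ((norm h)\<^sup>2 * ker p {0<..\<rho>} (h::'a)) \<partial>lborel)
     \<le> ennreal (C * \<rho> powr (real DIM('a) + 2 - p))" if \<rho>: "\<rho> > 0" for \<rho>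
  proof -
    have "(\<integral>\<^sup>+h. ennreal ((norm h)\<^sup>2 * ker p {0<..\<rho>} (h::'a)) \<partial>lborel)
      \<le> ennreal (unit_ball_vol (real DIM('a)) * (2 powr \<bar>p\<bar> * \<rho> powr (real N + 2 - p) / (1 - q)))"
    proof (rule nn_integral_dyadic[where r = "\<lambda>j. \<rho> / 2 ^ j" and
          b = "\<lambda>j. (\<rho> / 2 ^ j)\<^sup>2 * (2 powr \<bar>p\<bar> * (\<rho> / 2 ^ j) powr (- p))"])
      fix h :: 'a assume "(norm h)\<^sup>2 * ker p {0<..\<rho>} h > 0"
      then have h: "0 < norm h" "norm h \<le> \<rho>"
        by (cases "0 < norm h \<and> norm h \<le> \<rho>"; auto simp: ker_def)+
      define j where "j = (LEAST j. \<rho> < norm h * 2 ^ Suc j)"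
      have "\<exists>j. \<rho> / norm h < 2 ^ j" by (rule real_arch_pow) simp
      then obtain i where "\<rho> / norm h < 2 ^ i" by blast
      then have "\<rho> < norm h * 2 ^ i" using h by (simp add: field_simps)
      also have "\<dots> \<le> norm h * 2 ^ Suc i" by (intro mult_left_mono power_increasing) auto
      finally have "\<rho> < norm h * 2 ^ Suc i" .
      then have 1: "\<rho> < norm h * 2 ^ Suc j" unfolding j_def by (rule LeastI)
      have 2: "norm h * 2 ^ j \<le> \<rho>"
      proof (cases j)
        case (Suc i)
        then have "\<not> \<rho> < norm h * 2 ^ Suc i" using not_less_Least[of i "\<lambda>j. \<rho> < norm h * 2 ^ Suc j"] by (simp add: j_def)
        then show ?thesis using Suc by simp
      qed (use h in simp)
      define y where "y = \<rho> / 2 ^ j"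
      have y: "norm h \<le> y" "y / 2 \<le> norm h" "y > 0" using 1 2 \<rho> by (auto simp: y_def field_simps)
      have "norm h powr (- p) \<le> 2 powr \<bar>p\<bar> * y powr (- p)"
      proof (cases "p \<ge> 0")
        case True
        then have "norm h powr (- p) \<le> (y / 2) powr (- p)" using y by (intro powr_mono2') auto
        also have "\<dots> = 2 powr \<bar>p\<bar> * y powr (- p)"
          using True unfolding powr_divide by (simp add: powr_minus_divide[of 2 p])
        finally show ?thesis .
      next
        case False
        then have "norm h powr (- p) \<le> y powr (- p)" using y by (intro powr_mono2) auto
        also have "\<dots> \<le> 2 powr \<bar>p\<bar> * y powr (- p)"
          using mult_right_mono[of 1 "2 powr \<bar>p\<bar>" "y powr (- p)"] ge_one_powr_ge_zero[of 2 "\<bar>p\<bar>"] by simp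
        finally show ?thesis .
      qed
      then have "(norm h)\<^sup>2 * ker p {0<..\<rho>} h \<le> y\<^sup>2 * (2 powr \<bar>p\<bar> * y powr (- p))"
        using h y by (auto simp: ker_def intro!: mult_mono power_mono)
      with y(1) show "\<exists>j. norm h \<le> \<rho> / 2 ^ j \<and> (norm h)\<^sup>2 * ker p {0<..\<rho>} h \<le> (\<rho> / 2 ^ j)\<^sup>2 * (2 powr \<bar>p\<bar> * (\<rho> / 2 ^ j) powr (- p))"
        unfolding y_def by blast
    next
      fix j
      have y: "\<rho> / 2 ^ j > 0" using \<rho> by simp
      have "(\<rho> / 2 ^ j)\<^sup>2 * (2 powr \<bar>p\<bar> * (\<rho> / 2 ^ j) powr (- p)) * (\<rho> / 2 ^ j) ^ DIM('a)
         = 2 powr \<bar>p\<bar> * (\<rho> / 2 ^ j) powr (real N + 2 - p)"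
        using powr_add[of "\<rho> / 2 ^ j" "real N + 2" "- p"] powr_add[of "\<rho> / 2 ^ j" "real N" 2]
          powr_realpow[OF y, of N] powr_numeral[of "\<rho> / 2 ^ j" "num.Bit0 num.One"] y
        by (simp only: N_def add_uminus_conv_diff mult.assoc mult.commute mult.left_commute less_imp_le)
      also have "(\<rho> / 2 ^ j) powr (real N + 2 - p) = \<rho> powr (real N + 2 - p) * ((1 / 2) ^ j) powr (real N + 2 - p)"
        unfolding powr_mult[symmetric] by (simp add: power_one_over)
      also have "((1 / 2) ^ j :: real) powr (real N + 2 - p) = q ^ j"
      proof -
        have "((1 / 2) ^ j :: real) powr (real N + 2 - p) = (2 powr (- real j)) powr (real N + 2 - p)"
          by (simp add: powr_minus_divide powr_realpow power_one_over)
        also have "\<dots> = q powr real j" by (simp add: q_def powr_powr algebra_simps)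
        also have "\<dots> = q ^ j" by (rule powr_realpow) (simp add: q_def)
        finally show ?thesis .
      qed
      finally show "(\<rho> / 2 ^ j)\<^sup>2 * (2 powr \<bar>p\<bar> * (\<rho> / 2 ^ j) powr (- p)) * (\<rho> / 2 ^ j) ^ DIM('a)
         = 2 powr \<bar>p\<bar> * \<rho> powr (real N + 2 - p) * q ^ j" by simp
    qed (use \<rho> q in auto)
    then show ?thesis by (simp add: C_def N_def mult.assoc)
  qed
  have int: "integrable lborel (\<lambda>h::'a. (norm h)\<^sup>2 * ker p {0<..\<rho>} h)" if "\<rho> > 0" for \<rho>
    using main[OF that]
    by (intro integrableI_nonneg) (auto simp: ker_nonneg intro: order_le_less_trans)
  have "(\<integral>h. (norm (h::'a))\<^sup>2 * ker p {0<..\<rho>} h \<partial>lborel) \<le> C * \<rho> powr (real DIM('a) + 2 - p)" if "\<rho> > 0" for \<rho>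
  proof -
    have "ennreal (\<integral>h. (norm (h::'a))\<^sup>2 * ker p {0<..\<rho>} h \<partial>lborel) \<le> ennreal (C * \<rho> powr (real DIM('a) + 2 - p))"
      using main[OF that] by (subst nn_integral_eq_integral[symmetric, OF int[OF that]]) (auto simp: ker_nonneg)
    then show ?thesis using C0 by (subst (asm) ennreal_le_iff) auto
  qed
  with C0 int show ?thesis by (rule that)
qed

text \<open>Both terms of the constant come from |h| > \<epsilon>: first 1 \<le> (|h| /
  \<epsilon>)^p, then |x + h| \<le> R + |h| \<le> (R / \<epsilon> + 1) |h|. The bound is uniform for
  x in a ball, hence on the support of a test function.\<close>

lemma tail_weight:
  assumes p: "0 < p" and e: "\<epsilon> > 0" and x: "norm x \<le> R"
  shows "ker p {\<epsilon><..} h \<le> (\<epsilon> powr (- p) + (R / \<epsilon> + 1) powr p) / (1 + norm (x + h :: 'a::euclidean_space) powr p)"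
proof (cases "norm h > \<epsilon>")
  case True
  have R: "R \<ge> 0" using x norm_ge_zero order_trans by blast
  have h: "norm h > 0" using True e by linarith
  have "norm (x + h) \<le> R + norm h" using norm_triangle_ineq[of x h] x by linarith
  also have "\<dots> \<le> (R / \<epsilon> + 1) * norm h"
    using mult_left_mono[of \<epsilon> "norm h" "R / \<epsilon>"] True R e by (simp add: algebra_simps)
  finally have 1: "norm (x + h) powr p \<le> (R / \<epsilon> + 1) powr p * norm h powr p"
    using p h R e by (subst powr_mult[symmetric]) (intro powr_mono2, auto)
  have 2: "1 \<le> \<epsilon> powr (- p) * norm h powr p"
    using p e True by (simp add: powr_minus field_simps powr_mono2)
  have "1 + norm (x + h) powr p \<le> (\<epsilon> powr (- p) + (R / \<epsilon> + 1) powr p) * norm h powr p"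
    using 1 2 by (simp add: algebra_simps)
  then have "norm h powr (- p) * (1 + norm (x + h) powr p) \<le> \<epsilon> powr (- p) + (R / \<epsilon> + 1) powr p"
    using h by (simp add: powr_minus field_simps)
  moreover have "1 + norm (x + h) powr p > 0" by (simp add: add_pos_nonneg)
  ultimately show ?thesis
    using True by (simp add: ker_def pos_le_divide_eq)
qed (auto simp: ker_def intro!: divide_nonneg_nonneg add_nonneg_nonneg)

section \<open>Integrability against the weight of the solution space\<close>

definition weighted_L1 :: "real \<Rightarrow> ('a::euclidean_space \<Rightarrow> real) set" where
  "weighted_L1 p = {v \<in> borel_measurable borel. integrable lborel (\<lambda>x. v x / (1 + norm x powr p))}"

lemma weighted_L1_mono:
  assumes v: "v \<in> weighted_L1 p" and w: "w \<in> borel_measurable borel" "\<And>x. \<bar>w x\<bar> \<le> v x"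
  shows "w \<in> weighted_L1 p"
proof -
  have [measurable]: "w \<in> borel_measurable borel" by fact
  have "integrable lborel (\<lambda>x. w x / (1 + norm x powr p))"
  proof (rule Bochner_Integration.integrable_bound)
    show "integrable lborel (\<lambda>x. v x / (1 + norm x powr p))" using v by (simp add: weighted_L1_def)
    show "AE x in lborel. norm (w x / (1 + norm x powr p)) \<le> norm (v x / (1 + norm x powr p))"
      using w(2) by (auto simp: abs_divide add_nonneg_nonneg intro!: divide_right_mono order_trans[OF w(2)])
  qed measurable
  then show ?thesis using w(1) by (simp add: weighted_L1_def)
qed

lemma weighted_L1_tail:
  assumes v: "v \<in> weighted_L1 p" and v0: "\<And>x. 0 \<le> v x" and p: "0 < p" and e: "\<epsilon> > 0" and x: "norm x \<le> R"
  shows "integrable lborel (\<lambda>h. v (x + h :: 'a::euclidean_space) * ker p {\<epsilon><..} h)"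
    and "(\<integral>h. v (x + h) * ker p {\<epsilon><..} h \<partial>lborel)
       \<le> (\<epsilon> powr (- p) + (R / \<epsilon> + 1) powr p) * (\<integral>x. v x / (1 + norm x powr p) \<partial>lborel)"
proof -
  define C where "C = \<epsilon> powr (- p) + (R / \<epsilon> + 1) powr p"
  have [measurable]: "v \<in> borel_measurable borel" using v by (simp add: weighted_L1_def)
  have int: "integrable lborel (\<lambda>z. C * (v z / (1 + norm z powr p)))"
    using v by (intro integrable_mult_right) (simp add: weighted_L1_def)
  then have int': "integrable lborel (\<lambda>h. C * (v (x + h) / (1 + norm (x + h) powr p)))"
    by (subst (asm) integral_lborel_translate(2)[symmetric, of _ x]) auto
  have bd: "v (x + h) * ker p {\<epsilon><..} h \<le> C * (v (x + h) / (1 + norm (x + h) powr p))" for h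
    using mult_left_mono[OF tail_weight[OF p e x, of h] v0[of "x + h"]] by (simp add: C_def mult.commute)
  show 1: "integrable lborel (\<lambda>h. v (x + h) * ker p {\<epsilon><..} h)"
    using bd by (intro Bochner_Integration.integrable_bound[OF int'])
      (auto intro!: AE_I2 simp: ker_nonneg v0 simp del: times_divide_eq_right intro: order_trans[OF _ abs_ge_self])
  have "(\<integral>h. v (x + h) * ker p {\<epsilon><..} h \<partial>lborel) \<le> (\<integral>h. C * (v (x + h) / (1 + norm (x + h) powr p)) \<partial>lborel)"
    by (intro integral_mono 1 int' bd)
  also have "\<dots> = (\<integral>h. C * (v h / (1 + norm h powr p)) \<partial>lborel)"
    using integral_lborel_translate(1)[of "\<lambda>h. C * (v h / (1 + norm h powr p))" x] by simp
  finally show "(\<integral>h. v (x + h) * ker p {\<epsilon><..} h \<partial>lborel)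
       \<le> (\<epsilon> powr (- p) + (R / \<epsilon> + 1) powr p) * (\<integral>x. v x / (1 + norm x powr p) \<partial>lborel)"
    unfolding C_def[symmetric] by (simp only: integral_mult_right_zero)
qed

section \<open>The integrated inequality for the truncated operators\<close>

lemma Cc_integrable:
  assumes f: "f \<in> Cc \<Omega>"
  shows "integrable lborel f"
proof -
  from f obtain K where K: "continuous_on UNIV f" "compact K" "\<And>x. x \<notin> K \<Longrightarrow> f x = 0" by (rule CcE) blast
  have "integrable lborel (\<lambda>x. indicator K x *\<^sub>R f x)"
    using K by (intro borel_integrable_compact) (auto intro: continuous_on_subset)
  also have "(\<lambda>x. indicator K x *\<^sub>R f x) = f" using K(3) by (auto simp: fun_eq_iff indicator_def)
  finally show ?thesis .
qed

lemma Cc_weighted_L1: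
  assumes f: "f \<in> Cc \<Omega>"
  shows "f \<in> weighted_L1 p"
proof -
  have [measurable]: "f \<in> borel_measurable borel" by (rule Cc_measurable[OF f])
  have "integrable lborel (\<lambda>x. f x / (1 + norm x powr p))"
    by (rule Bochner_Integration.integrable_bound[OF Cc_integrable[OF f]])
       (auto intro!: AE_I2 simp: abs_divide divide_le_eq_1 field_simps add_pos_nonneg mult_nonneg_nonneg)
  then show ?thesis by (simp add: weighted_L1_def)
qed

lemma weighted_L1_times_Cc:
  assumes v: "v \<in> weighted_L1 p" and f: "f \<in> Cc \<Omega>" and p: "0 < p"
  shows "integrable lborel (\<lambda>x. v x * f x)"
proof -
  have [measurable]: "f \<in> borel_measurable borel" "v \<in> borel_measurable borel"
    using Cc_measurable[OF f] v by (auto simp: weighted_L1_def)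
  from f obtain K where K: "compact K" "\<And>x. x \<notin> K \<Longrightarrow> f x = 0" by (rule CcE) blast
  obtain D where D: "\<And>x. x \<in> K \<Longrightarrow> norm x \<le> D" using compact_imp_bounded[OF K(1)] by (auto simp: bounded_iff)
  obtain B where B: "B > 0" "\<And>x. \<bar>f x\<bar> \<le> B" using Cc_bounded[OF f] by blast
  have int: "integrable lborel (\<lambda>x. (B * (1 + D powr p)) * (v x / (1 + norm x powr p)))"
    using v by (intro integrable_mult_right) (simp add: weighted_L1_def)
  show ?thesis
  proof (rule Bochner_Integration.integrable_bound[OF int])
    have "\<bar>v x * f x\<bar> \<le> \<bar>(B * (1 + D powr p)) * (v x / (1 + norm x powr p))\<bar>" for x
    proof (cases "x \<in> K")
      case True
      have pos: "1 + norm x powr p > 0" by (simp add: add_pos_nonneg)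
      have "1 + norm x powr p \<le> 1 + D powr p"
        using D[OF True] p by (intro add_left_mono powr_mono2) auto
      then have "\<bar>f x\<bar> * (1 + norm x powr p) \<le> B * (1 + D powr p)"
        using B pos by (intro mult_mono) auto
      then have "\<bar>f x\<bar> \<le> B * (1 + D powr p) / (1 + norm x powr p)"
        using pos by (simp add: pos_le_divide_eq)
      then have "\<bar>v x\<bar> * \<bar>f x\<bar> \<le> \<bar>v x\<bar> * (B * (1 + D powr p) / (1 + norm x powr p))"
        by (rule mult_left_mono) simp
      also have "\<dots> = \<bar>(B * (1 + D powr p)) * (v x / (1 + norm x powr p))\<bar>"
        using B pos by (simp add: abs_mult abs_divide add_nonneg_nonneg)
      finally show ?thesis by (simp add: abs_mult)
    qed (simp add: K)
    then show "AE x in lborel. norm (v x * f x) \<le> norm ((B * (1 + D powr p)) * (v x / (1 + norm x powr p)))"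
      unfolding real_norm_def by blast
  qed measurable
qed

text \<open>The truncated fractional Laplacian without its normalising constant, in the increment h
  = z - x.\<close>

definition trunc :: "real \<Rightarrow> real set \<Rightarrow> ('a::euclidean_space \<Rightarrow> real) \<Rightarrow> 'a \<Rightarrow> real" where
  "trunc p S v x = (\<integral>h. (v x - v (x + h)) * ker p S h \<partial>lborel)"

lemma trunc_tail:
  fixes v :: "'a::euclidean_space \<Rightarrow> real"
  assumes v: "v \<in> weighted_L1 p" "\<And>x. 0 \<le> v x" and p: "real DIM('a) < p" and e: "\<epsilon> > 0"
  shows "integrable lborel (\<lambda>h. (v x - v (x + h)) * ker p {\<epsilon><..} h)"
    and "trunc p {\<epsilon><..} v x = v x * (\<integral>h. ker p {\<epsilon><..} (h::'a) \<partial>lborel) - (\<integral>h. v (x + h) * ker p {\<epsilon><..} h \<partial>lborel)"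
proof -
  have p0: "0 < p" using p by (smt (verit) of_nat_0_le_iff)
  have 1: "integrable lborel (\<lambda>h::'a. v x * ker p {\<epsilon><..} h)"
    by (intro integrable_mult_right ker_tail_integrable p e)
  have 2: "integrable lborel (\<lambda>h. v (x + h) * ker p {\<epsilon><..} h)"
    by (rule weighted_L1_tail(1)[OF v p0 e order_refl])
  show "integrable lborel (\<lambda>h. (v x - v (x + h)) * ker p {\<epsilon><..} h)"
    using Bochner_Integration.integrable_diff[OF 1 2] by (simp add: left_diff_distrib)
  show "trunc p {\<epsilon><..} v x = v x * (\<integral>h. ker p {\<epsilon><..} (h::'a) \<partial>lborel) - (\<integral>h. v (x + h) * ker p {\<epsilon><..} h \<partial>lborel)"
    unfolding trunc_def using Bochner_Integration.integral_diff[OF 1 2] by (simp add: left_diff_distrib)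
qed

lemma trunc_split:
  fixes v :: "'a::euclidean_space \<Rightarrow> real"
  assumes v: "v \<in> weighted_L1 p" "\<And>x. 0 \<le> v x" and p: "real DIM('a) < p" and e: "0 < a" "a \<le> b"
  shows "integrable lborel (\<lambda>h. (v x - v (x + h)) * ker p {a<..b} h)"
    and "trunc p {a<..} v x = trunc p {a<..b} v x + trunc p {b<..} v x"
proof -
  have b: "0 < b" using e by simp
  have eq: "(v x - v (x + h)) * ker p {a<..b} h = (v x - v (x + h)) * ker p {a<..} h - (v x - v (x + h)) * ker p {b<..} h" for h
    using ker_split[OF e(2), of p h] by (simp add: algebra_simps)
  show "integrable lborel (\<lambda>h. (v x - v (x + h)) * ker p {a<..b} h)"
    unfolding eq by (intro Bochner_Integration.integrable_diff trunc_tail(1) v p e b)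
  have "trunc p {a<..b} v x = trunc p {a<..} v x - trunc p {b<..} v x"
    unfolding trunc_def eq by (intro Bochner_Integration.integral_diff trunc_tail(1) v p e b)
  then show "trunc p {a<..} v x = trunc p {a<..b} v x + trunc p {b<..} v x" by simp
qed

text \<open>Symmetrising \<open>h \<mapsto> -h\<close> turns a one-sided bound on second differences into a bound
  that does not depend on the inner radius of truncation.\<close>

lemma near_symmetric:
  fixes \<phi> :: "'a::euclidean_space \<Rightarrow> real"
  assumes \<phi>: "integrable lborel (\<lambda>h. \<phi> h * ker p {a<..b} h)" "\<phi> \<in> borel_measurable borel"
    and a: "0 \<le> a" and M: "0 \<le> M" "\<And>h. \<phi> h + \<phi> (- h) \<le> M * (norm h)\<^sup>2"
    and I: "integrable lborel (\<lambda>h::'a. (norm h)\<^sup>2 * ker p {0<..b} h)"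
  shows "(\<integral>h. \<phi> h * ker p {a<..b} h \<partial>lborel) \<le> M / 2 * (\<integral>h. (norm (h::'a))\<^sup>2 * ker p {0<..b} h \<partial>lborel)"
proof -
  have [measurable]: "\<phi> \<in> borel_measurable borel" by fact
  note refl = integral_lborel_reflect[of "\<lambda>h. \<phi> h * ker p {a<..b} h", simplified ker_minus]
  have i2: "integrable lborel (\<lambda>h. \<phi> (- h) * ker p {a<..b} h)" using refl(2) \<phi>(1) by simp
  have "2 * (\<integral>h. \<phi> h * ker p {a<..b} h \<partial>lborel) = (\<integral>h. \<phi> h * ker p {a<..b} h + \<phi> (- h) * ker p {a<..b} h \<partial>lborel)"
    using refl(1) by (subst Bochner_Integration.integral_add[OF \<phi>(1) i2]) simp
  also have "\<dots> \<le> (\<integral>h. M * ((norm (h::'a))\<^sup>2 * ker p {0<..b} h) \<partial>lborel)"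
  proof (rule Bochner_Integration.integral_mono)
    fix h :: 'a
    have "\<phi> h * ker p {a<..b} h + \<phi> (- h) * ker p {a<..b} h \<le> M * (norm h)\<^sup>2 * ker p {a<..b} h"
      using mult_right_mono[OF M(2) ker_nonneg, of h p "{a<..b}" h] by (simp add: algebra_simps)
    also have "\<dots> \<le> M * (norm h)\<^sup>2 * ker p {0<..b} h"
      using a M by (intro mult_left_mono) (auto simp: ker_def indicator_def)
    finally show "\<phi> h * ker p {a<..b} h + \<phi> (- h) * ker p {a<..b} h \<le> M * ((norm h)\<^sup>2 * ker p {0<..b} h)"
      by simp
  qed (use \<phi>(1) i2 I in \<open>auto intro!: Bochner_Integration.integrable_add\<close>)
  also have "\<dots> = M * (\<integral>h. (norm (h::'a))\<^sup>2 * ker p {0<..b} h \<partial>lborel)" by (rule integral_mult_right_zero)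
  finally show ?thesis by simp
qed

text \<open>For continuous \<open>\<zeta>\<close> this says that \<zeta>(x) + (M/2) |x|^2 is convex.
  The form by second differences is the one that \<open>near_symmetric\<close> takes.\<close>

definition semiconvex :: "('a::euclidean_space \<Rightarrow> real) \<Rightarrow> bool" where
  "semiconvex \<zeta> \<longleftrightarrow> (\<exists>M\<ge>0. \<forall>x h. 2 * \<zeta> x - \<zeta> (x + h) - \<zeta> (x - h) \<le> M * (norm h)\<^sup>2)"

text \<open>At a zero of \<open>\<zeta>\<close> the truncated operator is nonpositive. At any other point of the support
  the contribution of \<open>|h| > \<rho>\<close> to \<open>\<integral>\<zeta>(x+h)|h|\<^sup>-\<^sup>p\<close> is bounded away from zero and absorbs the
  contribution of \<open>|h| \<le> \<rho>\<close>, which vanishes with \<open>\<rho>\<close>.\<close>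

lemma trunc_le_multiple:
  fixes \<zeta> :: "'a::euclidean_space \<Rightarrow> real"
  assumes p: "real DIM('a) < p" "p < real DIM('a) + 2"
    and \<zeta>: "\<zeta> \<in> Cc UNIV" "\<And>x. 0 \<le> \<zeta> x" "semiconvex \<zeta>"
  obtains C \<rho> where "0 \<le> C" "0 < \<rho>"
    "\<And>\<epsilon> x. 0 < \<epsilon> \<Longrightarrow> \<epsilon> < \<rho> \<Longrightarrow> trunc p {\<epsilon><..} \<zeta> x \<le> C * \<zeta> x"
proof (cases "\<exists>x. \<zeta> x > 0")
  case False
  then have "\<zeta> x = 0" for x using \<zeta>(2)[of x] by (metis less_eq_real_def)
  then have "trunc p {\<epsilon><..} \<zeta> x \<le> 0 * \<zeta> x" for \<epsilon> x by (simp add: trunc_def)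
  then show ?thesis by (rule that[of 0 1, rotated 2]) auto
next
  case True
  then obtain x0 where x0: "\<zeta> x0 > 0" by blast
  have p0: "0 < p" using p by (smt (verit) of_nat_0_le_iff)
  have [measurable]: "\<zeta> \<in> borel_measurable borel" by (rule Cc_measurable[OF \<zeta>(1)])
  note \<zeta>w = Cc_weighted_L1[OF \<zeta>(1), of p]
  from \<zeta>(1) obtain K where K: "compact K" "\<And>x. x \<notin> K \<Longrightarrow> \<zeta> x = 0" by (rule CcE) blast
  obtain D where D: "D > 0" "\<And>x. x \<in> K \<Longrightarrow> norm x \<le> D"
    using compact_imp_bounded[OF K(1)] by (auto simp: bounded_pos)
  obtain B where B: "B > 0" "\<And>x. \<bar>\<zeta> x\<bar> \<le> B" using Cc_bounded[OF \<zeta>(1)] by blast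
  obtain M where M: "M \<ge> 0" "\<And>x h. 2 * \<zeta> x - \<zeta> (x + h) - \<zeta> (x - h) \<le> M * (norm h)\<^sup>2"
    using \<zeta>(3) by (auto simp: semiconvex_def)
  obtain C1 where C1: "C1 \<ge> 0"
    "\<And>\<rho>. \<rho> > 0 \<Longrightarrow> integrable lborel (\<lambda>h::'a. (norm h)\<^sup>2 * ker p {0<..\<rho>} h)"
    "\<And>\<rho>. \<rho> > 0 \<Longrightarrow> (\<integral>h. (norm (h::'a))\<^sup>2 * ker p {0<..\<rho>} h \<partial>lborel) \<le> C1 * \<rho> powr (real DIM('a) + 2 - p)"
    using ker_near_integrable[OF p(2)] by blast
  define V where "V = unit_ball_vol (real DIM('a))"
  define Z where "Z = (\<integral>x. \<zeta> x \<partial>lborel)"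
  \<comment> \<open>Two points of \<open>K\<close> are at distance at most \<open>2 * D\<close>, so
    \<open>m\<close> is a lower bound of the kernel between distinct ones.\<close>
  define m where "m = (2 * D) powr (- p)"
  have m: "m > 0" using D by (simp add: m_def)
  have Z: "Z > 0"
  proof -
    have "\<forall>\<^sub>F x in at x0. \<zeta> x > \<zeta> x0 / 2"
      using Cc_continuous[OF \<zeta>(1)] x0 by (intro order_tendstoD) (auto simp: continuous_on_def)
    then obtain r where r: "r > 0" "\<And>x. x \<noteq> x0 \<Longrightarrow> dist x x0 < r \<Longrightarrow> \<zeta> x > \<zeta> x0 / 2"
      by (auto simp: eventually_at)
    have "0 < \<zeta> x0 / 2 * measure lborel (ball x0 r)"
      using x0 r by (simp add: content_ball_pos)
    also have "\<dots> = (\<integral>x. \<zeta> x0 / 2 * indicator (ball x0 r) x \<partial>lborel)"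
      by simp
    also have "\<dots> \<le> Z"
      unfolding Z_def
    proof (rule Bochner_Integration.integral_mono)
      show "integrable lborel (\<lambda>x. \<zeta> x0 / 2 * indicator (ball x0 r) x)"
        using emeasure_bounded_finite[OF bounded_ball, of x0 r]
        by (intro integrable_mult_right integrable_real_indicator) auto
      fix x show "\<zeta> x0 / 2 * indicator (ball x0 r) x \<le> \<zeta> x"
        using r(2)[of x] x0 \<zeta>(2)[of x] by (cases "x = x0") (auto simp: indicator_def dist_commute less_imp_le)
    qed (rule Cc_integrable[OF \<zeta>(1)])
    finally show ?thesis .
  qed
  \<comment> \<open>The first term bounds the near part of the operator; the second bounds what the
    lower bound \<open>m * Z\<close> loses when the ball |h| \<le> \<rho> is removed. Both vanish
    with \<open>\<rho>\<close>, whereas \<open>m * Z\<close> is a fixed positive number, and this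
    determines \<open>\<rho>\<close>.\<close>
  have lim: "((\<lambda>\<rho>. M / 2 * (C1 * \<rho> powr (real DIM('a) + 2 - p)) + m * (B * (V * \<rho> ^ DIM('a)))) \<longlongrightarrow> 0) (at_right 0)"
  proof -
    have 1: "((\<lambda>\<rho>. \<rho> powr (real DIM('a) + 2 - p)) \<longlongrightarrow> 0) (at_right 0)"
      using p(2) by (intro tendsto_zero_powrI) (auto intro!: tendsto_eq_intros eventually_mono[OF eventually_at_right_less])
    have 2: "((\<lambda>\<rho>::real. \<rho> ^ DIM('a)) \<longlongrightarrow> 0) (at_right 0)"
      by (auto intro!: tendsto_eq_intros simp: zero_power)
    show ?thesis
      by (rule tendsto_eq_rhs[OF tendsto_add[OF tendsto_mult_left[OF tendsto_mult_left[OF 1]]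
              tendsto_mult_left[OF tendsto_mult_left[OF tendsto_mult_left[OF 2]]]]]) simp
  qed
  have "\<forall>\<^sub>F \<rho> in at_right 0. M / 2 * (C1 * \<rho> powr (real DIM('a) + 2 - p)) + m * (B * (V * \<rho> ^ DIM('a))) < m * Z"
    using order_tendstoD(2)[OF lim] m Z by simp
  then have "\<forall>\<^sub>F \<rho> in at_right (0::real). 0 < \<rho> \<and> M / 2 * (C1 * \<rho> powr (real DIM('a) + 2 - p)) + m * (B * (V * \<rho> ^ DIM('a))) < m * Z"
    using eventually_at_right_less[of "0::real"] by eventually_elim auto
  then obtain \<rho> where \<rho>: "0 < \<rho>" and small: "M / 2 * (C1 * \<rho> powr (real DIM('a) + 2 - p)) + m * (B * (V * \<rho> ^ DIM('a))) < m * Z"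
    using eventually_happens[of _ "at_right (0::real)"] by auto
  \<comment> \<open>With \<open>C\<close> the total mass of the kernel beyond \<open>\<rho>\<close>,
    the term \<open>C * \<zeta> x\<close> is exactly the positive part of the far operator.\<close>
  define C where "C = (\<integral>h. ker p {\<rho><..} (h::'a) \<partial>lborel)"
  have C0: "0 \<le> C" unfolding C_def by (simp add: ker_nonneg)
  have "trunc p {\<epsilon><..} \<zeta> x \<le> C * \<zeta> x" if \<epsilon>: "0 < \<epsilon>" "\<epsilon> < \<rho>" for \<epsilon> x
  proof (cases "\<zeta> x > 0")
    case False
    then have "\<zeta> x = 0" using \<zeta>(2)[of x] by (metis less_eq_real_def)
    moreover have "0 \<le> (\<integral>h. \<zeta> (x + h) * ker p {\<epsilon><..} h \<partial>lborel)"
      using \<zeta>(2) by (intro Bochner_Integration.integral_nonneg) (auto simp: ker_nonneg)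
    ultimately show ?thesis by (simp add: trunc_tail(2)[OF \<zeta>w \<zeta>(2) p(1) \<epsilon>(1)])
  next
    case True
    then have xK: "x \<in> K" using K(2) by force
    have "trunc p {\<epsilon><..\<rho>} \<zeta> x \<le> M / 2 * (\<integral>h. (norm (h::'a))\<^sup>2 * ker p {0<..\<rho>} h \<partial>lborel)"
      unfolding trunc_def
    proof (rule near_symmetric)
      show "\<zeta> x - \<zeta> (x + h) + (\<zeta> x - \<zeta> (x + - h)) \<le> M * (norm h)\<^sup>2" for h
        using M(2)[of x h] by simp
    qed (use \<epsilon> M C1 \<rho> trunc_split(1)[OF \<zeta>w \<zeta>(2) p(1) \<epsilon>(1), of \<rho>] in auto)
    also have "\<dots> \<le> M / 2 * (C1 * \<rho> powr (real DIM('a) + 2 - p))"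
      using M C1(3)[OF \<rho>] by (intro mult_left_mono) auto
    finally have near: "trunc p {\<epsilon><..\<rho>} \<zeta> x \<le> M / 2 * (C1 * \<rho> powr (real DIM('a) + 2 - p))" .
    have i1: "integrable lborel (\<lambda>h. \<zeta> (x + h))"
      using Cc_integrable[OF \<zeta>(1)] integral_lborel_translate(2)[of \<zeta> x] by simp
    have i2: "integrable lborel (\<lambda>h::'a. B * indicator (cball 0 \<rho>) h)"
      using emeasure_bounded_finite[OF bounded_cball, of "0::'a" \<rho>]
      by (intro integrable_mult_right integrable_real_indicator) auto
    \<comment> \<open>Removing the ball of radius \<open>\<rho>\<close> from the mass
      \<open>Z\<close> of \<open>\<zeta>\<close> costs at most \<open>B\<close> times its volume;
      what remains is seen through a kernel of at least \<open>m\<close>.\<close>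
    have "m * (Z - B * (V * \<rho> ^ DIM('a))) = (\<integral>h. m * (\<zeta> (x + h) - B * indicator (cball 0 \<rho>) h) \<partial>lborel)"
      using i1 i2 integral_lborel_translate(1)[of \<zeta> x] \<rho>
      by (simp add: Z_def V_def content_cball)
    also have "\<dots> \<le> (\<integral>h. \<zeta> (x + h) * ker p {\<rho><..} h \<partial>lborel)"
    proof (rule Bochner_Integration.integral_mono)
      show "integrable lborel (\<lambda>h. m * (\<zeta> (x + h) - B * indicator (cball 0 \<rho>) h))"
        by (intro integrable_mult_right Bochner_Integration.integrable_diff i1 i2)
      show "integrable lborel (\<lambda>h. \<zeta> (x + h) * ker p {\<rho><..} h)"
        by (rule weighted_L1_tail(1)[OF \<zeta>w \<zeta>(2) p0 \<rho> order_refl])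
      fix h
      show "m * (\<zeta> (x + h) - B * indicator (cball 0 \<rho>) h) \<le> \<zeta> (x + h) * ker p {\<rho><..} h"
      proof (cases "norm h \<le> \<rho>")
        case True
        have "\<zeta> (x + h) - B \<le> 0" using B(2)[of "x + h"] by linarith
        then show ?thesis using True m by (simp add: ker_def mult_nonneg_nonpos)
      next
        case False
        show ?thesis
        proof (cases "x + h \<in> K")
          case True
          have "norm h \<le> norm (x + h) + norm x" using norm_triangle_ineq4[of "x + h" x] by simp
          then have "norm h \<le> 2 * D" using D(2)[OF True] D(2)[OF xK] by simp
          then have "m \<le> norm h powr (- p)"
            unfolding m_def using False \<rho> p0 by (intro powr_mono2') auto
          then have "\<zeta> (x + h) * m \<le> \<zeta> (x + h) * norm h powr (- p)" by (intro mult_left_mono \<zeta>(2))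
          then show ?thesis using False by (simp add: ker_def mult.commute)
        qed (use K False in \<open>simp add: ker_def\<close>)
      qed
    qed
    finally have far: "m * (Z - B * (V * \<rho> ^ DIM('a))) \<le> (\<integral>h. \<zeta> (x + h) * ker p {\<rho><..} h \<partial>lborel)" .
    have "trunc p {\<epsilon><..} \<zeta> x = trunc p {\<epsilon><..\<rho>} \<zeta> x + trunc p {\<rho><..} \<zeta> x"
      using \<epsilon> by (intro trunc_split(2) \<zeta>w \<zeta>(2) p) auto
    also have "trunc p {\<rho><..} \<zeta> x = C * \<zeta> x - (\<integral>h. \<zeta> (x + h) * ker p {\<rho><..} h \<partial>lborel)"
      by (simp add: trunc_tail(2)[OF \<zeta>w \<zeta>(2) p(1) \<rho>] C_def mult.commute)
    finally show ?thesis using near far small by (simp add: right_diff_distrib)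
  qed
  with C0 \<rho> show ?thesis by (rule that)
qed

lemma tail_measurable:
  fixes w :: "'a::euclidean_space \<Rightarrow> real"
  assumes [measurable]: "w \<in> borel_measurable borel"
  shows "(\<lambda>x. \<integral>h. w (x + h) * ker p {\<epsilon><..} h \<partial>lborel) \<in> borel_measurable borel"
proof -
  have "(\<lambda>x. \<integral>h. w (x + h) * ker p {\<epsilon><..} h \<partial>lborel) \<in> borel_measurable lborel"
    by (rule lborel.borel_measurable_lebesgue_integral) measurable
  then show ?thesis by simp
qed

text \<open>As a double integral in x and z the expression is symmetric under exchange of
  \<open>a\<close> and \<open>b\<close>, by Tonelli and the evenness of the kernel.\<close>

lemma tail_form:
  fixes a b :: "'a::euclidean_space \<Rightarrow> real"
  assumes a: "a \<in> borel_measurable borel" "\<And>x. 0 \<le> a x"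
    and b: "b \<in> weighted_L1 p" "\<And>x. 0 \<le> b x" and p: "0 < p" and e: "0 < \<epsilon>"
  shows "(\<integral>\<^sup>+x. ennreal (a x * (\<integral>h. b (x + h) * ker p {\<epsilon><..} h \<partial>lborel)) \<partial>lborel)
    = (\<integral>\<^sup>+x. \<integral>\<^sup>+z. ennreal (a x * b z * ker p {\<epsilon><..} (z - x)) \<partial>lborel \<partial>lborel)"
proof (rule nn_integral_cong)
  fix x
  have [measurable]: "b \<in> borel_measurable borel" using b by (simp add: weighted_L1_def)
  have i: "integrable lborel (\<lambda>h. a x * (b (x + h) * ker p {\<epsilon><..} h))"
    by (intro integrable_mult_right weighted_L1_tail(1)[OF b p e order_refl])
  have "ennreal (a x * (\<integral>h. b (x + h) * ker p {\<epsilon><..} h \<partial>lborel)) = ennreal (\<integral>h. a x * (b (x + h) * ker p {\<epsilon><..} h) \<partial>lborel)"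
    by (subst integral_mult_right_zero) simp
  also have "\<dots> = (\<integral>\<^sup>+h. ennreal (a x * (b (x + h) * ker p {\<epsilon><..} h)) \<partial>lborel)"
    using a(2) b(2) by (intro nn_integral_eq_integral[symmetric] i) (auto simp: ker_nonneg)
  also have "\<dots> = (\<integral>\<^sup>+z. ennreal (a x * b z * ker p {\<epsilon><..} (z - x)) \<partial>lborel)"
    using integral_lborel_translate(3)[of "\<lambda>z. a x * b z * ker p {\<epsilon><..} (z - x)" x]
    by (simp add: mult.assoc)
  finally show "ennreal (a x * (\<integral>h. b (x + h) * ker p {\<epsilon><..} h \<partial>lborel)) = (\<integral>\<^sup>+z. ennreal (a x * b z * ker p {\<epsilon><..} (z - x)) \<partial>lborel)" .
qed

text \<open>The truncated operator is a multiple \<open>\<kappa>\<close> of the identity minus a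
  convolution with an even kernel, hence symmetric, and the pointwise bound for
  \<open>\<zeta>\<close> can be integrated against \<open>w\<close>. The exchange takes place in
  \<open>ennreal\<close>, so integrability has to be shown directly only for
  \<open>\<zeta> * A w\<close>, where the compact support of \<open>\<zeta>\<close> helps.\<close>

lemma trunc_dual_le:
  fixes \<zeta> w :: "'a::euclidean_space \<Rightarrow> real"
  assumes p: "real DIM('a) < p" and \<zeta>: "\<zeta> \<in> Cc UNIV" "\<And>x. 0 \<le> \<zeta> x"
    and w: "w \<in> weighted_L1 p" "\<And>x. 0 \<le> w x" and e: "0 < \<epsilon>"
    and C: "0 \<le> C" "\<And>x. trunc p {\<epsilon><..} \<zeta> x \<le> C * \<zeta> x"
  shows "integrable lborel (\<lambda>x. \<zeta> x * trunc p {\<epsilon><..} w x)"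
    and "(\<integral>x. \<zeta> x * trunc p {\<epsilon><..} w x \<partial>lborel) \<le> C * (\<integral>x. w x * \<zeta> x \<partial>lborel)"
proof -
  have p0: "0 < p" using p by (smt (verit) of_nat_0_le_iff)
  have [measurable]: "\<zeta> \<in> borel_measurable borel" "w \<in> borel_measurable borel"
    using Cc_measurable[OF \<zeta>(1)] w by (auto simp: weighted_L1_def)
  define \<kappa> where "\<kappa> = (\<integral>h. ker p {\<epsilon><..} (h::'a) \<partial>lborel)"
  have \<kappa>0: "0 \<le> \<kappa>" unfolding \<kappa>_def by (simp add: ker_nonneg)
  define A where "A v x = (\<integral>h. v (x + h) * ker p {\<epsilon><..} h \<partial>lborel)" for v :: "'a \<Rightarrow> real" and x
  have Aw0: "0 \<le> A w x" and A\<zeta>0: "0 \<le> A \<zeta> x" for x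
    unfolding A_def using w(2) \<zeta>(2)
    by (auto simp: ker_nonneg intro!: Bochner_Integration.integral_nonneg)
  have Am [measurable]: "A w \<in> borel_measurable borel" "A \<zeta> \<in> borel_measurable borel"
    unfolding A_def by (rule tail_measurable; simp)+
  note tr = trunc_tail(2)[OF _ _ p e, folded \<kappa>_def A_def]
  have iw: "integrable lborel (\<lambda>x. w x * \<zeta> x)" by (rule weighted_L1_times_Cc[OF w(1) \<zeta>(1) p0])
  have iA: "integrable lborel (\<lambda>x. \<zeta> x * A w x)"
  proof -
    from \<zeta>(1) obtain K where K: "compact K" "\<And>x. x \<notin> K \<Longrightarrow> \<zeta> x = 0" by (rule CcE) blast
    obtain D where D: "\<And>x. x \<in> K \<Longrightarrow> norm x \<le> D" using compact_imp_bounded[OF K(1)] by (auto simp: bounded_iff)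
    define c where "c = (\<epsilon> powr (- p) + (D / \<epsilon> + 1) powr p) * (\<integral>x. w x / (1 + norm x powr p) \<partial>lborel)"
    have "\<zeta> x * A w x \<le> \<zeta> x * c" for x
    proof (cases "x \<in> K")
      case True
      then show ?thesis
        unfolding A_def c_def using D by (intro mult_left_mono weighted_L1_tail(2) w p0 e \<zeta>) auto
    qed (simp add: K)
    then have "norm (\<zeta> x * A w x) \<le> norm (\<zeta> x * c)" for x
      using Aw0[of x] \<zeta>(2)[of x] by (metis abs_ge_self abs_of_nonneg mult_nonneg_nonneg order_trans real_norm_def)
    then show ?thesis
      by (intro Bochner_Integration.integrable_bound[OF integrable_mult_left[OF Cc_integrable[OF \<zeta>(1)], of c]]) auto
  qed
  have eq: "\<zeta> x * trunc p {\<epsilon><..} w x = \<kappa> * (w x * \<zeta> x) - \<zeta> x * A w x" for x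
    by (simp add: tr[OF w] algebra_simps)
  show "integrable lborel (\<lambda>x. \<zeta> x * trunc p {\<epsilon><..} w x)"
    unfolding eq by (intro Bochner_Integration.integrable_diff integrable_mult_right iw iA)
  have swap: "(\<integral>\<^sup>+x. ennreal (\<zeta> x * A w x) \<partial>lborel) = (\<integral>\<^sup>+x. ennreal (w x * A \<zeta> x) \<partial>lborel)"
  proof -
    have "(\<integral>\<^sup>+x. ennreal (\<zeta> x * A w x) \<partial>lborel)
        = (\<integral>\<^sup>+x. \<integral>\<^sup>+z. ennreal (\<zeta> x * w z * ker p {\<epsilon><..} (z - x)) \<partial>lborel \<partial>lborel)"
      unfolding A_def by (rule tail_form) (use \<zeta> w p0 e in auto)
    also have "\<dots> = (\<integral>\<^sup>+z. \<integral>\<^sup>+x. ennreal (\<zeta> x * w z * ker p {\<epsilon><..} (z - x)) \<partial>lborel \<partial>lborel)"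
      by (rule lborel_pair.Fubini') measurable
    also have "\<dots> = (\<integral>\<^sup>+z. \<integral>\<^sup>+x. ennreal (w z * \<zeta> x * ker p {\<epsilon><..} (x - z)) \<partial>lborel \<partial>lborel)"
    proof (intro nn_integral_cong)
      fix x z :: 'a
      have "ker p {\<epsilon><..} (x - z) = ker p {\<epsilon><..} (z - x)"
        using ker_minus[of p "{\<epsilon><..}" "z - x"] by simp
      then show "ennreal (\<zeta> z * w x * ker p {\<epsilon><..} (x - z)) = ennreal (w x * \<zeta> z * ker p {\<epsilon><..} (z - x))"
        by (simp add: mult.commute)
    qed
    also have "\<dots> = (\<integral>\<^sup>+x. ennreal (w x * A \<zeta> x) \<partial>lborel)"
      unfolding A_def by (rule tail_form[symmetric]) (use \<zeta> w p0 e Cc_weighted_L1 in auto)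
    finally show ?thesis .
  qed
  have "ennreal (\<kappa> * (\<integral>x. w x * \<zeta> x \<partial>lborel)) = (\<integral>\<^sup>+x. ennreal (\<kappa> * (w x * \<zeta> x)) \<partial>lborel)"
    using w(2) \<zeta>(2) \<kappa>0 iw
    by (subst nn_integral_eq_integral) (auto intro!: integrable_mult_right)
  also have "\<dots> \<le> (\<integral>\<^sup>+x. ennreal (C * (w x * \<zeta> x)) + ennreal (w x * A \<zeta> x) \<partial>lborel)"
  proof (rule nn_integral_mono)
    fix x
    have "\<kappa> * \<zeta> x \<le> C * \<zeta> x + A \<zeta> x"
      using C(2)[of x] tr[OF Cc_weighted_L1[OF \<zeta>(1)] \<zeta>(2), of x] by (simp add: mult.commute)
    then have "w x * (\<kappa> * \<zeta> x) \<le> w x * (C * \<zeta> x + A \<zeta> x)" by (intro mult_left_mono w)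
    then have "ennreal (\<kappa> * (w x * \<zeta> x)) \<le> ennreal (C * (w x * \<zeta> x) + w x * A \<zeta> x)"
      by (intro ennreal_leI) (simp add: algebra_simps)
    then show "ennreal (\<kappa> * (w x * \<zeta> x)) \<le> ennreal (C * (w x * \<zeta> x)) + ennreal (w x * A \<zeta> x)"
      using C(1) w(2)[of x] \<zeta>(2)[of x] A\<zeta>0[of x] by (simp add: ennreal_plus)
  qed
  also have "\<dots> = (\<integral>\<^sup>+x. ennreal (C * (w x * \<zeta> x)) \<partial>lborel) + (\<integral>\<^sup>+x. ennreal (\<zeta> x * A w x) \<partial>lborel)"
    unfolding swap by (rule nn_integral_add) measurable
  also have "(\<integral>\<^sup>+x. ennreal (C * (w x * \<zeta> x)) \<partial>lborel) = ennreal (C * (\<integral>x. w x * \<zeta> x \<partial>lborel))"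
    using w(2) \<zeta>(2) C(1) iw
    by (subst nn_integral_eq_integral) (auto intro!: integrable_mult_right)
  also have "(\<integral>\<^sup>+x. ennreal (\<zeta> x * A w x) \<partial>lborel) = ennreal (\<integral>x. \<zeta> x * A w x \<partial>lborel)"
    using Aw0 \<zeta>(2) by (intro nn_integral_eq_integral iA) auto
  finally have "ennreal (\<kappa> * (\<integral>x. w x * \<zeta> x \<partial>lborel)) \<le> ennreal (C * (\<integral>x. w x * \<zeta> x \<partial>lborel) + (\<integral>x. \<zeta> x * A w x \<partial>lborel))"
    using Aw0 \<zeta>(2) C(1) w(2)
    by (subst ennreal_plus) (auto intro!: mult_nonneg_nonneg Bochner_Integration.integral_nonneg)
  then have "\<kappa> * (\<integral>x. w x * \<zeta> x \<partial>lborel) \<le> C * (\<integral>x. w x * \<zeta> x \<partial>lborel) + (\<integral>x. \<zeta> x * A w x \<partial>lborel)"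
    using Aw0 \<zeta>(2) C(1) w(2)
    by (subst (asm) ennreal_le_iff) (auto intro!: add_nonneg_nonneg mult_nonneg_nonneg Bochner_Integration.integral_nonneg)
  moreover have "(\<integral>x. \<zeta> x * trunc p {\<epsilon><..} w x \<partial>lborel) = \<kappa> * (\<integral>x. w x * \<zeta> x \<partial>lborel) - (\<integral>x. \<zeta> x * A w x \<partial>lborel)"
    unfolding eq
    by (subst Bochner_Integration.integral_diff[OF integrable_mult_right[OF iw] iA]) simp
  ultimately show "(\<integral>x. \<zeta> x * trunc p {\<epsilon><..} w x \<partial>lborel) \<le> C * (\<integral>x. w x * \<zeta> x \<partial>lborel)" by simp
qed

text \<open>The principal value is only known to exist pointwise, so it cannot be exchanged with the
  integral directly. The inf-convolution \<open>w\<close> of \<open>v\<close> is semiconcave, which bounds its truncated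
  operators from below, uniformly in \<open>\<epsilon>\<close>; and \<open>w(x + \<cdot>) - w(x) \<le> v(y + \<cdot>) - v(y)\<close> for a point
  \<open>y\<close> near \<open>x\<close> compares them with those of \<open>v\<close>. Dominated convergence then applies to \<open>w\<close>.\<close>

lemma integral_principal_value_le:
  fixes \<zeta> :: "'a::euclidean_space \<Rightarrow> real"
  assumes p: "real DIM('a) < p" "p < real DIM('a) + 2"
    and \<zeta>: "\<zeta> \<in> Cc UNIV" "\<And>x. 0 \<le> \<zeta> x" "semiconvex \<zeta>"
  obtains C where "0 \<le> C"
    "\<And>v G. continuous_on UNIV v \<Longrightarrow> (\<And>x. 0 \<le> v x) \<Longrightarrow> v \<in> weighted_L1 p \<Longrightarrow> continuous_on UNIV G \<Longrightarrow>
      (\<And>x. ((\<lambda>\<epsilon>. trunc p {\<epsilon><..} v x) \<longlongrightarrow> G x) (at_right 0)) \<Longrightarrow>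
      (\<integral>x. \<zeta> x * G x \<partial>lborel) \<le> C * (\<integral>x. v x * \<zeta> x \<partial>lborel)"
proof -
  have p0: "0 < p" using p by (smt (verit) of_nat_0_le_iff)
  obtain C \<rho> where C: "0 \<le> C" "0 < \<rho>"
    "\<And>\<epsilon> x. 0 < \<epsilon> \<Longrightarrow> \<epsilon> < \<rho> \<Longrightarrow> trunc p {\<epsilon><..} \<zeta> x \<le> C * \<zeta> x"
    using trunc_le_multiple[OF p \<zeta>] by blast
  from \<zeta>(1) obtain K where K: "compact K" "\<And>x. x \<notin> K \<Longrightarrow> \<zeta> x = 0" by (rule CcE) blast
  obtain D where D: "D > 0" "\<And>x. x \<in> K \<Longrightarrow> norm x \<le> D"
    using compact_imp_bounded[OF K(1)] by (auto simp: bounded_pos)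
  have [measurable]: "\<zeta> \<in> borel_measurable borel" by (rule Cc_measurable[OF \<zeta>(1)])
  have "(\<integral>x. \<zeta> x * G x \<partial>lborel) \<le> C * (\<integral>x. v x * \<zeta> x \<partial>lborel)"
    if v: "continuous_on UNIV v" "\<And>x. 0 \<le> v x" "v \<in> weighted_L1 p" and G: "continuous_on UNIV G"
      and lim: "\<And>x. ((\<lambda>\<epsilon>. trunc p {\<epsilon><..} v x) \<longlongrightarrow> G x) (at_right 0)" for v G
  proof -
    have [measurable]: "G \<in> borel_measurable borel" by (rule borel_measurable_continuous_onI[OF G])
    have \<zeta>G: "integrable lborel (\<lambda>x. \<zeta> x * G x)" by (rule Cc_integrable[OF Cc_mult[OF \<zeta>(1) G]])
    \<comment> \<open>The loss \<open>\<eta>\<close> pays for reading \<open>G\<close> at a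
      displaced point; it is removed at the end.\<close>
    have approx: "(\<integral>x. \<zeta> x * (G x - \<eta>) \<partial>lborel) \<le> C * (\<integral>x. v x * \<zeta> x \<partial>lborel)" if \<eta>: "\<eta> > 0" for \<eta>
    proof -
      have "bounded (v ` K)" "bounded (G ` K)"
        using K v(1) G by (auto intro!: compact_imp_bounded compact_continuous_image intro: continuous_on_subset)
      then obtain V BG where VB: "V > 0" "\<And>x. x \<in> K \<Longrightarrow> \<bar>v x\<bar> \<le> V" "BG > 0" "\<And>x. x \<in> K \<Longrightarrow> \<bar>G x\<bar> \<le> BG"
        unfolding bounded_pos by fastforce
      have "uniformly_continuous_on (cball 0 (D + 1)) G"
        by (intro compact_uniformly_continuous) (auto intro: continuous_on_subset[OF G])
      then obtain r0 where r0: "r0 > 0"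
        "\<And>x y. x \<in> cball 0 (D + 1) \<Longrightarrow> y \<in> cball 0 (D + 1) \<Longrightarrow> dist y x < r0 \<Longrightarrow> dist (G y) (G x) < \<eta>"
        unfolding uniformly_continuous_on_def using \<eta> by metis
      define r where "r = min r0 1 / 2"
      have r: "r > 0" "r < r0" "r < 1" using r0(1) by (auto simp: r_def)
      \<comment> \<open>Chosen so that the minimiser \<open>y\<close> belonging to any
        \<open>x\<close> in \<open>K\<close> satisfies |y - x|^2 \<le> 2 d v(x) \<le> r^2.\<close>
      define d where "d = r\<^sup>2 / (2 * V)"
      have dd: "d > 0" "2 * d * V = r\<^sup>2" using r VB by (auto simp: d_def)
      interpret inf_convolution d v using dd v by unfold_locales auto
      define w where "w = infc d v"
      have w0: "0 \<le> w x" and wv: "w x \<le> v x" for x by (simp_all add: w_def ge0 le_self)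
      have wm [measurable]: "w \<in> borel_measurable borel" unfolding w_def by (rule measurable_infc)
      have wL: "w \<in> weighted_L1 p"
        by (rule weighted_L1_mono[OF v(3) wm]) (use w0 wv in auto)
      \<comment> \<open>One point \<open>y\<close> serves all radii \<open>\<epsilon>\<close>. This
        lets \<open>\<epsilon>\<close> tend to 0 at \<open>y\<close>, where the principal value of
        \<open>v\<close> is known to exist.\<close>
      have cmp: "\<exists>y. (\<forall>\<epsilon>>0. trunc p {\<epsilon><..} v y \<le> trunc p {\<epsilon><..} w x) \<and> G x - \<eta> \<le> G y" if x: "x \<in> K" for x
      proof -
        obtain y where y: "(norm (y - x))\<^sup>2 \<le> 2 * d * v x" "\<And>h. w (x + h) - w x \<le> v (y + h) - v y"
          using translate[of x] unfolding w_def by metis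
        have "2 * d * v x \<le> 2 * d * V" using VB(2)[OF x] dd(1) by (intro mult_left_mono) auto
        then have "(norm (y - x))\<^sup>2 \<le> r\<^sup>2" using y(1) dd(2) by simp
        then have yx: "norm (y - x) \<le> r" using r(1) by (auto intro: power2_le_imp_le)
        have "norm y \<le> norm x + norm (y - x)" using norm_triangle_ineq[of x "y - x"] by simp
        then have "norm y \<le> D + 1" using D(2)[OF x] yx r by linarith
        then have "dist (G y) (G x) < \<eta>" using D(2)[OF x] yx r by (intro r0(2)) (auto simp: dist_norm)
        then have "G x - \<eta> \<le> G y" by (auto simp: dist_real_def)
        moreover have "trunc p {\<epsilon><..} v y \<le> trunc p {\<epsilon><..} w x" if "\<epsilon> > 0" for \<epsilon>
          unfolding trunc_def
        proof (rule Bochner_Integration.integral_mono)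
          fix h
          show "(v y - v (y + h)) * ker p {\<epsilon><..} h \<le> (w x - w (x + h)) * ker p {\<epsilon><..} h"
            using y(2)[of h] by (intro mult_right_mono ker_nonneg) auto
        qed (intro trunc_tail(1) v wL w0 p that)+
        ultimately show ?thesis by blast
      qed
      obtain C1 where I1: "integrable lborel (\<lambda>h::'a. (norm h)\<^sup>2 * ker p {0<..1} h)"
        using ker_near_integrable[OF p(2)] by (metis zero_less_one)
      define I where "I = (\<integral>h. (norm (h::'a))\<^sup>2 * ker p {0<..1} h \<partial>lborel)"
      define J where "J = (1 powr (- p) + (D / 1 + 1) powr p) * (\<integral>x. w x / (1 + norm x powr p) \<partial>lborel)"
      define B where "B = (1 / d) / 2 * I + J"
      \<comment> \<open>The annulus up to radius 1 is controlled by semiconcavity, the rest by the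
        weighted norm of \<open>w\<close>; neither bound involves \<open>\<epsilon>\<close>.\<close>
      have lower: "- B \<le> trunc p {\<epsilon><..} w x" if x: "x \<in> K" and \<epsilon>: "0 < \<epsilon>" "\<epsilon> \<le> 1" for x \<epsilon>
      proof -
        have "- trunc p {\<epsilon><..1} w x = (\<integral>h. (w (x + h) - w x) * ker p {\<epsilon><..1} h \<partial>lborel)"
          unfolding trunc_def
          by (subst Bochner_Integration.integral_minus[symmetric]) (simp add: left_diff_distrib)
        also have "\<dots> \<le> (1 / d) / 2 * I"
          unfolding I_def
        proof (rule near_symmetric)
          show "integrable lborel (\<lambda>h. (w (x + h) - w x) * ker p {\<epsilon><..1} h)"
            using Bochner_Integration.integrable_minus[OF trunc_split(1)[OF wL w0 p(1) \<epsilon>, of x]]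
            by (simp add: left_diff_distrib)
          show "w (x + h) - w x + (w (x + - h) - w x) \<le> 1 / d * (norm h)\<^sup>2" for h
            using semiconcave[of x h] by (simp add: w_def)
        qed (use \<epsilon> dd I1 in auto)
        finally have 1: "- trunc p {\<epsilon><..1} w x \<le> (1 / d) / 2 * I" .
        have "(\<integral>h. w (x + h) * ker p {1<..} h \<partial>lborel) \<le> J"
          unfolding J_def by (rule weighted_L1_tail(2)[OF wL w0 p0 zero_less_one D(2)[OF x]])
        moreover have "0 \<le> w x * (\<integral>h. ker p {1<..} (h::'a) \<partial>lborel)"
          using w0 by (intro mult_nonneg_nonneg Bochner_Integration.integral_nonneg) (auto simp: ker_nonneg)
        ultimately have 2: "- trunc p {1<..} w x \<le> J"
          using trunc_tail(2)[OF wL w0 p(1) zero_less_one, of x] by linarith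
        show ?thesis using trunc_split(2)[OF wL w0 p(1) \<epsilon>, of x] 1 2 by (simp add: B_def)
      qed
      \<comment> \<open>Dominated convergence needs a sequence of radii. Starting at
        \<open>Suc (Suc n)\<close> keeps them strictly below \<open>\<rho>\<close>.\<close>
      define e where "e n = min \<rho> 1 * inverse (real (Suc (Suc n)))" for n
      have e: "0 < e n" "e n < \<rho>" "e n \<le> 1" for n
      proof -
        have "min \<rho> 1 * inverse (real (Suc (Suc n))) < min \<rho> 1 * 1"
          using C(2) by (intro mult_strict_left_mono) (auto simp: inverse_less_1_iff)
        then show "0 < e n" "e n < \<rho>" "e n \<le> 1" using C(2) by (auto simp: e_def)
      qed
      have e_lim: "filterlim e (at_right 0) sequentially"
      proof (rule tendsto_imp_filterlim_at_right)
        show "e \<longlonglongrightarrow> 0" unfolding e_def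
          by (intro tendsto_mult_right_zero LIMSEQ_Suc[OF LIMSEQ_inverse_real_of_nat])
      qed (use e(1) in auto)
      define T where "T n x = trunc p {e n<..} w x" for n x
      \<comment> \<open>The values \<open>T n x\<close> are bounded below but need not be bounded
        above or converge. Capped at \<open>G x - \<eta>\<close> they do both, and lowering them is
        harmless for an upper bound on \<open>G\<close>.\<close>
      have T_lim: "(\<lambda>n. min (T n x) (G x - \<eta>)) \<longlonglongrightarrow> G x - \<eta>" if x: "x \<in> K" for x
      proof -
        obtain y where y: "\<And>\<epsilon>. \<epsilon> > 0 \<Longrightarrow> trunc p {\<epsilon><..} v y \<le> trunc p {\<epsilon><..} w x" "G x - \<eta> \<le> G y"
          using cmp[OF x] by blast
        have "(\<lambda>n. trunc p {e n<..} v y) \<longlonglongrightarrow> G y" by (rule filterlim_compose[OF lim e_lim])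
        then have "(\<lambda>n. min (trunc p {e n<..} v y) (G x - \<eta>)) \<longlonglongrightarrow> min (G y) (G x - \<eta>)"
          by (intro tendsto_min tendsto_const)
        then have l: "(\<lambda>n. min (trunc p {e n<..} v y) (G x - \<eta>)) \<longlonglongrightarrow> G x - \<eta>"
          using y(2) by (simp add: min_absorb2)
        show ?thesis
          by (rule tendsto_sandwich[OF _ _ l tendsto_const]) (use y(1) e(1) in \<open>auto simp: T_def min_le_iff_disj intro!: always_eventually\<close>)
      qed
      have Tm [measurable]: "T n \<in> borel_measurable borel" for n
        unfolding T_def using tail_measurable[OF wm, of p "e n"]
        by (subst trunc_tail(2)[OF wL w0 p(1) e(1), abs_def]) measurable
      have bd: "norm (\<zeta> x * min (T n x) (G x - \<eta>)) \<le> \<zeta> x * (\<bar>B\<bar> + BG + \<eta>)" for n x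
      proof (cases "x \<in> K")
        case True
        have "\<bar>min (T n x) (G x - \<eta>)\<bar> \<le> \<bar>B\<bar> + BG + \<eta>"
          using lower[OF True e(1,3)[of n]] VB(4)[OF True] VB(3) \<eta> by (auto simp: T_def min_def)
        then show ?thesis using mult_left_mono[OF _ \<zeta>(2)[of x]] \<zeta>(2)[of x] by (simp add: abs_mult)
      qed (simp add: K)
      have "(\<lambda>n. \<integral>x. \<zeta> x * min (T n x) (G x - \<eta>) \<partial>lborel) \<longlonglongrightarrow> (\<integral>x. \<zeta> x * (G x - \<eta>) \<partial>lborel)"
      proof (rule integral_dominated_convergence)
        show "integrable lborel (\<lambda>x. \<zeta> x * (\<bar>B\<bar> + BG + \<eta>))"
          by (intro integrable_mult_left Cc_integrable[OF \<zeta>(1)])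
        show "AE x in lborel. (\<lambda>n. \<zeta> x * min (T n x) (G x - \<eta>)) \<longlonglongrightarrow> \<zeta> x * (G x - \<eta>)"
        proof (rule AE_I2)
          fix x show "(\<lambda>n. \<zeta> x * min (T n x) (G x - \<eta>)) \<longlonglongrightarrow> \<zeta> x * (G x - \<eta>)"
            using tendsto_mult_left[OF T_lim] K(2) by (cases "x \<in> K") auto
        qed
        fix n
        show "AE x in lborel. norm (\<zeta> x * min (T n x) (G x - \<eta>)) \<le> \<zeta> x * (\<bar>B\<bar> + BG + \<eta>)"
          using bd by blast
      qed measurable
      moreover have "(\<integral>x. \<zeta> x * min (T n x) (G x - \<eta>) \<partial>lborel) \<le> C * (\<integral>x. v x * \<zeta> x \<partial>lborel)" for n
      proof -
        note dual = trunc_dual_le[OF p(1) \<zeta>(1,2) wL w0 e(1) C(1) C(3)[OF e(1,2)], of n, folded T_def]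
        have "(\<integral>x. \<zeta> x * min (T n x) (G x - \<eta>) \<partial>lborel) \<le> (\<integral>x. \<zeta> x * T n x \<partial>lborel)"
        proof (rule Bochner_Integration.integral_mono)
          show "integrable lborel (\<lambda>x. \<zeta> x * min (T n x) (G x - \<eta>))"
            by (rule Bochner_Integration.integrable_bound[OF integrable_mult_left[OF Cc_integrable[OF \<zeta>(1)], of "\<bar>B\<bar> + BG + \<eta>"]])
               (use bd in \<open>auto intro!: AE_I2 intro: order_trans[OF _ abs_ge_self]\<close>)
          show "\<zeta> x * min (T n x) (G x - \<eta>) \<le> \<zeta> x * T n x" for x
            by (intro mult_left_mono \<zeta>(2)) simp
        qed (rule dual)
        also have "\<dots> \<le> C * (\<integral>x. w x * \<zeta> x \<partial>lborel)" by (rule dual)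
        also have "\<dots> \<le> C * (\<integral>x. v x * \<zeta> x \<partial>lborel)"
          using wv \<zeta>(2) by (intro mult_left_mono[OF Bochner_Integration.integral_mono C(1)] weighted_L1_times_Cc[OF _ \<zeta>(1) p0] wL v(3))
             (auto intro!: mult_right_mono)
        finally show ?thesis .
      qed
      ultimately show ?thesis by (intro LIMSEQ_le_const2) auto
    qed
    show ?thesis
    proof (rule field_le_epsilon)
      fix \<epsilon> :: real assume \<epsilon>: "\<epsilon> > 0"
      define Z where "Z = (\<integral>x. \<zeta> x \<partial>lborel)"
      have Z: "Z \<ge> 0" unfolding Z_def using \<zeta>(2) by (intro Bochner_Integration.integral_nonneg) auto
      have \<eta>: "\<epsilon> / (Z + 1) > 0" using \<epsilon> Z by simp
      have "(\<integral>x. \<zeta> x * (G x - \<epsilon> / (Z + 1)) \<partial>lborel) = (\<integral>x. \<zeta> x * G x \<partial>lborel) - Z * (\<epsilon> / (Z + 1))"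
        unfolding right_diff_distrib Z_def[symmetric]
        by (subst Bochner_Integration.integral_diff[OF \<zeta>G integrable_mult_left[OF Cc_integrable[OF \<zeta>(1)]]])
           (simp add: Z_def)
      moreover have "Z * (\<epsilon> / (Z + 1)) \<le> \<epsilon>" using Z \<epsilon> by (simp add: field_simps)
      ultimately show "(\<integral>x. \<zeta> x * G x \<partial>lborel) \<le> C * (\<integral>x. v x * \<zeta> x \<partial>lborel) + \<epsilon>"
        using approx[OF \<eta>] by linarith
    qed
  qed
  with C(1) show ?thesis by (rule that)
qed

section \<open>Limits at the initial time\<close>

text \<open>Eventually any two values differ by at most \<open>2 * e\<close>, so the filter is
  Cauchy; nothing has to be known about how \<open>a\<close> varies with \<open>e\<close>.\<close>

lemma tendsto_of_approx:
  fixes X :: "'b \<Rightarrow> real"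
  assumes F: "F \<noteq> bot" and ap: "\<And>e. e > 0 \<Longrightarrow> \<exists>a. \<forall>\<^sub>F t in F. \<bar>X t - a\<bar> \<le> e"
  shows "\<exists>l. (X \<longlongrightarrow> l) F"
proof -
  have "cauchy_filter (filtermap X F)"
    unfolding cauchy_filter_metric_filtermap
  proof (intro allI impI)
    fix e :: real assume e: "e > 0"
    then have "e / 3 > 0" by simp
    from ap[OF this] obtain a where "\<forall>\<^sub>F t in F. \<bar>X t - a\<bar> \<le> e / 3" by blast
    moreover have "dist (X x) (X y) < e" if "\<bar>X x - a\<bar> \<le> e / 3" "\<bar>X y - a\<bar> \<le> e / 3" for x y
      unfolding dist_real_def using that e by linarith
    ultimately show "\<exists>P. eventually P F \<and> (\<forall>x y. P x \<and> P y \<longrightarrow> dist (X x) (X y) < e)"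
      by (intro exI[of _ "\<lambda>t. \<bar>X t - a\<bar> \<le> e / 3"]) blast
  qed
  then have "\<exists>c. filtermap X F \<le> nhds c"
    using F by (intro cauchy_filter_complete_converges[OF _ complete_UNIV]) (auto simp: filtermap_bot_iff)
  then show ?thesis by (simp add: filterlim_def)
qed

lemma increasing_tendsto_at_right:
  fixes g :: "real \<Rightarrow> real"
  assumes b: "0 < b" and mono: "\<And>x y. 0 < x \<Longrightarrow> x \<le> y \<Longrightarrow> y < b \<Longrightarrow> g x \<le> g y"
    and low: "\<And>x. 0 < x \<Longrightarrow> x < b \<Longrightarrow> c \<le> g x"
  shows "\<exists>l. (g \<longlongrightarrow> l) (at_right 0)"
proof -
  have bdd: "bdd_below (g ` {0<..<b})" using low by (intro bdd_belowI2[of _ c]) auto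
  have ne: "{0<..<b} \<noteq> {}" using b by simp
  have ev: "\<forall>\<^sub>F x in at_right 0. x \<in> {0<..<y}" if "0 < y" for y :: real
    using that by (rule eventually_at_right_real)
  have "(g \<longlongrightarrow> (INF x\<in>{0<..<b}. g x)) (at_right 0)"
  proof (rule decreasing_tendsto)
    show "\<forall>\<^sub>F x in at_right 0. (INF x\<in>{0<..<b}. g x) \<le> g x"
      using ev[OF b] by eventually_elim (rule cINF_lower[OF bdd])
    fix z assume "(INF x\<in>{0<..<b}. g x) < z"
    then obtain y where y: "y \<in> {0<..<b}" "g y < z"
      using cINF_less_iff[OF ne bdd] by auto
    then have "0 < y" by simp
    from ev[OF this] show "\<forall>\<^sub>F x in at_right 0. g x < z"
    proof eventually_elim
      case (elim x)
      then have "g x \<le> g y" using y by (intro mono) auto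
      then show ?case using y by simp
    qed
  qed
  then show ?thesis by blast
qed

text \<open>By the differential inequality, \<open>e\<^sup>C\<^sup>t X(t) - e\<^sup>C \<integral>\<^sub>t F\<close> is nondecreasing.\<close>

lemma tendsto_of_differential_inequality:
  fixes X X' F :: "real \<Rightarrow> real"
  assumes X: "\<And>t. 0 < t \<Longrightarrow> (X has_real_derivative X' t) (at t)" "\<And>t. 0 < t \<Longrightarrow> 0 \<le> X t"
    and C: "0 \<le> C" "\<And>t. 0 < t \<Longrightarrow> - C * X t - F t \<le> X' t"
    and F: "continuous_on {0<..} F" "\<And>t. 0 < t \<Longrightarrow> 0 \<le> F t"
    and B: "\<And>t. 0 < t \<Longrightarrow> t < 1/2 \<Longrightarrow> integral {t..1/2} F \<le> B"
  shows "\<exists>l. (X \<longlongrightarrow> l) (at_right 0)"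
proof -
  \<comment> \<open>The end point 1/2 keeps the interval inside the time window (0,1) of
    \<open>regular_set\<close>, and below 1, so that \<open>exp C\<close> bounds the integrating
    factor.\<close>
  define J where "J t = integral {t..1/2} F" for t
  have Fint: "F integrable_on {a..b}" if "0 < a" for a b
    by (intro integrable_continuous_interval continuous_on_subset[OF F(1)]) (use that in auto)
  have J0: "0 \<le> J t" if "0 < t" for t
    unfolding J_def using that F(2) by (intro Henstock_Kurzweil_Integration.integral_nonneg Fint) auto
  have Jdiff: "J x - J y = integral {x..y} F" if "0 < x" "x \<le> y" "y < 1/2" for x y
    using Henstock_Kurzweil_Integration.integral_combine[of x y "1/2" F] Fint[of x "1/2"] that
    by (simp add: J_def)
  have "\<exists>l. ((\<lambda>t. - J t) \<longlongrightarrow> l) (at_right 0)"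
  proof (rule increasing_tendsto_at_right[of "1/2" _ "- B"])
    fix x y :: real assume xy: "0 < x" "x \<le> y" "y < 1/2"
    then have "0 \<le> integral {x..y} F"
      using F(2) by (intro Henstock_Kurzweil_Integration.integral_nonneg Fint) auto
    then show "- J x \<le> - J y" using Jdiff[OF xy] by simp
  qed (use B in \<open>auto simp: J_def\<close>)
  then obtain lJ where lJ: "((\<lambda>t. - J t) \<longlongrightarrow> lJ) (at_right 0)" by blast
  have "\<exists>l. ((\<lambda>t. exp (C * t) * X t - exp C * J t) \<longlongrightarrow> l) (at_right 0)"
  proof (rule increasing_tendsto_at_right[of "1/2" _ "- exp C * B"])
    fix x y :: real assume xy: "0 < x" "x \<le> y" "y < 1/2"
    have ftc: "((\<lambda>t. exp (C * t) * (C * X t + X' t)) has_integral (exp (C * y) * X y - exp (C * x) * X x)) {x..y}"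
    proof (rule fundamental_theorem_of_calculus[OF xy(2)])
      fix t assume "t \<in> {x..y}"
      then have t: "0 < t" using xy by auto
      have "((\<lambda>t. exp (C * t) * X t) has_real_derivative exp (C * t) * (C * X t + X' t)) (at t)"
        using X(1)[OF t] by (auto intro!: derivative_eq_intros simp: algebra_simps)
      then show "((\<lambda>t. exp (C * t) * X t) has_vector_derivative exp (C * t) * (C * X t + X' t)) (at t within {x..y})"
        using has_real_derivative_iff_has_vector_derivative has_vector_derivative_at_within by blast
    qed
    have "integral {x..y} (\<lambda>t. - exp C * F t) \<le> integral {x..y} (\<lambda>t. exp (C * t) * (C * X t + X' t))"
    proof (rule integral_le)
      show "(\<lambda>t. - exp C * F t) integrable_on {x..y}"
        using integrable_cmul[OF Fint[OF xy(1), of y], of "- exp C"] by simp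
      show "(\<lambda>t. exp (C * t) * (C * X t + X' t)) integrable_on {x..y}" using ftc by blast
      fix t assume "t \<in> {x..y}"
      then have t: "0 < t" "t \<le> 1" using xy by auto
      have "exp (C * t) * F t \<le> exp C * F t"
        using F(2)[OF t(1)] mult_left_mono[OF t(2) C(1)] by (intro mult_right_mono) auto
      moreover have "exp (C * t) * (- F t) \<le> exp (C * t) * (C * X t + X' t)"
        using C(2)[OF t(1)] by (intro mult_left_mono) auto
      ultimately show "- exp C * F t \<le> exp (C * t) * (C * X t + X' t)" by simp
    qed
    also have "\<dots> = exp (C * y) * X y - exp (C * x) * X x" by (rule integral_unique[OF ftc])
    finally have "- exp C * integral {x..y} F \<le> exp (C * y) * X y - exp (C * x) * X x"
      by simp
    then show "exp (C * x) * X x - exp C * J x \<le> exp (C * y) * X y - exp C * J y"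
      using Jdiff[OF xy] by (simp add: algebra_simps)
  next
    fix x :: real assume x: "0 < x" "x < 1/2"
    have "exp C * J x \<le> exp C * B" using B[OF x] by (intro mult_left_mono) (auto simp: J_def)
    moreover have "0 \<le> exp (C * x) * X x" using X(2)[OF x(1)] by simp
    ultimately show "- exp C * B \<le> exp (C * x) * X x - exp C * J x" by linarith
  qed simp
  then obtain lY where lY: "((\<lambda>t. exp (C * t) * X t - exp C * J t) \<longlongrightarrow> lY) (at_right 0)" by blast
  \<comment> \<open>\<open>X\<close> is recovered from the two monotone quantities by undoing the
    integrating factor.\<close>
  have "((\<lambda>t. exp (- (C * t)) * ((exp (C * t) * X t - exp C * J t) - exp C * (- J t))) \<longlongrightarrow> exp (- (C * 0)) * (lY - exp C * lJ)) (at_right 0)"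
    by (intro tendsto_intros lY lJ)
  moreover have "exp (- (C * t)) * ((exp (C * t) * X t - exp C * J t) - exp C * (- J t)) = X t" for t
    by (simp add: mult.assoc[symmetric] exp_minus_inverse mult.commute[of "exp (- (C * t))"])
  ultimately show ?thesis by (auto simp only:)
qed

section \<open>Approximation by semiconvex functions\<close>

text \<open>The sup-convolution of \<open>g\<close> is \<open>B\<close> minus the Moreau envelope of
  the nonnegative function \<open>B - g\<close>, so semiconcavity of the envelope becomes
  semiconvexity. Its support grows by at most the distance to a maximiser. The compact set
  \<open>K\<close> is chosen before \<open>\<eta>\<close>, so that a single cut-off can later
  dominate all the errors.\<close>

lemma Cc_semiconvex_approx:
  assumes g: "g \<in> Cc \<Omega>" "\<And>x. 0 \<le> g x" and \<Omega>: "open \<Omega>"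
  obtains K where "compact K" "K \<subseteq> \<Omega>"
    "\<forall>\<eta>>0. \<exists>z \<in> Cc \<Omega>. (\<forall>x. 0 \<le> z x) \<and> semiconvex z \<and> (\<forall>x. g x \<le> z x \<and> z x \<le> g x + \<eta>) \<and> (\<forall>x. x \<notin> K \<longrightarrow> z x = 0)"
proof -
  from g(1) obtain L where L: "continuous_on UNIV g" "compact L" "L \<subseteq> \<Omega>" "\<And>x. x \<notin> L \<Longrightarrow> g x = 0"
    by (rule CcE) blast
  obtain B where B: "B > 0" "\<And>x. \<bar>g x\<bar> \<le> B" using Cc_bounded[OF g(1)] by blast
  obtain e where e: "e > 0" "(\<Union>x\<in>L. cball x e) \<subseteq> \<Omega>"
    using compact_subset_open_imp_cball_epsilon_subset[OF L(2) \<Omega> L(3)] by blast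
  define K where "K = (\<Union>x\<in>L. cball x e)"
  have cK: "compact K"
  proof -
    have "K = {x + y |x y. x \<in> L \<and> y \<in> cball 0 e}"
    proof safe
      fix x assume "x \<in> K"
      then obtain y where "y \<in> L" "dist y x \<le> e" by (auto simp: K_def)
      then show "\<exists>y z. x = y + z \<and> y \<in> L \<and> z \<in> cball 0 e"
        by (intro exI[of _ y] exI[of _ "x - y"]) (auto simp: dist_norm norm_minus_commute)
    qed (force simp: K_def dist_norm)
    then show ?thesis using compact_sums[OF L(2) compact_cball[of 0 e]] by (simp only:)
  qed
  have KO: "K \<subseteq> \<Omega>" using e(2) by (simp add: K_def)
  have "\<exists>z \<in> Cc \<Omega>. (\<forall>x. 0 \<le> z x) \<and> semiconvex z \<and> (\<forall>x. g x \<le> z x \<and> z x \<le> g x + \<eta>) \<and> (\<forall>x. x \<notin> K \<longrightarrow> z x = 0)"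
    if \<eta>: "\<eta> > 0" for \<eta>
  proof -
    have "uniformly_continuous_on K g"
      by (intro compact_uniformly_continuous cK continuous_on_subset[OF L(1)]) simp
    then obtain \<delta> where \<delta>: "\<delta> > 0" "\<And>x y. x \<in> K \<Longrightarrow> y \<in> K \<Longrightarrow> dist y x < \<delta> \<Longrightarrow> dist (g y) (g x) < \<eta>"
      unfolding uniformly_continuous_on_def using \<eta> by metis
    define r where "r = min e (\<delta> / 2)"
    have r: "r > 0" "r \<le> e" "r < \<delta>" using e(1) \<delta>(1) by (auto simp: r_def)
    \<comment> \<open>With this \<open>d\<close> the value of \<open>z\<close> at x is at most that
      of \<open>g\<close> at a point within distance \<open>r\<close> of x.\<close>
    define d where "d = r\<^sup>2 / (2 * B)"
    have dd: "d > 0" "2 * d * B = r\<^sup>2" using r B by (auto simp: d_def)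
    define v where "v x = B - g x" for x
    have gB: "g x \<le> B" for x using B(2)[of x] by simp
    interpret inf_convolution d v
      using dd gB L(1) by unfold_locales (auto simp: v_def intro!: continuous_intros)
    define z where "z x = B - infc d v x" for x
    have zg: "g x \<le> z x" for x using le_self[of x] by (simp add: z_def v_def)
    have z0: "0 \<le> z x" for x using zg[of x] g(2)[of x] by simp
    have at: "\<exists>y. norm (y - x) \<le> r \<and> z x \<le> g y" for x
    proof -
      obtain y where y: "(norm (y - x))\<^sup>2 \<le> 2 * d * v x" "infc d v x = v y + (norm (y - x))\<^sup>2 / (2 * d)"
        using translate[of x] by blast
      have "2 * d * v x \<le> 2 * d * B" using dd g(2)[of x] by (intro mult_left_mono) (auto simp: v_def)
      then have "(norm (y - x))\<^sup>2 \<le> r\<^sup>2" using y(1) dd(2) by simp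
      then have "norm (y - x) \<le> r" using r(1) by (auto intro: power2_le_imp_le)
      moreover have "z x \<le> g y" using y(2) dd(1) by (simp add: z_def v_def)
      ultimately show ?thesis by blast
    qed
    have out: "z x = 0" if "x \<notin> K" for x
    proof -
      obtain y where y: "norm (y - x) \<le> r" "z x \<le> g y" using at by blast
      have "y \<notin> L" using that y(1) r(2) by (auto simp: K_def dist_norm)
      then show ?thesis using L(4)[of y] y(2) z0[of x] by simp
    qed
    have up: "z x \<le> g x + \<eta>" for x
    proof -
      obtain y where y: "norm (y - x) \<le> r" "z x \<le> g y" using at by blast
      show ?thesis
      proof (cases "y \<in> L")
        case True
        then have "x \<in> cball y e" using y(1) r(2) by (simp add: dist_norm)
        then have xK: "x \<in> K" using True by (auto simp: K_def)
        have "y \<in> K" using True e(1) by (force simp: K_def)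
        then have "dist (g y) (g x) < \<eta>" using y(1) r(3) xK by (intro \<delta>(2)) (auto simp: dist_norm)
        then show ?thesis using y(2) by (auto simp: dist_real_def)
      next
        case False
        then show ?thesis using L(4)[OF False] y(2) g(2)[of x] \<eta> by simp
      qed
    qed
    have "continuous_on UNIV (infc d v)"
      by (rule continuous_infc[of B]) (use g(2) in \<open>simp add: v_def\<close>)
    then have "z \<in> Cc \<Omega>"
      by (intro CcI[of _ K]) (auto simp: z_def[abs_def] out[unfolded z_def] intro!: continuous_intros cK subsetD[OF KO])
    moreover have "semiconvex z"
      unfolding semiconvex_def
    proof (intro exI[of _ "1 / d"] conjI allI)
      fix x h
      show "2 * z x - z (x + h) - z (x - h) \<le> 1 / d * (norm h)\<^sup>2"
        using semiconcave[of x h] by (simp add: z_def)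
    qed (use dd in simp)
    ultimately show ?thesis using z0 zg up out by blast
  qed
  with cK KO show ?thesis by (intro that[of K] allI impI)
qed

text \<open>A bridge to the gauge integral over a box, for which continuity in a parameter and
  differentiation under the integral sign are at hand.\<close>

lemma integral_eq_cbox:
  fixes f :: "'a::euclidean_space \<Rightarrow> real"
  assumes f: "continuous_on UNIV f" "\<And>x. x \<notin> cbox a b \<Longrightarrow> f x = 0"
  shows "integrable lborel f" "(\<integral>x. f x \<partial>lborel) = integral (cbox a b) f"
proof -
  have "f \<in> Cc UNIV" by (rule CcI[OF f(1) compact_cbox _ f(2)]) auto
  then show i: "integrable lborel f" by (rule Cc_integrable)
  have "f integrable_on cbox a b"
    by (intro integrable_continuous continuous_on_subset[OF f(1)]) simp
  then have "(f has_integral integral (cbox a b) f) UNIV"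
    using f(2) by (intro has_integral_on_superset[OF integrable_integral]) auto
  with has_integral_integral_lborel[OF i] show "(\<integral>x. f x \<partial>lborel) = integral (cbox a b) f"
    by (rule has_integral_unique)
qed

section \<open>Nonnegative solutions\<close>

lemma frac_lap_trunc_eq:
  fixes \<phi> :: "'a::euclidean_space \<Rightarrow> real"
  assumes [measurable]: "\<phi> \<in> borel_measurable borel"
  shows "frac_lap_trunc s \<phi> x \<epsilon> = frac_lap_const DIM('a) s * trunc (real DIM('a) + 2 * s) {\<epsilon><..} \<phi> x"
proof -
  define q where "q = real DIM('a) + 2 * s"
  have "(LINT z:{z. norm (z - x) > \<epsilon>}|lebesgue. (\<phi> x - \<phi> z) / norm (z - x) powr q)
     = (LINT z|lebesgue. (\<phi> x - \<phi> z) * ker q {\<epsilon><..} (z - x))"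
    unfolding set_lebesgue_integral_def
    by (intro Bochner_Integration.integral_cong)
       (auto simp: ker_def indicator_def powr_minus divide_inverse)
  also have "\<dots> = (\<integral>z. (\<phi> x - \<phi> z) * ker q {\<epsilon><..} (z - x) \<partial>lborel)"
    by (rule integral_completion) measurable
  also have "\<dots> = trunc q {\<epsilon><..} \<phi> x"
    unfolding trunc_def
    using integral_lborel_translate(1)[of "\<lambda>z. (\<phi> x - \<phi> z) * ker q {\<epsilon><..} (z - x)" x] by simp
  finally show ?thesis by (simp add: frac_lap_trunc_def q_def)
qed

lemma frac_lap_const_pos: "0 < s \<Longrightarrow> s < 1 \<Longrightarrow> 0 < frac_lap_const N s"
  unfolding frac_lap_const_def
  by (intro mult_pos_pos divide_pos_pos Gamma_real_pos) (auto simp: add_nonneg_pos)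

locale nonneg_solution =
  fixes s :: real and f :: "real \<Rightarrow> 'a::euclidean_space \<Rightarrow> real \<Rightarrow> real" and u :: "real \<Rightarrow> 'a \<Rightarrow> real"
  assumes s01: "0 < s" "s < 1"
    and f_sign: "\<And>t x r. t > 0 \<Longrightarrow> f t x r * r \<ge> 0"
    and sol: "classical_solution s f u"
    and u_nonneg: "\<And>t x. t > 0 \<Longrightarrow> u t x \<ge> 0"
begin

definition "p = real DIM('a) + 2 * s"
definition "cst = frac_lap_const DIM('a) s"
definition "ut t x = deriv (\<lambda>\<tau>. u \<tau> x) t"
definition "Lu t x = frac_lap s (u t) x"
definition "Fu t x = f t x (u t x)"

lemma p_bounds: "real DIM('a) < p" "p < real DIM('a) + 2" "0 < p"
  using s01 by (auto simp: p_def intro!: add_nonneg_pos)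

lemma cst_pos: "0 < cst"
  unfolding cst_def by (rule frac_lap_const_pos[OF s01])

lemma continuous_Q: "continuous_on Q_infty (\<lambda>(t, x). u t x)" "continuous_on Q_infty (\<lambda>(t, x). ut t x)"
    "continuous_on Q_infty (\<lambda>(t, x). Lu t x)"
  using sol unfolding classical_solution_def ut_def Lu_def by auto

lemma equation: "0 < t \<Longrightarrow> ut t x + Lu t x + Fu t x = 0"
  using sol unfolding classical_solution_def ut_def Lu_def Fu_def by auto

lemma u_deriv: "0 < t \<Longrightarrow> ((\<lambda>\<tau>. u \<tau> x) has_real_derivative ut t x) (at t)"
  using sol unfolding classical_solution_def ut_def
  by (metis DERIV_imp_deriv real_differentiable_def)

text \<open>\<open>f\<close> itself need not be continuous; its composition with the solution is,
  because the equation expresses it by two continuous functions.\<close>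

lemma continuous_Fu: "continuous_on Q_infty (\<lambda>(t, x). Fu t x)"
proof -
  have "continuous_on Q_infty (\<lambda>p. - (\<lambda>(t, x). ut t x) p - (\<lambda>(t, x). Lu t x) p)"
    by (intro continuous_intros continuous_Q)
  then show ?thesis
  proof (rule continuous_on_eq)
    fix q :: "real \<times> 'a" assume "q \<in> Q_infty"
    then obtain t x where q: "q = (t, x)" "0 < t" by (auto simp: Q_infty_def)
    then show "- (\<lambda>(t, x). ut t x) q - (\<lambda>(t, x). Lu t x) q = (\<lambda>(t, x). Fu t x) q"
      using equation[OF q(2), of x] by simp
  qed
qed

lemma slice: "continuous_on Q_infty (\<lambda>(t, x). g t x) \<Longrightarrow> 0 < t \<Longrightarrow> continuous_on UNIV (g t)"
  by (drule continuous_on_compose2[where s = UNIV and f = "\<lambda>x. (t, x)"])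
     (auto simp: Q_infty_def intro!: continuous_intros)

lemmas continuous_slices = slice[OF continuous_Q(1)] slice[OF continuous_Q(2)] slice[OF continuous_Q(3)] slice[OF continuous_Fu]

lemma u_weighted: assumes t: "0 < t" shows "u t \<in> weighted_L1 p"
proof -
  have m [measurable]: "u t \<in> borel_measurable borel"
    by (rule borel_measurable_continuous_onI[OF continuous_slices(1)[OF t]])
  have "u t \<in> Ls_space s" using sol t by (auto simp: classical_solution_def)
  then have "(\<integral>\<^sup>+x. ennreal (\<bar>u t x\<bar> / (1 + norm x powr p)) \<partial>lborel) < \<infinity>"
    by (simp add: Ls_space_def p_def nn_integral_completion)
  then have "integrable lborel (\<lambda>x. u t x / (1 + norm x powr p))"
    using u_nonneg[OF t] by (intro integrableI_nonneg) (auto intro!: AE_I2 divide_nonneg_nonneg add_nonneg_nonneg)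
  then show ?thesis using m by (simp add: weighted_L1_def)
qed

lemma trunc_tendsto: assumes t: "0 < t"
  shows "((\<lambda>\<epsilon>. trunc p {\<epsilon><..} (u t) x) \<longlongrightarrow> Lu t x / cst) (at_right 0)"
proof -
  have m: "u t \<in> borel_measurable borel"
    by (rule borel_measurable_continuous_onI[OF continuous_slices(1)[OF t]])
  have "frac_lap_exists s (u t) x" using sol t by (auto simp: classical_solution_def)
  then obtain l where l: "(frac_lap_trunc s (u t) x \<longlongrightarrow> l) (at_right 0)" by (auto simp: frac_lap_exists_def)
  then have "Lu t x = l" unfolding Lu_def frac_lap_def by (intro tendsto_Lim) auto
  moreover have "frac_lap_trunc s (u t) x = (\<lambda>\<epsilon>. cst * trunc p {\<epsilon><..} (u t) x)"
    by (rule ext) (simp add: frac_lap_trunc_eq[OF m] cst_def p_def)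
  ultimately have "((\<lambda>\<epsilon>. cst * trunc p {\<epsilon><..} (u t) x) \<longlongrightarrow> Lu t x) (at_right 0)"
    using l by simp
  then have "((\<lambda>\<epsilon>. cst * trunc p {\<epsilon><..} (u t) x / cst) \<longlongrightarrow> Lu t x / cst) (at_right 0)"
    using cst_pos by (intro tendsto_divide tendsto_const) auto
  then show ?thesis using cst_pos by simp
qed

text \<open>At a zero of \<open>u\<close>, where the sign condition on \<open>f\<close> is void, \<open>u(\<cdot>, x)\<close> and \<open>u(t, \<cdot>)\<close> are
  both minimal.\<close>

lemma Fu_nonneg: assumes t: "0 < t" shows "0 \<le> Fu t x"
proof (cases "u t x = 0")
  case False
  then have "u t x > 0" using u_nonneg[OF t, of x] by simp
  then show ?thesis using f_sign[OF t, of x "u t x"] by (simp add: Fu_def zero_le_mult_iff)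
next
  case True
  have "ut t x = 0"
    by (rule DERIV_local_min[OF u_deriv[OF t] t]) (use True u_nonneg in auto)
  moreover have "Lu t x / cst \<le> 0"
  proof (rule tendsto_upperbound[OF trunc_tendsto[OF t]])
    have "trunc p {\<epsilon><..} (u t) x \<le> 0" for \<epsilon>
      unfolding trunc_def True using u_nonneg[OF t]
      by (auto intro!: Bochner_Integration.integral_nonneg simp: ker_nonneg)
    then show "\<forall>\<^sub>F \<epsilon> in at_right 0. trunc p {\<epsilon><..} (u t) x \<le> 0" by simp
  qed simp
  ultimately show ?thesis using equation[OF t, of x] cst_pos by (simp add: divide_le_0_iff)
qed

section \<open>The regular set and the initial trace\<close>

lemma open_regular_set: "open (regular_set f u)"
  unfolding open_contains_ball
proof
  fix z assume "z \<in> regular_set f u"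
  then obtain \<rho> where \<rho>: "\<rho> > 0"
    "(\<integral>\<^sup>+t\<in>{0<..<1}. (\<integral>\<^sup>+x\<in>ball z \<rho>. ennreal (f t x (u t x)) \<partial>lebesgue) \<partial>lebesgue) < \<infinity>"
    by (auto simp: regular_set_def)
  have "y \<in> regular_set f u" if y: "y \<in> ball z \<rho>" for y
  proof -
    define r where "r = \<rho> - dist z y"
    have r: "r > 0" "ball y r \<subseteq> ball z \<rho>"
    proof -
      show "r > 0" using y by (simp add: r_def)
      show "ball y r \<subseteq> ball z \<rho>"
      proof
        fix x assume "x \<in> ball y r"
        then show "x \<in> ball z \<rho>" using dist_triangle[of z x y] by (simp add: r_def)
      qed
    qed
    have "(\<integral>\<^sup>+t\<in>{0<..<1}. (\<integral>\<^sup>+x\<in>ball y r. ennreal (f t x (u t x)) \<partial>lebesgue) \<partial>lebesgue)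
      \<le> (\<integral>\<^sup>+t\<in>{0<..<1}. (\<integral>\<^sup>+x\<in>ball z \<rho>. ennreal (f t x (u t x)) \<partial>lebesgue) \<partial>lebesgue)"
      using r(2) by (intro nn_integral_mono mult_right_mono mult_left_mono) (auto simp: indicator_def)
    then show ?thesis using r(1) \<rho>(2) by (auto simp: regular_set_def intro: le_less_trans)
  qed
  then show "\<exists>e>0. ball z e \<subseteq> regular_set f u" using \<rho>(1) by blast
qed

text \<open>Finitely many of the balls in the definition of \<open>regular_set\<close> cover the
  support of \<open>\<zeta>\<close>. On each of them the space-time integral of the absorption term
  is finite, and \<open>\<zeta>\<close> is bounded.\<close>

lemma Fu_test_bound:
  assumes \<zeta>: "\<zeta> \<in> Cc (regular_set f u)" "\<And>x. 0 \<le> \<zeta> x"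
    and F: "continuous_on {0<..} (\<lambda>t. \<integral>x. Fu t x * \<zeta> x \<partial>lborel)"
  obtains B where "\<And>t. 0 < t \<Longrightarrow> t < 1/2 \<Longrightarrow> integral {t..1/2} (\<lambda>t. \<integral>x. Fu t x * \<zeta> x \<partial>lborel) \<le> B"
proof -
  define FF where "FF t = (\<integral>x. Fu t x * \<zeta> x \<partial>lborel)" for t
  from \<zeta>(1) obtain K where K: "compact K" "K \<subseteq> regular_set f u" "\<And>x. x \<notin> K \<Longrightarrow> \<zeta> x = 0" by (rule CcE) blast
  obtain M where M: "M > 0" "\<And>x. \<bar>\<zeta> x\<bar> \<le> M" using Cc_bounded[OF \<zeta>(1)] by blast
  define h where "h z \<rho> t = (\<integral>\<^sup>+x\<in>ball z \<rho>. ennreal (Fu t x) \<partial>lborel)" for z \<rho> t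
  have "\<forall>z\<in>K. \<exists>\<rho>>0. (\<integral>\<^sup>+t\<in>{0<..<1}. h z \<rho> t \<partial>lborel) < \<infinity>"
    using K(2) by (auto simp: regular_set_def h_def Fu_def nn_integral_completion)
  then obtain \<rho> where \<rho>: "\<And>z. z \<in> K \<Longrightarrow> \<rho> z > 0 \<and> (\<integral>\<^sup>+t\<in>{0<..<1}. h z (\<rho> z) t \<partial>lborel) < \<infinity>"
    by metis
  obtain Z where Z: "Z \<subseteq> K" "finite Z" "K \<subseteq> (\<Union>z\<in>Z. ball z (\<rho> z))"
    using compactE_image[OF K(1), of K "\<lambda>z. ball z (\<rho> z)"] \<rho> by force
  \<comment> \<open>Continuity is known only on \<open>Q_infty\<close>. Extension by zero gives a
    Borel function on the whole product, from which the measurability in time of the inner integrals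
    follows.\<close>
  define G where "G q = indicator Q_infty q *\<^sub>R (case q of (t, x) \<Rightarrow> Fu t x)" for q
  have "G \<in> borel_measurable borel"
    unfolding G_def by (intro borel_measurable_continuous_on_indicator continuous_Fu)
      (auto simp: Q_infty_def intro!: borel_open open_Times)
  then have Gm [measurable]: "G \<in> borel_measurable (borel \<Otimes>\<^sub>M borel)" by (simp add: borel_prod)
  have hm: "(\<lambda>t. h z r t * indicator {0<..<1} t) \<in> borel_measurable lborel" for z r
  proof -
    define b where "b = (indicator (ball z r) :: 'a \<Rightarrow> ennreal)"
    define i where "i = (indicator {0<..<1} :: real \<Rightarrow> ennreal)"
    have [measurable]: "b \<in> borel_measurable borel" "i \<in> borel_measurable borel"
      unfolding b_def i_def by (intro borel_measurable_indicator; simp)+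
    have "(\<lambda>t. (\<integral>\<^sup>+x. ennreal (G (t, x)) * b x \<partial>lborel) * i t) \<in> borel_measurable lborel"
      by measurable
    also have "(\<lambda>t. (\<integral>\<^sup>+x. ennreal (G (t, x)) * b x \<partial>lborel) * i t) = (\<lambda>t. h z r t * indicator {0<..<1} t)"
      by (auto simp: h_def G_def Q_infty_def indicator_def fun_eq_iff b_def i_def)
    finally show ?thesis .
  qed
  define R where "R = (\<Sum>z\<in>Z. \<integral>\<^sup>+t\<in>{0<..<1}. h z (\<rho> z) t \<partial>lborel)"
  have Rfin: "ennreal M * R < \<infinity>"
  proof -
    have "R < top" unfolding R_def using \<rho> Z(1) by (subst ennreal_sum_less_top[OF Z(2)]) auto
    then show ?thesis by (simp add: ennreal_mult_less_top)
  qed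
  have FF_le: "ennreal (FF t) \<le> ennreal M * (\<Sum>z\<in>Z. h z (\<rho> z) t)" if t: "0 < t" for t
  proof -
    have [measurable]: "Fu t \<in> borel_measurable borel"
      by (rule borel_measurable_continuous_onI[OF continuous_slices(4)[OF t]])
    have i: "integrable lborel (\<lambda>x. Fu t x * \<zeta> x)"
      using Cc_integrable[OF Cc_mult[OF \<zeta>(1) continuous_slices(4)[OF t]]] by (simp add: mult.commute)
    have "ennreal (FF t) = (\<integral>\<^sup>+x. ennreal (Fu t x * \<zeta> x) \<partial>lborel)"
      unfolding FF_def using Fu_nonneg[OF t] \<zeta>(2) by (intro nn_integral_eq_integral[symmetric] i) auto
    also have "\<dots> \<le> (\<integral>\<^sup>+x. ennreal M * (\<Sum>z\<in>Z. ennreal (Fu t x) * indicator (ball z (\<rho> z)) x) \<partial>lborel)"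
    proof (rule nn_integral_mono)
      fix x
      show "ennreal (Fu t x * \<zeta> x) \<le> ennreal M * (\<Sum>z\<in>Z. ennreal (Fu t x) * indicator (ball z (\<rho> z)) x)"
      proof (cases "x \<in> K")
        case True
        then obtain z where z: "z \<in> Z" "x \<in> ball z (\<rho> z)" using Z(3) by blast
        have "Fu t x * \<zeta> x \<le> M * Fu t x"
          using M(2)[of x] Fu_nonneg[OF t, of x] by (subst mult.commute) (intro mult_right_mono, auto)
        then have "ennreal (Fu t x * \<zeta> x) \<le> ennreal M * (ennreal (Fu t x) * indicator (ball z (\<rho> z)) x)"
          using M(1) Fu_nonneg[OF t, of x] z(2) by (simp add: ennreal_mult[symmetric] ennreal_leI)
        also have "\<dots> \<le> ennreal M * (\<Sum>z\<in>Z. ennreal (Fu t x) * indicator (ball z (\<rho> z)) x)"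
          by (rule mult_left_mono[OF member_le_sum[OF z(1) _ Z(2)]]) auto
        finally show ?thesis .
      qed (simp add: K)
    qed
    also have "\<dots> = ennreal M * (\<Sum>z\<in>Z. h z (\<rho> z) t)"
    proof -
      have m: "(\<lambda>x. ennreal (Fu t x) * indicator (ball z (\<rho> z)) x) \<in> borel_measurable lborel" for z
        by (intro borel_measurable_times_ennreal borel_measurable_indicator) auto
      show ?thesis
        unfolding h_def nn_integral_sum[OF m, symmetric]
        by (intro nn_integral_cmult borel_measurable_sum m)
    qed
    finally show ?thesis .
  qed
  have "integral {t..1/2} FF \<le> enn2real (ennreal M * R)" if t: "0 < t" "t < 1/2" for t
  proof -
    have FF0: "0 \<le> FF \<tau>" if "0 < \<tau>" for \<tau>
      unfolding FF_def using Fu_nonneg[OF that] \<zeta>(2) by (intro Bochner_Integration.integral_nonneg) auto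
    have c: "continuous_on {t..1/2} FF"
      using F t unfolding FF_def[abs_def] by (auto intro: continuous_on_subset)
    have si: "set_integrable lborel {t..1/2} FF" by (rule borel_integrable_atLeastAtMost'[OF c])
    have "ennreal (integral {t..1/2} FF) = ennreal (\<integral>\<tau>. indicator {t..1/2} \<tau> *\<^sub>R FF \<tau> \<partial>lborel)"
      using set_borel_integral_eq_integral(2)[OF si] by (simp add: set_lebesgue_integral_def)
    also have "\<dots> = (\<integral>\<^sup>+\<tau>. ennreal (indicator {t..1/2} \<tau> *\<^sub>R FF \<tau>) \<partial>lborel)"
      using si FF0 t unfolding set_integrable_def
      by (intro nn_integral_eq_integral[symmetric]) (auto intro!: AE_I2 simp: indicator_def)
    also have "\<dots> \<le> (\<integral>\<^sup>+\<tau>. ennreal M * (\<Sum>z\<in>Z. h z (\<rho> z) \<tau> * indicator {0<..<1} \<tau>) \<partial>lborel)"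
    proof (rule nn_integral_mono)
      fix \<tau>
      show "ennreal (indicator {t..1/2} \<tau> *\<^sub>R FF \<tau>) \<le> ennreal M * (\<Sum>z\<in>Z. h z (\<rho> z) \<tau> * indicator {0<..<1} \<tau>)"
      proof (cases "\<tau> \<in> {t..1/2}")
        case True
        then have "0 < \<tau>" "\<tau> < 1" using t by auto
        then show ?thesis using FF_le[of \<tau>] True by simp
      qed simp
    qed
    also have "\<dots> = ennreal M * R"
      unfolding R_def using hm by (subst nn_integral_cmult) (auto simp: nn_integral_sum intro!: borel_measurable_sum)
    finally show ?thesis
      using Rfin by (cases "ennreal M * R") (auto simp: ennreal_le_iff2)
  qed
  then show ?thesis unfolding FF_def[abs_def] by (rule that)
qed

text \<open>Testing the equation with \<open>\<zeta>\<close> expresses X' by the fractional and the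
  absorption terms. \<open>integral_principal_value_le\<close> bounds the former by a multiple of X,
  and \<open>Fu_test_bound\<close> makes the latter integrable up to time 0.\<close>

lemma trace_semiconvex:
  assumes \<zeta>: "\<zeta> \<in> Cc (regular_set f u)" "\<And>x. 0 \<le> \<zeta> x" "semiconvex \<zeta>"
  shows "\<exists>l. ((\<lambda>t. \<integral>x. u t x * \<zeta> x \<partial>lborel) \<longlongrightarrow> l) (at_right 0)"
proof -
  from \<zeta>(1) obtain K where K: "continuous_on UNIV \<zeta>" "compact K" "\<And>x. x \<notin> K \<Longrightarrow> \<zeta> x = 0" by (rule CcE) blast
  obtain a where a: "K \<subseteq> cbox (- a) a" using bounded_subset_cbox_symmetric[OF compact_imp_bounded[OF K(2)]] by blast
  have out: "\<zeta> x = 0" if "x \<notin> cbox (- a) a" for x using that a K(3) by blast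
  have \<zeta>U: "\<zeta> \<in> Cc UNIV" by (rule Cc_mono[OF \<zeta>(1)]) simp
  obtain C where C: "0 \<le> C"
    "\<And>v G. continuous_on UNIV v \<Longrightarrow> (\<And>x. 0 \<le> v x) \<Longrightarrow> v \<in> weighted_L1 p \<Longrightarrow> continuous_on UNIV G \<Longrightarrow>
      (\<And>x. ((\<lambda>\<epsilon>. trunc p {\<epsilon><..} v x) \<longlongrightarrow> G x) (at_right 0)) \<Longrightarrow>
      (\<integral>x. \<zeta> x * G x \<partial>lborel) \<le> C * (\<integral>x. v x * \<zeta> x \<partial>lborel)"
    using integral_principal_value_le[OF p_bounds(1,2) \<zeta>U \<zeta>(2,3)] by blast
  have cont: "continuous_on ({0<..} \<times> cbox (- a) a) (\<lambda>(t, x). g t x * \<zeta> x)"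
    if "continuous_on Q_infty (\<lambda>(t, x). g t x)" for g
  proof -
    have "continuous_on ({0<..} \<times> cbox (- a) a) (\<lambda>q. (\<lambda>(t, x). g t x) q * \<zeta> (snd q))"
      by (rule continuous_on_mult[OF continuous_on_subset[OF that] continuous_on_compose2[OF K(1)]])
         (auto simp: Q_infty_def intro!: continuous_intros)
    then show ?thesis by (simp add: case_prod_beta)
  qed
  have int: "integrable lborel (\<lambda>x. g t x * \<zeta> x)" "(\<integral>x. g t x * \<zeta> x \<partial>lborel) = integral (cbox (- a) a) (\<lambda>x. g t x * \<zeta> x)"
    if "continuous_on Q_infty (\<lambda>(t, x). g t x)" "0 < t" for g t
    using integral_eq_cbox[of "\<lambda>x. g t x * \<zeta> x" "- a" a] slice[OF that] K(1) out
    by (auto intro!: continuous_intros)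
  define X where "X t = (\<integral>x. u t x * \<zeta> x \<partial>lborel)" for t
  define FF where "FF t = (\<integral>x. Fu t x * \<zeta> x \<partial>lborel)" for t
  have contFF: "continuous_on {0<..} FF"
  proof -
    have "continuous_on {0<..} (\<lambda>t. integral (cbox (- a) a) (\<lambda>x. Fu t x * \<zeta> x))"
      by (rule integral_continuous_on_param[OF cont[OF continuous_Fu]])
    then show ?thesis
      by (rule continuous_on_eq) (simp add: FF_def int(2)[OF continuous_Fu])
  qed
  obtain B where B: "\<And>t. 0 < t \<Longrightarrow> t < 1/2 \<Longrightarrow> integral {t..1/2} FF \<le> B"
    using Fu_test_bound[OF \<zeta>(1,2)] contFF unfolding FF_def[abs_def] by blast
  have "\<exists>l. (X \<longlongrightarrow> l) (at_right 0)"
  proof (rule tendsto_of_differential_inequality)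
    fix t :: real assume t: "0 < t"
    have "((\<lambda>t. integral (cbox (- a) a) (\<lambda>x. u t x * \<zeta> x)) has_field_derivative integral (cbox (- a) a) (\<lambda>x. ut t x * \<zeta> x)) (at t within {0<..})"
    proof (rule leibniz_rule_field_derivative)
      fix \<tau> :: real and x assume "\<tau> \<in> {0<..}"
      then show "((\<lambda>\<tau>. u \<tau> x * \<zeta> x) has_field_derivative ut \<tau> x * \<zeta> x) (at \<tau> within {0<..})"
        using has_field_derivative_at_within[OF u_deriv[of \<tau> x]] by (intro DERIV_cmult_right) auto
    next
      fix \<tau> :: real assume "\<tau> \<in> {0<..}"
      then show "(\<lambda>x. u \<tau> x * \<zeta> x) integrable_on cbox (- a) a"
        by (intro integrable_continuous continuous_intros continuous_on_subset[OF continuous_slices(1)] continuous_on_subset[OF K(1)]) auto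
    qed (use cont[OF continuous_Q(2)] t in auto)
    then have "((\<lambda>t. integral (cbox (- a) a) (\<lambda>x. u t x * \<zeta> x)) has_field_derivative (\<integral>x. ut t x * \<zeta> x \<partial>lborel)) (at t)"
      using t by (subst (asm) at_within_open) (auto simp: int(2)[OF continuous_Q(2) t])
    then show "(X has_real_derivative (\<integral>x. ut t x * \<zeta> x \<partial>lborel)) (at t)"
      by (rule has_field_derivative_transform_within_open[of _ _ _ "{0<..}"])
         (use t in \<open>auto simp: X_def int(2)[OF continuous_Q(1)]\<close>)
    show "0 \<le> X t" unfolding X_def using u_nonneg[OF t] \<zeta>(2)
      by (intro Bochner_Integration.integral_nonneg) auto
    show "0 \<le> FF t" unfolding FF_def using Fu_nonneg[OF t] \<zeta>(2)
      by (intro Bochner_Integration.integral_nonneg) auto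
    \<comment> \<open>\<open>trunc\<close> omits the normalising constant, so its limit is
      \<open>Lu t x / cst\<close>.\<close>
    have "(\<integral>x. \<zeta> x * (Lu t x / cst) \<partial>lborel) \<le> C * X t"
      unfolding X_def
      by (intro C(2) continuous_slices(1) u_nonneg u_weighted trunc_tendsto t)
         (use cst_pos in \<open>auto intro!: continuous_intros continuous_slices(3) t\<close>)
    also have "(\<integral>x. \<zeta> x * (Lu t x / cst) \<partial>lborel) = (\<integral>x. Lu t x * \<zeta> x \<partial>lborel) / cst"
      by (subst Bochner_Integration.integral_divide_zero[symmetric]) (simp add: mult.commute)
    finally have L: "(\<integral>x. Lu t x * \<zeta> x \<partial>lborel) \<le> (cst * C) * X t"
      using cst_pos by (simp add: field_simps)
    have "(\<integral>x. ut t x * \<zeta> x \<partial>lborel) = (\<integral>x. - (Lu t x * \<zeta> x) - Fu t x * \<zeta> x \<partial>lborel)"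
    proof (rule Bochner_Integration.integral_cong)
      fix x
      have e: "ut t x = - Lu t x - Fu t x" using equation[OF t, of x] by linarith
      show "ut t x * \<zeta> x = - (Lu t x * \<zeta> x) - Fu t x * \<zeta> x" unfolding e by (simp add: left_diff_distrib)
    qed simp
    also have "\<dots> = - (\<integral>x. Lu t x * \<zeta> x \<partial>lborel) - FF t"
      unfolding FF_def
      by (subst Bochner_Integration.integral_diff) (auto intro!: int(1) continuous_Q continuous_Fu t)
    finally show "- (cst * C) * X t - FF t \<le> (\<integral>x. ut t x * \<zeta> x \<partial>lborel)" using L by simp
  qed (use contFF C(1) cst_pos in simp, use contFF C(1) cst_pos in simp, rule B)
  then show ?thesis by (simp add: X_def[abs_def])
qed

text \<open>A semiconvex \<open>z\<close> with g \<le> z \<le> g + \<eta> vanishing off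
  \<open>K\<close> satisfies z \<le> g + \<eta> \<sigma> for a fixed \<open>\<sigma>\<close> that is
  at least 1 on \<open>K\<close>. The error is then \<open>\<eta>\<close> times the integral of u(t)
  \<sigma>, which stays bounded because it converges.\<close>

lemma trace_nonneg:
  assumes g: "g \<in> Cc (regular_set f u)" "\<And>x. 0 \<le> g x"
  shows "\<exists>l. ((\<lambda>t. \<integral>x. u t x * g x \<partial>lborel) \<longlongrightarrow> l) (at_right 0)"
proof -
  let ?\<Omega> = "regular_set f u"
  obtain K where K: "compact K" "K \<subseteq> ?\<Omega>"
    "\<forall>\<eta>>0. \<exists>z \<in> Cc ?\<Omega>. (\<forall>x. 0 \<le> z x) \<and> semiconvex z \<and> (\<forall>x. g x \<le> z x \<and> z x \<le> g x + \<eta>) \<and> (\<forall>x. x \<notin> K \<longrightarrow> z x = 0)"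
    by (rule Cc_semiconvex_approx[OF g open_regular_set]) (rule that)
  obtain \<tau> where \<tau>: "\<tau> \<in> Cc ?\<Omega>" "\<And>x. 0 \<le> \<tau> x" "\<And>x. x \<in> K \<Longrightarrow> \<tau> x = 1"
    using Cc_bump[OF K(1) open_regular_set K(2)] by metis
  \<comment> \<open>The cut-off \<open>\<tau>\<close> is only continuous; its semiconvex majorant
    \<open>\<sigma>\<close> is within the reach of \<open>trace_semiconvex\<close>. The tolerance 1
    is arbitrary.\<close>
  obtain \<sigma> where \<sigma>: "\<sigma> \<in> Cc ?\<Omega>" "\<And>x. 0 \<le> \<sigma> x" "semiconvex \<sigma>" "\<And>x. \<tau> x \<le> \<sigma> x"
  proof -
    obtain L where "\<forall>\<eta>>0. \<exists>z \<in> Cc ?\<Omega>. (\<forall>x. 0 \<le> z x) \<and> semiconvex z \<and>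
        (\<forall>x. \<tau> x \<le> z x \<and> z x \<le> \<tau> x + \<eta>) \<and> (\<forall>x. x \<notin> L \<longrightarrow> z x = 0)"
      by (rule Cc_semiconvex_approx[OF \<tau>(1,2) open_regular_set])
    from this[rule_format, OF zero_less_one] show ?thesis using that by blast
  qed
  obtain l where l: "((\<lambda>t. \<integral>x. u t x * \<sigma> x \<partial>lborel) \<longlongrightarrow> l) (at_right 0)"
    using trace_semiconvex[OF \<sigma>(1-3)] by blast
  have int: "integrable lborel (\<lambda>x. u t x * h x)" if "0 < t" "h \<in> Cc ?\<Omega>" for t h
    by (rule weighted_L1_times_Cc[OF u_weighted[OF that(1)] that(2) p_bounds(3)])
  show ?thesis
  proof (rule tendsto_of_approx)
    fix e :: real assume e: "e > 0"
    \<comment> \<open>Near time 0 the integral of u(t) \<sigma> is below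
      \<open>\<bar>l\<bar> + 1\<close>, so this \<open>\<eta>\<close> makes the approximation error
      at most \<open>e / 2\<close>.\<close>
    define \<eta> where "\<eta> = e / (2 * (\<bar>l\<bar> + 1))"
    have \<eta>: "\<eta> > 0" "\<eta> * (\<bar>l\<bar> + 1) = e / 2" using e by (auto simp: \<eta>_def field_simps)
    obtain z where z: "z \<in> Cc ?\<Omega>" "\<And>x. 0 \<le> z x" "semiconvex z" "\<And>x. g x \<le> z x" "\<And>x. z x \<le> g x + \<eta>"
      "\<And>x. x \<notin> K \<Longrightarrow> z x = 0"
      using K(3)[rule_format, OF \<eta>(1)] by blast
    obtain a where a: "((\<lambda>t. \<integral>x. u t x * z x \<partial>lborel) \<longlongrightarrow> a) (at_right 0)"
      using trace_semiconvex[OF z(1-3)] by blast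
    have "\<forall>\<^sub>F t in at_right 0. \<bar>(\<integral>x. u t x * z x \<partial>lborel) - a\<bar> < e / 2"
      using tendstoD[OF a, of "e / 2"] e by (simp add: dist_real_def)
    moreover have "\<forall>\<^sub>F t in at_right 0. \<bar>(\<integral>x. u t x * \<sigma> x \<partial>lborel) - l\<bar> < 1"
      using tendstoD[OF l, of 1] by (simp add: dist_real_def)
    moreover have "\<forall>\<^sub>F t in at_right (0::real). 0 < t" by (rule eventually_at_right_less)
    ultimately have "\<forall>\<^sub>F t in at_right 0. \<bar>(\<integral>x. u t x * g x \<partial>lborel) - a\<bar> \<le> e"
    proof eventually_elim
      case (elim t)
      note t = elim(3)
      note i = int[OF t g(1)] int[OF t z(1)] int[OF t \<sigma>(1)]
      have "(\<integral>x. u t x * g x \<partial>lborel) \<le> (\<integral>x. u t x * z x \<partial>lborel)"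
        by (rule Bochner_Integration.integral_mono[OF i(1,2)]) (rule mult_left_mono[OF z(4) u_nonneg[OF t]])
      moreover have "(\<integral>x. u t x * z x \<partial>lborel) \<le> (\<integral>x. u t x * (g x + \<eta> * \<sigma> x) \<partial>lborel)"
      proof (rule Bochner_Integration.integral_mono)
        fix x
        have "z x \<le> g x + \<eta> * \<sigma> x"
        proof (cases "x \<in> K")
          case True
          then have "1 \<le> \<sigma> x" using \<tau>(3)[of x] \<sigma>(4)[of x] by simp
          then have "\<eta> * 1 \<le> \<eta> * \<sigma> x" using \<eta>(1) by (intro mult_left_mono) auto
          then show ?thesis using z(5)[of x] by simp
        next
          case False
          then show ?thesis using z(6)[OF False] g(2)[of x] \<sigma>(2)[of x] \<eta>(1) by simp
        qed
        then show "u t x * z x \<le> u t x * (g x + \<eta> * \<sigma> x)" by (rule mult_left_mono[OF _ u_nonneg[OF t]])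
      next
        show "integrable lborel (\<lambda>x. u t x * (g x + \<eta> * \<sigma> x))"
          by (rule int[OF t Cc_add[OF g(1) Cc_cmult[OF \<sigma>(1)]]])
      qed (rule i(2))
      moreover have "(\<integral>x. u t x * (g x + \<eta> * \<sigma> x) \<partial>lborel) = (\<integral>x. u t x * g x \<partial>lborel) + \<eta> * (\<integral>x. u t x * \<sigma> x \<partial>lborel)"
      proof -
        have "(\<integral>x. u t x * (g x + \<eta> * \<sigma> x) \<partial>lborel) = (\<integral>x. u t x * g x + \<eta> * (u t x * \<sigma> x) \<partial>lborel)"
          by (simp add: algebra_simps)
        also have "\<dots> = (\<integral>x. u t x * g x \<partial>lborel) + (\<integral>x. \<eta> * (u t x * \<sigma> x) \<partial>lborel)"
          by (rule Bochner_Integration.integral_add[OF i(1) integrable_mult_right[OF i(3)]])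
        finally show ?thesis by simp
      qed
      moreover have "\<eta> * (\<integral>x. u t x * \<sigma> x \<partial>lborel) \<le> e / 2"
        unfolding \<eta>(2)[symmetric] using elim(2) \<eta>(1) by (intro mult_left_mono) linarith+
      ultimately show ?case using elim(1) by linarith
    qed
    then show "\<exists>a. \<forall>\<^sub>F t in at_right 0. \<bar>(\<integral>x. u t x * g x \<partial>lborel) - a\<bar> \<le> e" by blast
  qed simp
qed

definition trace :: "('a \<Rightarrow> real) \<Rightarrow> real" where
  "trace g = Lim (at_right 0) (\<lambda>t. \<integral>x. u t x * g x \<partial>lborel)"

lemma integrable_u_Cc: "0 < t \<Longrightarrow> g \<in> Cc \<Omega> \<Longrightarrow> integrable lborel (\<lambda>x. u t x * g x)"
  by (rule weighted_L1_times_Cc[OF u_weighted _ p_bounds(3)])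

lemma trace_tendsto:
  assumes g: "g \<in> Cc (regular_set f u)"
  shows "((\<lambda>t. \<integral>x. u t x * g x \<partial>lborel) \<longlongrightarrow> trace g) (at_right 0)"
proof -
  define P where "P x = max 0 (g x)" for x
  define M where "M x = max 0 (- g x)" for x
  have P: "P \<in> Cc (regular_set f u)" unfolding P_def
    by (auto intro!: Cc_combine[OF g g, where H="\<lambda>y _. max 0 y"] continuous_intros)
  have M: "M \<in> Cc (regular_set f u)" unfolding M_def
    by (auto intro!: Cc_combine[OF g g, where H="\<lambda>y _. max 0 (- y)"] continuous_intros)
  obtain lP where lP: "((\<lambda>t. \<integral>x. u t x * P x \<partial>lborel) \<longlongrightarrow> lP) (at_right 0)"
    using trace_nonneg[OF P] by (auto simp: P_def)
  obtain lM where lM: "((\<lambda>t. \<integral>x. u t x * M x \<partial>lborel) \<longlongrightarrow> lM) (at_right 0)"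
    using trace_nonneg[OF M] by (auto simp: M_def)
  have "((\<lambda>t. (\<integral>x. u t x * P x \<partial>lborel) - (\<integral>x. u t x * M x \<partial>lborel)) \<longlongrightarrow> lP - lM) (at_right 0)"
    by (rule tendsto_diff[OF lP lM])
  moreover have "\<forall>\<^sub>F t in at_right 0. (\<integral>x. u t x * P x \<partial>lborel) - (\<integral>x. u t x * M x \<partial>lborel) = (\<integral>x. u t x * g x \<partial>lborel)"
    using eventually_at_right_less[of 0]
  proof eventually_elim
    case (elim t)
    have "u t x * g x = u t x * P x - u t x * M x" for x by (auto simp: P_def M_def max_def)
    then show ?case
      using Bochner_Integration.integral_diff[OF integrable_u_Cc[OF elim P] integrable_u_Cc[OF elim M]] by simp
  qed
  ultimately have lim: "((\<lambda>t. \<integral>x. u t x * g x \<partial>lborel) \<longlongrightarrow> lP - lM) (at_right 0)"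
    by (rule Lim_transform_eventually)
  then have "trace g = lP - lM" unfolding trace_def by (intro tendsto_Lim) simp_all
  with lim show ?thesis by simp
qed

lemma trace_eqI:
  assumes "g \<in> Cc (regular_set f u)" "(F \<longlongrightarrow> l) (at_right 0)"
    "\<And>t. 0 < t \<Longrightarrow> F t = (\<integral>x. u t x * g x \<partial>lborel)"
  shows "trace g = l"
proof (rule tendsto_unique[OF _ trace_tendsto[OF assms(1)]])
  show "((\<lambda>t. \<integral>x. u t x * g x \<partial>lborel) \<longlongrightarrow> l) (at_right 0)"
    using eventually_at_right_less[of 0] by (intro Lim_transform_eventually[OF assms(2)]) (auto elim!: eventually_mono simp: assms(3))
qed simp

lemma positive_functional_trace: "positive_functional (regular_set f u) trace"
proof
  show "open (regular_set f u)" by (rule open_regular_set)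
next
  fix g h assume gh: "g \<in> Cc (regular_set f u)" "h \<in> Cc (regular_set f u)"
  show "trace (\<lambda>x. g x + h x) = trace g + trace h"
    by (rule trace_eqI[OF Cc_add[OF gh] tendsto_add[OF trace_tendsto[OF gh(1)] trace_tendsto[OF gh(2)]]])
       (use gh integrable_u_Cc in \<open>simp add: distrib_left\<close>)
next
  fix g c assume g: "g \<in> Cc (regular_set f u)"
  show "trace (\<lambda>x. c * g x) = c * trace g"
    by (rule trace_eqI[OF Cc_cmult[OF g] tendsto_mult_left[OF trace_tendsto[OF g]]])
       (simp add: mult.left_commute)
next
  fix g assume g: "g \<in> Cc (regular_set f u)" "\<And>x. 0 \<le> g x"
  show "0 \<le> trace g"
  proof (rule tendsto_lowerbound[OF trace_tendsto[OF g(1)]])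
    show "\<forall>\<^sub>F t in at_right 0. 0 \<le> (\<integral>x. u t x * g x \<partial>lborel)"
      using eventually_at_right_less[of 0]
      by eventually_elim (use u_nonneg g(2) in \<open>auto intro!: Bochner_Integration.integral_nonneg\<close>)
  qed simp
qed

end

lemma C2_0_subset_Cc: "C2_0 \<Omega> \<subseteq> Cc \<Omega>"
proof
  fix \<zeta> assume \<zeta>: "\<zeta> \<in> C2_0 \<Omega>"
  then obtain D where "\<And>x. (\<zeta> has_derivative blinfun_apply (D x)) (at x)"
    unfolding C2_0_def C2_fun_def by blast
  then have "continuous_on UNIV \<zeta>"
    by (auto intro!: continuous_at_imp_continuous_on has_derivative_continuous)
  then show "\<zeta> \<in> Cc \<Omega>"
    using \<zeta> closure_subset[of "{x. \<zeta> x \<noteq> 0}"] unfolding C2_0_def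
    by (intro CcI[of _ "closure {x. \<zeta> x \<noteq> 0}"]) auto
qed

theorem theoremA:
  fixes s :: real
    and f :: "real \<Rightarrow> 'a::euclidean_space \<Rightarrow> real \<Rightarrow> real"
    and u :: "real \<Rightarrow> 'a \<Rightarrow> real"
  assumes "0 < s" and "s < 1"
    and "caratheodory f"
    and "\<And>t x r. t > 0 \<Longrightarrow> f t x r * r \<ge> 0"
    and "classical_solution s f u"
    and "\<And>t x. t > 0 \<Longrightarrow> u t x \<ge> 0"
  shows "\<exists>\<nu> :: 'a measure. radon_measure_on (regular_set f u) \<nu> \<and>
    (\<forall>\<zeta> \<in> C2_0 (regular_set f u).
       ((\<lambda>t. LINT x:regular_set f u|lebesgue. u t x * \<zeta> x)
          \<longlongrightarrow> (LINT x|\<nu>. \<zeta> x)) (at_right 0))"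
proof -
  interpret nonneg_solution s f u
    using assms by unfold_locales auto
  let ?\<Omega> = "regular_set f u"
  obtain \<nu> where \<nu>: "radon_measure_on ?\<Omega> \<nu>" "\<And>g. g \<in> Cc ?\<Omega> \<Longrightarrow> (LINT x|\<nu>. g x) = trace g"
    using riesz_representation[OF positive_functional_trace] by blast
  have "((\<lambda>t. LINT x:?\<Omega>|lebesgue. u t x * \<zeta> x) \<longlongrightarrow> (LINT x|\<nu>. \<zeta> x)) (at_right 0)"
    if "\<zeta> \<in> C2_0 ?\<Omega>" for \<zeta>
  proof -
    have \<zeta>: "\<zeta> \<in> Cc ?\<Omega>" using that C2_0_subset_Cc by blast
    then have out: "\<zeta> x = 0" if "x \<notin> ?\<Omega>" for x using that by (auto simp: Cc_def)
    have "\<forall>\<^sub>F t in at_right 0. (\<integral>x. u t x * \<zeta> x \<partial>lborel) = (LINT x:?\<Omega>|lebesgue. u t x * \<zeta> x)"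
      using eventually_at_right_less[of 0]
    proof eventually_elim
      case (elim t)
      have "(LINT x:?\<Omega>|lebesgue. u t x * \<zeta> x) = (LINT x|lebesgue. u t x * \<zeta> x)"
        unfolding set_lebesgue_integral_def using out
        by (intro Bochner_Integration.integral_cong) (auto simp: indicator_def)
      also have "\<dots> = (\<integral>x. u t x * \<zeta> x \<partial>lborel)"
        using integrable_u_Cc[OF elim \<zeta>] by (intro integral_completion) auto
      finally show ?case by simp
    qed
    with trace_tendsto[OF \<zeta>] show ?thesis
      unfolding \<nu>(2)[OF \<zeta>] by (rule Lim_transform_eventually)
  qed
  with \<nu>(1) show ?thesis by blast
qed

end
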